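(* Let $q\ge1$ and let $A=(a_1,\ldots,a_q)$, $B=(b_1,\ldots,b_q)$ be real vectors with $B\prec^W A$ and $\psi=\sum_{i=1}^{q}(b_i-a_i)>0$. Let $\sigma\ge2$ and $|\arg(z)|<\pi/\sigma$. Then $$ {}_{q+1}F_q(\sigma,A;B;-z)=\int_{0}^{\infty}\frac{\varphi(y)\,dy}{y^{\sigma}+z^{\sigma}}, $$ where $$ \varphi(y)=\frac{\sigma y^{\sigma-1}}{\pi}\left(\prod_{i=1}^{q}\frac{\Gamma(b_i)}{\Gamma(a_i)}\right)\int_{0}^{1}\frac{\sin\left\{\sigma\arctan\left(\frac{ty\sin(\pi/\sigma)}{1+ty\cos(\pi/\sigma)}\right)\right\}}{t\left(1+2ty\cos(\pi/\sigma)+t^2y^2\right)^{\sigma/2}}\,G^{q,0}_{q,q}\left(t\,\Big|\begin{array}{c}B\\ A\end{array}\right)dt. $$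
   Context: $B\prec^W A$ means: $0<a_1\le\cdots\le a_q$, $0<b_1\le\cdots\le b_q$, and $\sum_{i=1}^{k}a_i\le\sum_{i=1}^{k}b_i$ for $k=1,\ldots,q$. The generalized hypergeometric function is ${}_{q+1}F_q(\sigma,A;B;z)=\sum_{n=0}^{\infty}\frac{(\sigma)_n(a_1)_n\cdots(a_q)_n}{(b_1)_n\cdots(b_q)_n\,n!}z^n$ for $|z|<1$, extended by analytic continuation to $\mathbb{C}\setminus[1,\infty)$; $(a)_0=1$, $(a)_n=a(a+1)\cdots(a+n-1)$. Powers are principal branches. Meijer's function is $$G^{q,0}_{q,q}\left(x\,\Big|\begin{array}{c}B\\ A\end{array}\right)=\frac{1}{2\pi i}\int_{c-i\infty}^{c+i\infty}\frac{\Gamma(a_1+s)\cdots\Gamma(a_q+s)}{\Gamma(b_1+s)\cdots\Gamma(b_q+s)}x^{-s}\,ds,\qquad c>-\min(a_1,\ldots,a_q),$$ for $x>0$, the integral being understood as $\lim_{R\to\infty}\int_{c-iR}^{c+iR}$. *)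

theory Defs
  imports "HOL-Complex_Analysis.Complex_Analysis"
begin

definition weak_supermajorized :: "real list \<Rightarrow> real list \<Rightarrow> bool"
    (infix "\<prec>\<^sup>W" 50) where
  "B \<prec>\<^sup>W A \<longleftrightarrow> length B = length A \<and>
     sorted A \<and> (\<forall>a\<in>set A. 0 < a) \<and> sorted B \<and> (\<forall>b\<in>set B. 0 < b) \<and>
     (\<forall>k\<in>{1..length A}. sum_list (take k A) \<le> sum_list (take k B))"

definition slit_plane :: "complex set" where
  "slit_plane = - (complex_of_real ` {1..})"

definition hypergeometric_F :: "real \<Rightarrow> real list \<Rightarrow> real list \<Rightarrow> complex \<Rightarrow> complex" where
  "hypergeometric_F \<sigma> A B =
     (SOME f. f holomorphic_on slit_plane \<and>
        (\<forall>z\<in>ball 0 1. f z =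
           eval_fps (fps_hypergeo (map complex_of_real (\<sigma> # A)) (map complex_of_real B) 1) z))"

text \<open>The choice is immaterial on the slit plane: the analytic continuation is unique.\<close>

lemma hypergeometric_F_eqI:
  assumes f: "f holomorphic_on slit_plane"
    and eq: "\<And>z. z \<in> ball 0 1 \<Longrightarrow> f z =
      eval_fps (fps_hypergeo (map complex_of_real (\<sigma> # A)) (map complex_of_real B) 1) z"
    and z: "z \<in> slit_plane"
  shows "hypergeometric_F \<sigma> A B z = f z"
proof -
  let ?S = "eval_fps (fps_hypergeo (map complex_of_real (\<sigma> # A)) (map complex_of_real B) 1)"
  let ?P = "\<lambda>f. f holomorphic_on slit_plane \<and> (\<forall>z\<in>ball 0 1. f z = ?S z)"
  have "?P f" using f eq by blast
  then have "?P (Eps ?P)" by (rule someI[where P = ?P])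
  then have g: "?P (hypergeometric_F \<sigma> A B)"
    unfolding hypergeometric_F_def .
  have sub: "ball 0 1 \<subseteq> slit_plane"
    by (auto simp: slit_plane_def)
  have op: "open slit_plane"
    unfolding slit_plane_def by (intro open_Compl closed_slot_right)
  have con: "connected slit_plane"
    unfolding slit_plane_def
    by (intro starlike_imp_connected starlike_slotted_complex_plane_right)
  show ?thesis
    by (rule analytic_continuation_open[of "ball 0 1" slit_plane "hypergeometric_F \<sigma> A B" f])
       (use sub op con f g eq z in auto)
qed

text \<open>
  Meijer's function with upper row \<open>B\<close> and lower row \<open>A\<close>, computed on the vertical line
  through \<open>c\<close>; its value does not depend on \<open>c > - Min (set A)\<close>.
\<close>

definition meijer_G :: "real \<Rightarrow> real list \<Rightarrow> real list \<Rightarrow> real \<Rightarrow> complex" where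
  "meijer_G c B A x =
     Lim at_top (\<lambda>R::real. 1 / (2 * complex_of_real pi * \<i>) *
       contour_integral (linepath (Complex c (- R)) (Complex c R))
         (\<lambda>s. (\<Prod>a\<leftarrow>A. Gamma (complex_of_real a + s)) / (\<Prod>b\<leftarrow>B. Gamma (complex_of_real b + s))
               * complex_of_real x powr (- s)))"

definition phi_integrand :: "real \<Rightarrow> real \<Rightarrow> real list \<Rightarrow> real list \<Rightarrow> real \<Rightarrow> real \<Rightarrow> complex" where
  "phi_integrand c \<sigma> A B y t =
     complex_of_real
       (sin (\<sigma> * arctan (t * y * sin (pi / \<sigma>) / (1 + t * y * cos (pi / \<sigma>))))
        / (t * (1 + 2 * t * y * cos (pi / \<sigma>) + t\<^sup>2 * y\<^sup>2) powr (\<sigma> / 2)))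
     * meijer_G c B A t"

definition phi :: "real \<Rightarrow> real \<Rightarrow> real list \<Rightarrow> real list \<Rightarrow> real \<Rightarrow> complex" where
  "phi c \<sigma> A B y =
     complex_of_real (\<sigma> * y powr (\<sigma> - 1) / pi * (\<Prod>i<length A. Gamma (B ! i) / Gamma (A ! i)))
     * (LBINT t:{0<..<1}. phi_integrand c \<sigma> A B y t)"

end

theory Submission
  imports Defs
begin

text \<open>
  Let \<open>h(s) = \<Prod> \<Gamma>(a\<^sub>i + s) / \<Prod> \<Gamma>(b\<^sub>i + s)\<close>. On a half-plane \<open>Re s \<ge> - \<mu>\<close> with
  \<open>0 < \<mu> < a\<^sub>1\<close> one has \<open>h(s) = O(|s|\<^sup>-\<^sup>\<psi>)\<close> and \<open>h'(s) = O(|s|\<^sup>-\<^sup>\<psi>\<^sup>-\<^sup>1)\<close>. One integration by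
  parts then shows that the truncated integrals defining \<open>G(t)\<close> converge for \<open>0 < t < 1\<close> and are
  dominated by \<open>t\<^sup>\<mu> (1 - t)\<^sup>\<delta>\<^sup>-\<^sup>1\<close>; by dominated convergence, Fubini and Cauchy's formula the
  moments of \<open>G(t) / t\<close> are the values \<open>h(n)\<close>. Expanding the binomial and continuing analytically gives
  the Euler representation of \<open>F(-z)\<close>, up to the Gamma factors, as the integral of
  \<open>(1 + t z)\<^sup>-\<^sup>\<sigma> G(t) / t\<close> over \<open>(0, 1)\<close>. The kernel \<open>(1 + t z)\<^sup>-\<^sup>\<sigma>\<close> is a Stieltjes transform in
  \<open>z\<^sup>\<sigma>\<close>, with density read off from its boundary values on the rays \<open>arg z = \<plusminus>\<pi>/\<sigma>\<close>, and Fubini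
  finishes the proof.
\<close>

text \<open>For \<open>\<psi>\<close> at most 1 the quotient h is not absolutely integrable on
  vertical lines, so Fubini's theorem does not apply to the integral defining G. Exchanges with that
  integral are therefore made over [-R, R], and R tends to infinity afterwards under a majorant
  independent of R. The interpolation exponent \<open>\<delta>\<close> gives up a little of the
  decay in s and buys an integrable singularity at t = 1. The line Re s = -\<open>\<mu>\<close> lies
  to the left of 0 so that G(t)/t is dominated near 0 by the integrable t^(\<open>\<mu>\<close> -
  1). This margin is used again at the end: part of t^\<open>\<mu>\<close> is exchanged for decay in
  y of the Stieltjes density, without which the last double integral would not be absolutely
  convergent. The angle pi/\<open>\<sigma>\<close> is dictated by the denominator: on the rays at
  this angle zeta^\<open>\<sigma>\<close> = -y^\<open>\<sigma>\<close>, so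
  zeta^\<open>\<sigma>\<close> - z^\<open>\<sigma>\<close> becomes -(y^\<open>\<sigma>\<close> +
  z^\<open>\<sigma>\<close>). The conclusion also asserts integrability, because a Bochner integral
  that does not exist has the value 0 and an equation between integrals alone could hold for the
  wrong reason.\<close>

section \<open>Growth of the Gamma quotient\<close>

lemma ln_norm_one_plus_approx:
  fixes x :: complex
  assumes "Re x \<ge> 0"
  shows "\<bar>ln (norm (1 + x)) - Re x\<bar> \<le> 3 / 2 * norm x ^ 2"
proof -
  \<comment> \<open>This is ln(1 + r) <= r applied to |1 + u|^2 = 1 + 2 Re u + |u|^2.\<close>
  have upper: "ln (norm (1 + u)) \<le> Re u + norm u ^ 2 / 2" if "1 + u \<noteq> 0" for u :: complex
  proof -
    have n: "norm (1 + u) ^ 2 = 1 + (2 * Re u + norm u ^ 2)"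
      unfolding cmod_power2 by (simp add: algebra_simps power2_eq_square)
    have "2 * ln (norm (1 + u)) = ln (norm (1 + u) ^ 2)"
      using that by (simp add: ln_realpow)
    also have "\<dots> \<le> 2 * Re u + norm u ^ 2"
      unfolding n by (rule ln_add_one_self_le_self2) (use that n in \<open>smt (verit) zero_less_norm_iff zero_less_power\<close>)
    finally show ?thesis by simp
  qed
  have ge1: "norm (1 + x) \<ge> 1"
    using assms abs_Re_le_cmod[of "1 + x"] by simp
  then have nz: "1 + x \<noteq> 0" by auto
  \<comment> \<open>The lower bound for ln |1 + x| is the upper bound at this u, because 1 + u =
    1/(1 + x). Since |1 + x| >= 1, one has |u| <= |x|; the error |x|^2/2 plus the error |x|^2 of Re
    u gives the constant 3/2.\<close>
  define u where "u = - x / (1 + x)"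
  have u1: "1 + u = 1 / (1 + x)" using nz by (simp add: u_def field_simps)
  have "ln (norm (1 + u)) = - ln (norm (1 + x))"
    using ge1 by (simp add: u1 norm_divide ln_div)
  moreover have "ln (norm (1 + u)) \<le> Re u + norm u ^ 2 / 2"
    by (rule upper) (use nz in \<open>simp add: u1\<close>)
  moreover have "norm u \<le> norm x"
    using ge1 nz by (simp add: u_def norm_divide divide_le_eq mult_le_cancel_left1)
  then have "norm u ^ 2 \<le> norm x ^ 2" by (simp add: power_mono)
  moreover have "norm x ^ 2 \<ge> 0" by simp
  moreover have "Re u \<le> - Re x + norm x ^ 2"
  proof -
    have "u = - x + x^2 / (1 + x)" using nz by (simp add: u_def field_simps power2_eq_square)
    then have "Re u = - Re x + Re (x^2 / (1 + x))" by simp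
    also have "Re (x^2 / (1 + x)) \<le> norm (x^2 / (1 + x))" by (rule complex_Re_le_cmod)
    also have "\<dots> = norm x ^ 2 / norm (1 + x)" by (simp add: norm_divide norm_power)
    also have "\<dots> \<le> norm x ^ 2" using ge1 by (simp add: divide_le_eq mult_le_cancel_left1)
    finally show ?thesis by simp
  qed
  ultimately show ?thesis using upper[OF nz] unfolding abs_le_iff by linarith
qed

text \<open>With r = |w| and Re w >= 0, |w + k|^2 >= r^2 + k^2 >= (r + k)^2 / 2, and the sum of
  1/((r + k)(r + k + 1)) telescopes. The bound decays like 1/r for large r, which the digamma
  estimate needs.\<close>

lemma sum_inverse_squares_le:
  fixes w :: complex
  assumes "Re w \<ge> 0" "w \<noteq> 0"
  shows "(\<Sum>k<n. 1 / norm (w + of_nat k) ^ 2) \<le> 2 / norm w + 1 / norm w ^ 2"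
proof -
  let ?r = "norm w"
  have r: "?r > 0" using assms by simp
  have step: "1 / norm (w + of_nat (Suc k)) ^ 2 \<le> 2 * (1 / (?r + real k) - 1 / (?r + real (Suc k)))" for k
  proof -
    have "norm (w + of_nat (Suc k)) ^ 2 = ?r ^ 2 + 2 * Re w * real (Suc k) + real (Suc k) ^ 2"
      by (simp only: cmod_power2 plus_complex.simps complex_Re_of_nat complex_Im_of_nat)
        (simp add: power2_eq_square algebra_simps)
    then have "norm (w + of_nat (Suc k)) ^ 2 \<ge> ?r ^ 2 + real (Suc k) ^ 2"
      using assms by simp
    moreover have "(?r + real (Suc k))^2 \<le> 2 * (?r ^ 2 + real (Suc k) ^ 2)"
      using sum_squares_bound[of ?r "real (Suc k)"] by (simp add: power2_eq_square algebra_simps)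
    moreover have "(?r + real k) * (?r + real (Suc k)) \<le> (?r + real (Suc k))^2"
      using r by (simp add: power2_eq_square mult_right_mono)
    ultimately have "(?r + real k) * (?r + real (Suc k)) \<le> 2 * norm (w + of_nat (Suc k)) ^ 2"
      by (meson order_trans mult_left_mono zero_le_numeral)
    moreover have "(?r + real k) * (?r + real (Suc k)) > 0" using r by (simp add: add_pos_nonneg)
    ultimately have "1 / (2 * norm (w + of_nat (Suc k)) ^ 2) \<le> 1 / ((?r + real k) * (?r + real (Suc k)))"
      by (intro divide_left_mono mult_pos_pos[of "_ * _"]) (auto intro: order.strict_trans2 simp del: of_nat_Suc)
    moreover have "1 / ((?r + real k) * (?r + real (Suc k))) = 1 / (?r + real k) - 1 / (?r + real (Suc k))"
    proof -
      have "?r + real k > 0" "?r + real (Suc k) > 0" using r by linarith+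
      then show ?thesis by (simp add: divide_simps)
    qed
    ultimately show ?thesis by simp
  qed
  have "(\<Sum>k<Suc n. 1 / norm (w + of_nat k) ^ 2) = 1 / ?r ^ 2 + (\<Sum>k<n. 1 / norm (w + of_nat (Suc k)) ^ 2)"
    by (subst sum.lessThan_Suc_shift) simp
  also have "(\<Sum>k<n. 1 / norm (w + of_nat (Suc k)) ^ 2)
      \<le> (\<Sum>k<n. 2 * (1 / (?r + real k) - 1 / (?r + real (Suc k))))"
    by (intro sum_mono step)
  also have "\<dots> = 2 * (1 / ?r - 1 / (?r + real n))"
    unfolding sum_distrib_left [symmetric]
    using sum_lessThan_telescope'[of "\<lambda>k. 1 / (?r + real k)" n] by simp
  also have "\<dots> \<le> 2 / ?r" using r by simp
  finally have "(\<Sum>k<Suc n. 1 / norm (w + of_nat k) ^ 2) \<le> 2 / ?r + 1 / ?r ^ 2" by simp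
  moreover have "(\<Sum>k<n. 1 / norm (w + of_nat k) ^ 2) \<le> (\<Sum>k<Suc n. 1 / norm (w + of_nat k) ^ 2)" by simp
  ultimately show ?thesis by linarith
qed

text \<open>Gamma(w + alpha) has the size of Gamma(w) |w|^alpha, uniformly on Re w >= epsilon. In
  Euler's limit the ratio is governed by the product of |1 + alpha/(w + k)|, which is compared with
  the product of |1 + 1/(w + k)|^alpha. The latter telescopes, and the terms of first order in 1/(w
  + k) cancel in the logarithms, so the error is a sum of inverse squares.\<close>

lemma Gamma_shift_bounds:
  fixes \<alpha> \<epsilon> :: real
  assumes "\<alpha> \<ge> 0" "\<epsilon> > 0"
  obtains C where "C > 0"
    "\<And>w::complex. Re w \<ge> \<epsilon> \<Longrightarrow> norm (Gamma (w + of_real \<alpha>)) \<le> C * (norm (Gamma w) * norm w powr \<alpha>)"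
    "\<And>w::complex. Re w \<ge> \<epsilon> \<Longrightarrow> norm (Gamma w) * norm w powr \<alpha> \<le> C * norm (Gamma (w + of_real \<alpha>))"
proof -
  \<comment> \<open>The quadratic error is 3/2 alpha^2 from the shift by alpha and alpha * 3/2 from
    the shift by 1; the last factor is the sum of inverse squares with |w| >= epsilon
    inserted.\<close>
  define K where "K = 3 / 2 * (\<alpha>^2 + \<alpha>) * (2 / \<epsilon> + 1 / \<epsilon>^2)"
  have main: "norm (Gamma (w + of_real \<alpha>)) \<le> exp K * (norm (Gamma w) * norm w powr \<alpha>) \<and>
      norm (Gamma w) * norm w powr \<alpha> \<le> exp K * norm (Gamma (w + of_real \<alpha>))"
    if w: "Re w \<ge> \<epsilon>" for w :: complex
  proof -
    have wpos: "norm w \<ge> \<epsilon>" using w complex_Re_le_cmod[of w] by linarith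
    have wn: "norm w > 0" using wpos assms by linarith
    have nz: "w + of_nat k \<noteq> 0" for k
      using w assms by (auto simp: complex_eq_iff)
    have nza: "w + of_real \<alpha> + of_nat k \<noteq> 0" for k
      using w assms by (auto simp: complex_eq_iff)
    define N where "N n = (\<Sum>k\<le>n. ln (norm (1 + of_real \<alpha> / (w + of_nat k))))" for n
    have approx: "\<bar>ln (norm (1 + of_real \<beta> / (w + of_nat k))) - \<beta> * Re (1 / (w + of_nat k))\<bar>
        \<le> 3 / 2 * \<beta>^2 * (1 / norm (w + of_nat k) ^ 2)" if "\<beta> \<ge> 0" for \<beta> k
    proof -
      have "Re (of_real \<beta> / (w + of_nat k)) = \<beta> * Re (1 / (w + of_nat k))"
        by (simp add: Re_divide)
      moreover have "Re (1 / (w + of_nat k)) \<ge> 0"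
        using w assms by (simp add: Re_divide)
      moreover have "norm (of_real \<beta> / (w + of_nat k)) ^ 2 = \<beta>^2 * (1 / norm (w + of_nat k) ^ 2)"
        by (simp add: norm_divide power_divide)
      ultimately show ?thesis
        using ln_norm_one_plus_approx[of "of_real \<beta> / (w + of_nat k)"] that
        by (simp only: mult_nonneg_nonneg mult.assoc)
    qed
    have M: "(\<Sum>k\<le>n. ln (norm (1 + 1 / (w + of_nat k)))) = ln (norm (w + of_nat (Suc n)) / norm w)" for n
    proof -
      have "(\<Sum>k\<le>n. ln (norm (1 + 1 / (w + of_nat k))))
          = (\<Sum>k<Suc n. ln (norm (w + of_nat (Suc k))) - ln (norm (w + of_nat k)))"
        unfolding lessThan_Suc_atMost
      proof (intro sum.cong refl)
        fix k
        have "1 + 1 / (w + of_nat k) = (w + of_nat (Suc k)) / (w + of_nat k)"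
          using nz[of k] by (simp add: field_simps)
        then show "ln (norm (1 + 1 / (w + of_nat k))) = ln (norm (w + of_nat (Suc k))) - ln (norm (w + of_nat k))"
          using nz[of k] nz[of "Suc k"] by (simp add: norm_divide ln_div del: of_nat_Suc)
      qed
      also have "\<dots> = ln (norm (w + of_nat (Suc n))) - ln (norm w)"
        by (subst sum_lessThan_telescope) simp
      also have "\<dots> = ln (norm (w + of_nat (Suc n)) / norm w)"
        using nz[of "Suc n"] wn by (simp add: ln_div del: of_nat_Suc)
      finally show ?thesis .
    qed
    have NM: "\<bar>N n - \<alpha> * ln (norm (w + of_nat (Suc n)) / norm w)\<bar> \<le> K" for n
    proof -
      have "\<bar>N n - \<alpha> * ln (norm (w + of_nat (Suc n)) / norm w)\<bar>
          = \<bar>\<Sum>k\<le>n. ln (norm (1 + of_real \<alpha> / (w + of_nat k))) - \<alpha> * ln (norm (1 + 1 / (w + of_nat k)))\<bar>"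
        unfolding N_def M [symmetric] by (simp only: sum_subtractf sum_distrib_left)
      also have "\<dots> \<le> (\<Sum>k\<le>n. \<bar>ln (norm (1 + of_real \<alpha> / (w + of_nat k))) - \<alpha> * ln (norm (1 + 1 / (w + of_nat k)))\<bar>)"
        by (rule sum_abs)
      also have "\<dots> \<le> (\<Sum>k\<le>n. 3 / 2 * (\<alpha>^2 + \<alpha>) * (1 / norm (w + of_nat k) ^ 2))"
      proof (rule sum_mono)
        fix k
        let ?a = "ln (norm (1 + of_real \<alpha> / (w + of_nat k)))" and ?b = "ln (norm (1 + 1 / (w + of_nat k)))"
          and ?r = "Re (1 / (w + of_nat k))" and ?s = "1 / norm (w + of_nat k) ^ 2"
        have 1: "\<bar>?a - \<alpha> * ?r\<bar> \<le> 3 / 2 * \<alpha>^2 * ?s" by (rule approx) fact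
        have "\<bar>?b - ?r\<bar> \<le> 3 / 2 * ?s" using approx[of 1 k] by simp
        then have "\<bar>\<alpha> * (?b - ?r)\<bar> \<le> \<alpha> * (3 / 2 * ?s)"
          using assms(1) by (simp only: abs_mult) (intro mult_mono; simp)
        moreover have "?a - \<alpha> * ?b = (?a - \<alpha> * ?r) - \<alpha> * (?b - ?r)" by (simp add: algebra_simps)
        moreover have "3 / 2 * (\<alpha>^2 + \<alpha>) * ?s = 3 / 2 * \<alpha>^2 * ?s + \<alpha> * (3 / 2 * ?s)"
          by (simp add: algebra_simps)
        ultimately show "\<bar>?a - \<alpha> * ?b\<bar> \<le> 3 / 2 * (\<alpha>^2 + \<alpha>) * ?s"
          using 1 abs_triangle_ineq4[of "?a - \<alpha> * ?r" "\<alpha> * (?b - ?r)"] by linarith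
      qed
      also have "\<dots> = 3 / 2 * (\<alpha>^2 + \<alpha>) * (\<Sum>k<Suc n. 1 / norm (w + of_nat k) ^ 2)"
        by (simp only: sum_distrib_left lessThan_Suc_atMost)
      also have "\<dots> \<le> K"
        unfolding K_def
      proof (intro mult_left_mono)
        have "(\<Sum>k<Suc n. 1 / norm (w + of_nat k) ^ 2) \<le> 2 / norm w + 1 / norm w ^ 2"
          by (rule sum_inverse_squares_le) (use w assms wn in auto)
        also have "\<dots> \<le> 2 / \<epsilon> + 1 / \<epsilon>^2"
          using wpos wn assms by (intro add_mono divide_left_mono power_mono) auto
        finally show "(\<Sum>k<Suc n. 1 / norm (w + of_nat k) ^ 2) \<le> 2 / \<epsilon> + 1 / \<epsilon>^2" .
      qed (use assms in auto)
      finally show ?thesis .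
    qed
    \<comment> \<open>Euler's approximant is n! n^w divided by the Pochhammer symbol with n + 1
      factors. Quotients of these symbols give the product over k <= n, and the quotient of the
      powers of n has modulus n^alpha.\<close>
    have expN: "norm (Gamma_series w n) * real n powr \<alpha> = norm (Gamma_series (w + of_real \<alpha>) n) * exp (N n)"
      if "n > 0" for n
    proof -
      have "exp (N n) = (\<Prod>k\<le>n. norm (1 + of_real \<alpha> / (w + of_nat k)))"
        unfolding N_def
      proof (subst exp_sum, simp, intro prod.cong refl)
        fix k
        have "1 + of_real \<alpha> / (w + of_nat k) = (w + of_real \<alpha> + of_nat k) / (w + of_nat k)"
          using nz[of k] by (simp add: field_simps)
        then have "1 + of_real \<alpha> / (w + of_nat k) \<noteq> 0" using nz nza by simp
        then show "exp (ln (norm (1 + of_real \<alpha> / (w + of_nat k)))) = norm (1 + of_real \<alpha> / (w + of_nat k))"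
          by simp
      qed
      also have "\<dots> = norm (\<Prod>k\<le>n. (w + of_real \<alpha> + of_nat k) / (w + of_nat k))"
        unfolding prod_norm [symmetric] using nz by (intro prod.cong refl) (simp add: field_simps)
      also have "(\<Prod>k\<le>n. (w + of_real \<alpha> + of_nat k) / (w + of_nat k))
          = pochhammer (w + of_real \<alpha>) (Suc n) / pochhammer w (Suc n)"
        by (simp add: pochhammer_prod prod_dividef atLeast0AtMost atLeastLessThanSuc_atLeastAtMost)
      finally have e: "exp (N n) = norm (pochhammer (w + of_real \<alpha>) (Suc n)) / norm (pochhammer w (Suc n))"
        by (simp add: norm_divide)
      have p: "pochhammer (w + of_real \<alpha>) (Suc n) \<noteq> 0"
        unfolding pochhammer_eq_0_iff using nza by (metis add_eq_0_iff2 add.commute)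
      have "exp ((w + of_real \<alpha>) * of_real (ln (real n)))
          = exp (w * of_real (ln (real n))) * of_real (exp (\<alpha> * ln (real n)))"
        by (simp add: distrib_right exp_add exp_of_real flip: of_real_mult)
      moreover have "exp (\<alpha> * ln (real n)) = real n powr \<alpha>" using \<open>n > 0\<close> by (simp add: powr_def)
      ultimately have "exp ((w + of_real \<alpha>) * of_real (ln (real n)))
          = exp (w * of_real (ln (real n))) * of_real (real n powr \<alpha>)" by simp
      then show ?thesis
        using p unfolding e Gamma_series_def by (simp add: norm_divide norm_mult del: pochhammer_Suc exp_of_real)
    qed
    have lim1: "(\<lambda>n. norm (Gamma_series w n)) \<longlonglongrightarrow> norm (Gamma w)"
      by (intro tendsto_norm Gamma_series_LIMSEQ)
    have lim2: "(\<lambda>n. norm (Gamma_series (w + of_real \<alpha>) n)) \<longlonglongrightarrow> norm (Gamma (w + of_real \<alpha>))"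
      by (intro tendsto_norm Gamma_series_LIMSEQ)
    \<comment> \<open>The telescoped product is |w + n + 1|^alpha / |w|^alpha. Its numerator divided
      by n^alpha is \<open>q n\<close>, which tends to 1 and disappears in the limit.\<close>
    define q where "q n = (norm (w + of_nat (Suc n)) / real n) powr \<alpha>" for n
    have "(\<lambda>n. norm (w / of_nat n + of_nat (Suc n) / of_nat n)) \<longlonglongrightarrow> norm (0 + 1 :: complex)"
      by (intro tendsto_norm tendsto_add lim_const_over_n LIMSEQ_Suc_n_over_n)
    moreover have "norm (w / of_nat n + of_nat (Suc n) / of_nat n) = norm (w + of_nat (Suc n)) / real n" for n
      by (simp only: add_divide_distrib [symmetric] norm_divide norm_of_nat)
    ultimately have "(\<lambda>n. norm (w + of_nat (Suc n)) / real n) \<longlonglongrightarrow> 1" by simp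
    then have "q \<longlonglongrightarrow> 1 powr \<alpha>" unfolding q_def by (intro tendsto_powr tendsto_const) auto
    then have lq: "q \<longlonglongrightarrow> 1" by simp
    have expM: "exp (\<alpha> * ln (norm (w + of_nat (Suc n)) / norm w)) * (norm w powr \<alpha>) = q n * real n powr \<alpha>"
      if "n > 0" for n
    proof -
      have "exp (\<alpha> * ln (norm (w + of_nat (Suc n)) / norm w)) = (norm (w + of_nat (Suc n)) / norm w) powr \<alpha>"
        using nz[of "Suc n"] wn by (simp add: powr_def)
      then show ?thesis using that wn by (simp add: q_def powr_divide)
    qed
    have ineq: "norm (Gamma_series (w + of_real \<alpha>) n) * q n \<le> exp K * (norm (Gamma_series w n) * norm w powr \<alpha>) \<and>
        norm (Gamma_series w n) * norm w powr \<alpha> \<le> exp K * (norm (Gamma_series (w + of_real \<alpha>) n) * q n)"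
      if n: "n > 0" for n
    proof -
      let ?m = "\<alpha> * ln (norm (w + of_nat (Suc n)) / norm w)"
      have np: "real n powr \<alpha> > 0" using n by simp
      have wp: "norm w powr \<alpha> > 0" using wn by simp
      have b: "exp ?m \<le> exp K * exp (N n)" "exp (N n) \<le> exp K * exp ?m"
        using NM[of n] by (auto simp flip: exp_add)
      have "norm (Gamma_series (w + of_real \<alpha>) n) * q n * real n powr \<alpha>
          = norm (Gamma_series (w + of_real \<alpha>) n) * (exp ?m * norm w powr \<alpha>)"
        by (simp only: expM[OF n] mult.assoc)
      also have "\<dots> \<le> norm (Gamma_series (w + of_real \<alpha>) n) * (exp K * exp (N n) * norm w powr \<alpha>)"
        using b(1) wp by (intro mult_left_mono mult_right_mono) auto
      also have "\<dots> = exp K * norm w powr \<alpha> * (norm (Gamma_series (w + of_real \<alpha>) n) * exp (N n))"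
        by (simp add: mult_ac)
      also have "\<dots> = exp K * (norm (Gamma_series w n) * norm w powr \<alpha>) * real n powr \<alpha>"
        unfolding expN[OF n, symmetric] by (simp add: mult_ac)
      finally have 1: "norm (Gamma_series (w + of_real \<alpha>) n) * q n \<le> exp K * (norm (Gamma_series w n) * norm w powr \<alpha>)"
        using np by simp
      have "norm (Gamma_series w n) * norm w powr \<alpha> * real n powr \<alpha>
          = norm w powr \<alpha> * (norm (Gamma_series (w + of_real \<alpha>) n) * exp (N n))"
        unfolding expN[OF n, symmetric] by (simp add: mult_ac)
      also have "\<dots> \<le> norm w powr \<alpha> * (norm (Gamma_series (w + of_real \<alpha>) n) * (exp K * exp ?m))"
        using b(2) wp by (intro mult_left_mono) auto
      also have "\<dots> = exp K * norm (Gamma_series (w + of_real \<alpha>) n) * (exp ?m * norm w powr \<alpha>)"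
        by (simp add: mult_ac)
      also have "\<dots> = exp K * (norm (Gamma_series (w + of_real \<alpha>) n) * q n) * real n powr \<alpha>"
        by (simp only: expM[OF n] mult.assoc)
      finally show ?thesis using 1 np by simp
    qed
    have l1: "(\<lambda>n. norm (Gamma_series (w + of_real \<alpha>) n) * q n) \<longlonglongrightarrow> norm (Gamma (w + of_real \<alpha>)) * 1"
      by (intro tendsto_mult lim2 lq)
    have l2: "(\<lambda>n. norm (Gamma_series w n) * norm w powr \<alpha>) \<longlonglongrightarrow> norm (Gamma w) * norm w powr \<alpha>"
      by (intro tendsto_mult lim1 tendsto_const)
    have "norm (Gamma (w + of_real \<alpha>)) * 1 \<le> exp K * (norm (Gamma w) * norm w powr \<alpha>)"
      by (rule LIMSEQ_le[OF l1 tendsto_mult[OF tendsto_const l2]]) (use ineq in \<open>intro exI[of _ 1]; auto\<close>)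
    moreover have "norm (Gamma w) * norm w powr \<alpha> \<le> exp K * (norm (Gamma (w + of_real \<alpha>)) * 1)"
      by (rule LIMSEQ_le[OF l2 tendsto_mult[OF tendsto_const l1]]) (use ineq in \<open>intro exI[of _ 1]; auto\<close>)
    ultimately show ?thesis by simp
  qed
  show ?thesis by (rule that[of "exp K"]) (use main in auto)
qed

text \<open>In the limit formula for the digamma function the logarithms cancel, and the k-th terms
  differ by alpha / ((w + k)(w + alpha + k)), which is at most alpha / |w + k|^2.\<close>

lemma Digamma_shift_bound:
  fixes \<alpha> \<epsilon> :: real
  assumes "\<alpha> \<ge> 0" "\<epsilon> > 0"
  obtains C where "C \<ge> 0"
    "\<And>w::complex. Re w \<ge> \<epsilon> \<Longrightarrow> norm (Digamma (w + of_real \<alpha>) - Digamma w) \<le> C / norm w"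
proof (rule that[of "\<alpha> * (2 + 1 / \<epsilon>)"])
  show "\<alpha> * (2 + 1 / \<epsilon>) \<ge> 0" using assms by simp
  fix w :: complex
  assume w: "Re w \<ge> \<epsilon>"
  have wpos: "norm w \<ge> \<epsilon>" using w complex_Re_le_cmod[of w] by linarith
  have wn: "norm w > 0" using wpos assms by linarith
  have nz: "w + of_nat k \<noteq> 0" for k
    using w assms by (auto simp: complex_eq_iff)
  have nza: "w + of_real \<alpha> + of_nat k \<noteq> 0" for k
    using w assms by (auto simp: complex_eq_iff)
  have w0: "w \<noteq> 0" "w + of_real \<alpha> \<noteq> 0" using nz[of 0] nza[of 0] by auto
  let ?D = "\<lambda>n. (of_real (ln (real n)) - (\<Sum>k<n. inverse (w + of_real \<alpha> + of_nat k)))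
      - (of_real (ln (real n)) - (\<Sum>k<n. inverse (w + of_nat k)))"
  have "?D \<longlonglongrightarrow> Digamma (w + of_real \<alpha>) - Digamma w"
    by (intro tendsto_diff Digamma_LIMSEQ w0)
  moreover have "norm (?D n) \<le> \<alpha> * (2 + 1 / \<epsilon>) / norm w" for n
  proof -
    have "?D n = (\<Sum>k<n. of_real \<alpha> / ((w + of_nat k) * (w + of_real \<alpha> + of_nat k)))"
      unfolding diff_diff_eq2 by (simp add: sum_subtractf [symmetric])
        (intro sum.cong refl, use nz nza in \<open>simp add: field_simps\<close>)
    also have "norm \<dots> \<le> (\<Sum>k<n. \<alpha> * (1 / norm (w + of_nat k) ^ 2))"
    proof (intro sum_norm_le)
      fix k
      have "norm (w + of_nat k) \<le> norm (w + of_real \<alpha> + of_nat k)"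
        using w assms by (simp add: cmod_def power_mono)
      then have "norm (w + of_nat k) ^ 2 \<le> norm ((w + of_nat k) * (w + of_real \<alpha> + of_nat k))"
        by (simp add: norm_mult power2_eq_square mult_left_mono)
      then have "\<alpha> / norm ((w + of_nat k) * (w + of_real \<alpha> + of_nat k)) \<le> \<alpha> / norm (w + of_nat k) ^ 2"
        using nz[of k] nza[of k] assms by (intro divide_left_mono) auto
      then show "norm (of_real \<alpha> / ((w + of_nat k) * (w + of_real \<alpha> + of_nat k))) \<le> \<alpha> * (1 / norm (w + of_nat k) ^ 2)"
        using assms by (simp add: norm_divide)
    qed
    also have "\<dots> = \<alpha> * (\<Sum>k<n. 1 / norm (w + of_nat k) ^ 2)" by (simp add: sum_distrib_left)
    also have "\<dots> \<le> \<alpha> * (2 / norm w + 1 / norm w ^ 2)"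
      using w assms wn by (intro mult_left_mono sum_inverse_squares_le) auto
    \<comment> \<open>One factor 1/|w| is replaced by 1/epsilon, so that both terms have the form
      constant / |w|.\<close>
    also have "1 / norm w ^ 2 \<le> 1 / (\<epsilon> * norm w)"
      using wpos wn assms by (intro divide_left_mono) (auto simp: power2_eq_square intro: mult_right_mono)
    then have "\<alpha> * (2 / norm w + 1 / norm w ^ 2) \<le> \<alpha> * (2 / norm w + 1 / (\<epsilon> * norm w))"
      using assms by (intro mult_left_mono) auto
    also have "\<dots> = \<alpha> * (2 + 1 / \<epsilon>) / norm w" using wn assms by (simp add: field_simps)
    finally show ?thesis .
  qed
  ultimately show "norm (Digamma (w + of_real \<alpha>) - Digamma w) \<le> \<alpha> * (2 + 1 / \<epsilon>) / norm w"
    using Lim_bounded[of "\<lambda>n. norm (?D n)"] tendsto_norm by blast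
qed

lemma Re_pos_notin_nonpos_Ints: "Re z > 0 \<Longrightarrow> z \<notin> \<int>\<^sub>\<le>\<^sub>0"
  by (auto elim!: nonpos_Ints_cases)

section \<open>Products of Gamma factors and their quotient\<close>

definition gamma_ratio :: "real list \<Rightarrow> real list \<Rightarrow> complex \<Rightarrow> complex" where
  "gamma_ratio A B s = (\<Prod>a\<leftarrow>A. Gamma (of_real a + s)) / (\<Prod>b\<leftarrow>B. Gamma (of_real b + s))"

text \<open>Every factor is measured against the same reference Gamma(s + m). For two lists of equal
  length its powers cancel in the quotient, and only |s + m| to the difference of the sums remains.
  The condition m <= a makes all shifts nonnegative.\<close>

lemma prod_list_Gamma_bounds:
  fixes A :: "real list" and m \<epsilon> :: real
  assumes "\<epsilon> > 0" "\<forall>a\<in>set A. m \<le> a"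
  shows "\<exists>C>0. \<forall>s. \<epsilon> \<le> Re (s + of_real m) \<longrightarrow>
      norm (\<Prod>a\<leftarrow>A. Gamma (of_real a + s)) \<le> C *
        (norm (Gamma (s + of_real m)) ^ length A * norm (s + of_real m) powr (\<Sum>a\<leftarrow>A. a - m)) \<and>
      norm (Gamma (s + of_real m)) ^ length A * norm (s + of_real m) powr (\<Sum>a\<leftarrow>A. a - m) \<le> C *
        norm (\<Prod>a\<leftarrow>A. Gamma (of_real a + s))"
  using assms(2)
proof (induction A)
  case Nil
  have "s + of_real m \<noteq> 0" if "\<epsilon> \<le> Re (s + of_real m)" for s 
    using assms(1) that complex_eq_iff[of "s + of_real m" 0] by auto
  then show ?case by (intro exI[of _ 1]) auto
next
  case (Cons a A)
  then obtain C where C: "C > 0" and IH: "\<forall>s. \<epsilon> \<le> Re (s + of_real m) \<longrightarrow>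
      norm (\<Prod>a\<leftarrow>A. Gamma (of_real a + s)) \<le> C *
        (norm (Gamma (s + of_real m)) ^ length A * norm (s + of_real m) powr (\<Sum>a\<leftarrow>A. a - m)) \<and>
      norm (Gamma (s + of_real m)) ^ length A * norm (s + of_real m) powr (\<Sum>a\<leftarrow>A. a - m) \<le> C *
        norm (\<Prod>a\<leftarrow>A. Gamma (of_real a + s))" by auto
  from Cons.prems have "a - m \<ge> 0" by simp
  then obtain D where D: "D > 0"
    "\<And>w. Re w \<ge> \<epsilon> \<Longrightarrow> norm (Gamma (w + of_real (a - m))) \<le> D * (norm (Gamma w) * norm w powr (a - m))"
    "\<And>w. Re w \<ge> \<epsilon> \<Longrightarrow> norm (Gamma w) * norm w powr (a - m) \<le> D * norm (Gamma (w + of_real (a - m)))"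
    using Gamma_shift_bounds[OF _ assms(1), of "a - m"] by blast
  show ?case
  proof (intro exI[of _ "D * C"] conjI allI impI)
    show "D * C > 0" using C D by simp
    fix s assume s: "\<epsilon> \<le> Re (s + of_real m)"
    define w where "w = s + of_real m"
    define P where "P = norm (\<Prod>a\<leftarrow>A. Gamma (of_real a + s))"
    define E where "E = norm (Gamma w) ^ length A * norm w powr (\<Sum>a\<leftarrow>A. a - m)"
    have aw: "of_real a + s = w + of_real (a - m)" by (simp add: w_def)
    have P: "norm (\<Prod>a\<leftarrow>a # A. Gamma (of_real a + s)) = norm (Gamma (w + of_real (a - m))) * P"
      by (simp add: norm_mult P_def aw)
    have E: "norm (Gamma w) ^ length (a # A) * norm w powr (\<Sum>a\<leftarrow>a # A. a - m)
        = (norm (Gamma w) * norm w powr (a - m)) * E"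
      by (simp add: E_def powr_add)
    have w: "Re w \<ge> \<epsilon>" using s by (simp add: w_def)
    have 1: "P \<le> C * E" "E \<le> C * P" using IH s by (auto simp: P_def E_def w_def)
    have 2: "P \<ge> 0" "E \<ge> 0" by (auto simp: P_def E_def)
    have "norm (Gamma (w + of_real (a - m))) * P \<le> (D * (norm (Gamma w) * norm w powr (a - m))) * (C * E)"
      by (rule mult_mono) (use D(2)[OF w] 1 2 D(1) in auto)
    then show "norm (\<Prod>a\<leftarrow>a # A. Gamma (of_real a + s)) \<le> D * C *
        (norm (Gamma (s + of_real m)) ^ length (a # A) * norm (s + of_real m) powr (\<Sum>a\<leftarrow>a # A. a - m))"
      unfolding w_def[symmetric] P E by (simp add: mult_ac)
    have "(norm (Gamma w) * norm w powr (a - m)) * E \<le> (D * norm (Gamma (w + of_real (a - m)))) * (C * P)"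
      by (rule mult_mono) (use D(3)[OF w] 1 2 D(1) in auto)
    then show "norm (Gamma (s + of_real m)) ^ length (a # A) * norm (s + of_real m) powr (\<Sum>a\<leftarrow>a # A. a - m) \<le> D * C *
        norm (\<Prod>a\<leftarrow>a # A. Gamma (of_real a + s))"
      unfolding w_def[symmetric] P E by (simp add: mult_ac)
  qed
qed

text \<open>The additive counterpart for the logarithmic derivative: the multiples of the reference
  value Digamma(s + m) cancel between two lists of equal length.\<close>

lemma sum_list_Digamma_bound:
  fixes A :: "real list" and m \<epsilon> :: real
  assumes "\<epsilon> > 0" "\<forall>a\<in>set A. m \<le> a"
  shows "\<exists>C\<ge>0. \<forall>s. \<epsilon> \<le> Re (s + of_real m) \<longrightarrow>
      norm ((\<Sum>a\<leftarrow>A. Digamma (of_real a + s)) - of_nat (length A) * Digamma (s + of_real m))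
        \<le> C / norm (s + of_real m)"
  using assms(2)
proof (induction A)
  case Nil
  show ?case by (intro exI[of _ 0]) auto
next
  case (Cons a A)
  then obtain C where C: "C \<ge> 0" and IH: "\<forall>s. \<epsilon> \<le> Re (s + of_real m) \<longrightarrow>
      norm ((\<Sum>a\<leftarrow>A. Digamma (of_real a + s)) - of_nat (length A) * Digamma (s + of_real m))
        \<le> C / norm (s + of_real m)" by auto
  from Cons.prems have "a - m \<ge> 0" by simp
  then obtain D where D: "D \<ge> 0"
    "\<And>w::complex. Re w \<ge> \<epsilon> \<Longrightarrow> norm (Digamma (w + of_real (a - m)) - Digamma w) \<le> D / norm w"
    using Digamma_shift_bound[OF _ assms(1), of "a - m"] by blast
  show ?case
  proof (intro exI[of _ "D + C"] conjI allI impI)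
    show "D + C \<ge> 0" using C D by simp
    fix s assume s: "\<epsilon> \<le> Re (s + of_real m)"
    have "(\<Sum>a\<leftarrow>a # A. Digamma (of_real a + s)) - of_nat (length (a # A)) * Digamma (s + of_real m)
      = (Digamma (s + of_real m + of_real (a - m)) - Digamma (s + of_real m)) +
        ((\<Sum>a\<leftarrow>A. Digamma (of_real a + s)) - of_nat (length A) * Digamma (s + of_real m))"
      by (simp add: algebra_simps)
    also have "norm \<dots> \<le> D / norm (s + of_real m) + C / norm (s + of_real m)"
      by (intro norm_triangle_mono D(2) IH[rule_format] s)
    finally show "norm ((\<Sum>a\<leftarrow>a # A. Digamma (of_real a + s)) - of_nat (length (a # A)) * Digamma (s + of_real m))
      \<le> (D + C) / norm (s + of_real m)" by (simp add: add_divide_distrib)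
  qed
qed

lemma has_field_derivative_prod_list_Gamma:
  assumes "\<forall>a\<in>set A. Re (of_real a + s) > 0"
  shows "((\<lambda>s::complex. \<Prod>a\<leftarrow>A. Gamma (of_real a + s)) has_field_derivative
    (\<Prod>a\<leftarrow>A. Gamma (of_real a + s)) * (\<Sum>a\<leftarrow>A. Digamma (of_real a + s))) (at s)"
  using assms
proof (induction A)
  case (Cons a A)
  have "of_real a + s \<notin> \<int>\<^sub>\<le>\<^sub>0" using Cons.prems by (intro Re_pos_notin_nonpos_Ints) auto
  then have "((\<lambda>s. Gamma (of_real a + s)) has_field_derivative
      Gamma (of_real a + s) * Digamma (of_real a + s)) (at s)"
    by (auto intro!: derivative_eq_intros)
  from DERIV_mult[OF this Cons.IH] Cons.prems show ?case
    by (simp add: algebra_simps)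
qed simp

lemma prod_list_Gamma_nonzero:
  assumes "\<forall>a\<in>set A. Re (of_real a + s) > 0"
  shows "(\<Prod>a\<leftarrow>A. Gamma (of_real a + s :: complex)) \<noteq> 0"
proof -
  have "Gamma (of_real a + s) \<noteq> 0" if "a \<in> set A" for a
    using assms that by (simp only: Gamma_eq_zero_iff Re_pos_notin_nonpos_Ints) simp
  then show ?thesis by (auto simp: prod_list_zero_iff)
qed

lemma gamma_ratio_has_field_derivative:
  assumes "\<forall>a\<in>set A. m \<le> a" "\<forall>b\<in>set B. m \<le> b" "Re s > - m"
  shows "(gamma_ratio A B has_field_derivative gamma_ratio A B s *
    ((\<Sum>a\<leftarrow>A. Digamma (of_real a + s)) - (\<Sum>b\<leftarrow>B. Digamma (of_real b + s)))) (at s)"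
proof -
  have *: "\<forall>a\<in>set A. Re (of_real a + s) > 0" "\<forall>a\<in>set B. Re (of_real a + s) > 0"
    using assms by fastforce+
  show ?thesis
    unfolding gamma_ratio_def
    by (rule DERIV_cong[OF DERIV_divide[OF has_field_derivative_prod_list_Gamma[OF *(1)]
      has_field_derivative_prod_list_Gamma[OF *(2)] prod_list_Gamma_nonzero[OF *(2)]]])
      (use prod_list_Gamma_nonzero[OF *(2)] in \<open>simp add: field_simps\<close>)
qed

text \<open>The bounds are stated with 1 + |s + \<open>\<mu>\<close>| because on the line Re s =
  -\<open>\<mu>\<close> this is 1 + |y|, and because negative powers of it stay bounded. The
  derivative gains one power, since the logarithmic derivative is a difference of digamma sums of
  size 1/|s + m|.\<close>

lemma gamma_ratio_bounds:
  fixes m \<mu> :: real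
  assumes len: "length A = length B" and A: "\<forall>a\<in>set A. m \<le> a" and B: "\<forall>b\<in>set B. m \<le> b"
    and "\<mu> < m" and le: "sum_list A \<le> sum_list B"
  obtains C where "C > 0"
    "\<And>s. Re s \<ge> - \<mu> \<Longrightarrow> norm (gamma_ratio A B s) \<le> C * (1 + norm (s + of_real \<mu>)) powr (sum_list A - sum_list B)"
    "\<And>s. Re s \<ge> - \<mu> \<Longrightarrow> norm (deriv (gamma_ratio A B) s) \<le> C * (1 + norm (s + of_real \<mu>)) powr (sum_list A - sum_list B - 1)"
proof -
  define \<epsilon> where "\<epsilon> = m - \<mu>"
  have \<epsilon>: "\<epsilon> > 0" using assms by (simp add: \<epsilon>_def)
  define \<psi> where "\<psi> = sum_list B - sum_list A"
  have \<psi>: "\<psi> \<ge> 0" using le by (simp add: \<psi>_def)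
  from prod_list_Gamma_bounds[OF \<epsilon> A] obtain C1 where C1: "C1 > 0" "\<And>s. \<epsilon> \<le> Re (s + of_real m) \<Longrightarrow>
      norm (\<Prod>a\<leftarrow>A. Gamma (of_real a + s)) \<le> C1 *
        (norm (Gamma (s + of_real m)) ^ length A * norm (s + of_real m) powr (\<Sum>a\<leftarrow>A. a - m))"
    by blast
  from prod_list_Gamma_bounds[OF \<epsilon> B] obtain C2 where C2: "C2 > 0" "\<And>s. \<epsilon> \<le> Re (s + of_real m) \<Longrightarrow>
      norm (Gamma (s + of_real m)) ^ length B * norm (s + of_real m) powr (\<Sum>a\<leftarrow>B. a - m) \<le> C2 *
        norm (\<Prod>a\<leftarrow>B. Gamma (of_real a + s))"
    by blast
  from sum_list_Digamma_bound[OF \<epsilon> A] obtain D1 where D1: "D1 \<ge> 0" "\<And>s. \<epsilon> \<le> Re (s + of_real m) \<Longrightarrow>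
      norm ((\<Sum>a\<leftarrow>A. Digamma (of_real a + s)) - of_nat (length A) * Digamma (s + of_real m))
        \<le> D1 / norm (s + of_real m)" by blast
  from sum_list_Digamma_bound[OF \<epsilon> B] obtain D2 where D2: "D2 \<ge> 0" "\<And>s. \<epsilon> \<le> Re (s + of_real m) \<Longrightarrow>
      norm ((\<Sum>a\<leftarrow>B. Digamma (of_real a + s)) - of_nat (length B) * Digamma (s + of_real m))
        \<le> D2 / norm (s + of_real m)" by blast
  have sums: "(\<Sum>a\<leftarrow>A. a - m) - (\<Sum>a\<leftarrow>B. a - m) = - \<psi>"
    using len by (simp add: sum_list_subtractf \<psi>_def sum_list_triv)
  \<comment> \<open>From epsilon <= |s + m| one gets 1 <= |s + m| / epsilon, and |s +
    \<open>\<mu>\<close>| <= |s + m| contributes the summand 1.\<close>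
  define k where "k = 1 + 1 / \<epsilon>"
  have k: "k > 0" using \<epsilon> by (simp add: k_def add_pos_pos)
  have base: "1 + norm (s + of_real \<mu>) \<le> k * norm (s + of_real m)" if "Re s \<ge> - \<mu>" for s
  proof -
    have "\<epsilon> \<le> Re (s + of_real m)" using that by (simp add: \<epsilon>_def)
    also have "\<dots> \<le> norm (s + of_real m)" by (rule complex_Re_le_cmod)
    finally have "1 \<le> 1 / \<epsilon> * norm (s + of_real m)" using \<epsilon> by (simp add: field_simps)
    moreover have "norm (s + of_real \<mu>) \<le> norm (s + of_real m)"
      using that assms by (simp add: cmod_def power_mono)
    ultimately show ?thesis by (simp add: k_def algebra_simps)
  qed
  have pw: "norm (s + of_real m) powr (- p) \<le> k powr p * (1 + norm (s + of_real \<mu>)) powr (- p)"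
    if "Re s \<ge> - \<mu>" "p \<ge> 0" for s p
  proof -
    have 1: "1 + norm (s + of_real \<mu>) > 0" by (simp add: add_pos_nonneg)
    have 2: "norm (s + of_real m) > 0"
      using less_le_trans[OF 1 base[OF that(1)]] k by (rule zero_less_mult_pos)
    have "(1 + norm (s + of_real \<mu>)) powr p \<le> (k * norm (s + of_real m)) powr p"
      using base[OF that(1)] 1 that by (intro powr_mono2) auto
    also have "\<dots> = k powr p * norm (s + of_real m) powr p" using k by (simp add: powr_mult)
    finally show ?thesis using 1 2 by (simp add: powr_minus field_simps)
  qed
  define C where "C = C1 * C2 * k powr \<psi>"
  have C: "C > 0" using C1 C2 k by (simp add: C_def)
  have h: "norm (gamma_ratio A B s) \<le> C * (1 + norm (s + of_real \<mu>)) powr (- \<psi>)" if s: "Re s \<ge> - \<mu>" for s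
  proof -
    let ?w = "s + of_real m"
    have w: "\<epsilon> \<le> Re ?w" using s by (simp add: \<epsilon>_def)
    have w0: "?w \<noteq> 0" using w \<epsilon> complex_eq_iff[of ?w 0] by auto
    have G0: "Gamma ?w \<noteq> 0" using w \<epsilon> unfolding Gamma_eq_zero_iff
      by (intro Re_pos_notin_nonpos_Ints) linarith
    let ?G = "norm (Gamma ?w) ^ length A"
    have G: "?G > 0" using G0 by simp
    have B: "?G * norm ?w powr (\<Sum>a\<leftarrow>B. a - m) \<le> C2 * norm (\<Prod>a\<leftarrow>B. Gamma (of_real a + s))"
      using C2(2)[OF w] len by simp
    have pos: "?G * norm ?w powr (\<Sum>a\<leftarrow>B. a - m) > 0" using G w0 by simp
    then have posB: "norm (\<Prod>a\<leftarrow>B. Gamma (of_real a + s)) > 0"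
      using less_le_trans[OF pos B] C2(1) zero_less_mult_pos by blast
    have "norm (gamma_ratio A B s) = norm (\<Prod>a\<leftarrow>A. Gamma (of_real a + s)) / norm (\<Prod>a\<leftarrow>B. Gamma (of_real a + s))"
      by (simp add: gamma_ratio_def norm_divide)
    also have "\<dots> \<le> C1 * (?G * norm ?w powr (\<Sum>a\<leftarrow>A. a - m)) / norm (\<Prod>a\<leftarrow>B. Gamma (of_real a + s))"
      by (intro divide_right_mono C1 w) auto
    also have "\<dots> \<le> C1 * (?G * norm ?w powr (\<Sum>a\<leftarrow>A. a - m)) / (?G * norm ?w powr (\<Sum>a\<leftarrow>B. a - m) / C2)"
    proof (rule divide_left_mono)
      show "?G * norm ?w powr (\<Sum>a\<leftarrow>B. a - m) / C2 \<le> norm (\<Prod>a\<leftarrow>B. Gamma (of_real a + s))"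
        using B C2(1) by (simp add: divide_le_eq mult.commute)
      show "0 \<le> C1 * (?G * norm ?w powr (\<Sum>a\<leftarrow>A. a - m))" using C1(1) G by simp
      show "0 < norm (\<Prod>a\<leftarrow>B. Gamma (of_real a + s)) * (?G * norm ?w powr (\<Sum>a\<leftarrow>B. a - m) / C2)"
        by (intro mult_pos_pos divide_pos_pos pos posB C2(1))
    qed
    also have "\<dots> = C1 * C2 * (norm ?w powr (\<Sum>a\<leftarrow>A. a - m) / norm ?w powr (\<Sum>a\<leftarrow>B. a - m))"
      using G0 C2(1) by simp
    also have "norm ?w powr (\<Sum>a\<leftarrow>A. a - m) / norm ?w powr (\<Sum>a\<leftarrow>B. a - m) = norm ?w powr (- \<psi>)"
      unfolding sums[symmetric] by (simp add: powr_diff)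
    also have "C1 * C2 * norm ?w powr (- \<psi>) \<le> C1 * C2 * (k powr \<psi> * (1 + norm (s + of_real \<mu>)) powr (- \<psi>))"
      using C1 C2 by (intro mult_left_mono pw s \<psi>) auto
    finally show ?thesis by (simp add: C_def mult.assoc)
  qed
  define D where "D = C * (D1 + D2) * k"
  have h': "norm (deriv (gamma_ratio A B) s) \<le> D * (1 + norm (s + of_real \<mu>)) powr (- \<psi> - 1)" if s: "Re s \<ge> - \<mu>" for s
  proof -
    let ?w = "s + of_real m"
    have w: "\<epsilon> \<le> Re ?w" using s by (simp add: \<epsilon>_def)
    let ?S = "(\<Sum>a\<leftarrow>A. Digamma (of_real a + s)) - (\<Sum>b\<leftarrow>B. Digamma (of_real b + s))"
    have "Re s > - m" using s assms by simp
    then have "deriv (gamma_ratio A B) s = gamma_ratio A B s * ?S"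
      by (intro DERIV_imp_deriv gamma_ratio_has_field_derivative[OF A B])
    moreover have "norm ?S \<le> (D1 + D2) * (k * (1 + norm (s + of_real \<mu>)) powr (-1))"
    proof -
      have "?S = ((\<Sum>a\<leftarrow>A. Digamma (of_real a + s)) - of_nat (length A) * Digamma ?w)
        - ((\<Sum>a\<leftarrow>B. Digamma (of_real a + s)) - of_nat (length B) * Digamma ?w)"
        using len by simp
      also have "norm \<dots> \<le> D1 / norm ?w + D2 / norm ?w"
        by (intro norm_triangle_le_diff add_mono D1 D2 w)
      also have "\<dots> = (D1 + D2) * norm ?w powr (-1)"
        by (simp add: powr_minus_divide add_divide_distrib)
      also have "\<dots> \<le> (D1 + D2) * (k powr 1 * (1 + norm (s + of_real \<mu>)) powr (-1))"
        using D1 D2 by (intro mult_left_mono pw s) auto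
      finally show ?thesis using k by simp
    qed
    ultimately have "norm (deriv (gamma_ratio A B) s) \<le> (C * (1 + norm (s + of_real \<mu>)) powr (- \<psi>)) *
        ((D1 + D2) * (k * (1 + norm (s + of_real \<mu>)) powr (-1)))"
      using C by (simp only: norm_mult) (intro mult_mono h s; simp)
    also have "\<dots> = D * ((1 + norm (s + of_real \<mu>)) powr (- \<psi>) * (1 + norm (s + of_real \<mu>)) powr (-1))"
      by (simp add: D_def mult_ac)
    also have "\<dots> = D * (1 + norm (s + of_real \<mu>)) powr (- \<psi> - 1)"
      by (simp only: powr_add [symmetric]) simp
    finally show ?thesis .
  qed
  have \<psi>': "sum_list A - sum_list B = - \<psi>" by (simp add: \<psi>_def)
  show ?thesis
  proof (rule that[of "max C D"])
    show "max C D > 0" using C by simp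
  next
    fix s assume "Re s \<ge> - \<mu>"
    note h[OF this]
    also have "C * (1 + norm (s + of_real \<mu>)) powr (- \<psi>) \<le> max C D * (1 + norm (s + of_real \<mu>)) powr (- \<psi>)"
      by (intro mult_right_mono) auto
    finally show "norm (gamma_ratio A B s) \<le> max C D * (1 + norm (s + of_real \<mu>)) powr (sum_list A - sum_list B)"
      unfolding \<psi>' .
  next
    fix s assume "Re s \<ge> - \<mu>"
    note h'[OF this]
    also have "D * (1 + norm (s + of_real \<mu>)) powr (- \<psi> - 1) \<le> max C D * (1 + norm (s + of_real \<mu>)) powr (- \<psi> - 1)"
      by (intro mult_right_mono) auto
    finally show "norm (deriv (gamma_ratio A B) s) \<le> max C D * (1 + norm (s + of_real \<mu>)) powr (sum_list A - sum_list B - 1)"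
      unfolding \<psi>' .
  qed
qed

section \<open>Integration lemmas\<close>

lemma integrable_pair_product_bound:
  fixes f :: "real \<times> real \<Rightarrow> complex" and a b :: "real \<Rightarrow> real"
  assumes [measurable]: "f \<in> borel_measurable (lborel \<Otimes>\<^sub>M lborel)"
    and a: "integrable lborel a" and b: "integrable lborel b"
    and bound: "\<And>x y. norm (f (x, y)) \<le> a x * b y"
  shows "integrable (lborel \<Otimes>\<^sub>M lborel) f"
proof (rule Bochner_Integration.integrable_bound)
  have [measurable]: "a \<in> borel_measurable borel" "b \<in> borel_measurable borel"
    using borel_measurable_integrable[OF a] borel_measurable_integrable[OF b] by simp_all
  show "integrable (lborel \<Otimes>\<^sub>M lborel) (\<lambda>(x, y). a x * b y)"
  proof (rule lborel_pair.Fubini_integrable)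
    show "integrable lborel (\<lambda>x. LINT y|lborel. norm (case (x, y) of (x, y) \<Rightarrow> a x * b y))"
      using a b by (simp add: abs_mult)
    show "AE x in lborel. integrable lborel (\<lambda>y. case (x, y) of (x, y) \<Rightarrow> a x * b y)"
      using b by simp
  qed measurable
  show "AE p in lborel \<Otimes>\<^sub>M lborel. norm (f p) \<le> norm (case p of (x, y) \<Rightarrow> a x * b y)"
    by (intro AE_I2) (use bound in \<open>auto intro!: order_trans[OF bound]\<close>)
qed fact

lemma Fubini_lborel:
  fixes f :: "real \<Rightarrow> real \<Rightarrow> complex" and a b :: "real \<Rightarrow> real"
  assumes "(\<lambda>(x, y). f x y) \<in> borel_measurable (lborel \<Otimes>\<^sub>M lborel)"
    and "integrable lborel a" and "integrable lborel b"
    and "\<And>x y. norm (f x y) \<le> a x * b y"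
  shows "integrable lborel (\<lambda>x. LINT y|lborel. f x y)"
    and "(LINT x|lborel. LINT y|lborel. f x y) = (LINT y|lborel. LINT x|lborel. f x y)"
proof -
  have i: "integrable (lborel \<Otimes>\<^sub>M lborel) (\<lambda>(x, y). f x y)"
    by (rule integrable_pair_product_bound[OF assms(1-3)]) (use assms(4) in auto)
  show "integrable lborel (\<lambda>x. LINT y|lborel. f x y)"
    using lborel_pair.integrable_fst[OF i] .
  show "(LINT x|lborel. LINT y|lborel. f x y) = (LINT y|lborel. LINT x|lborel. f x y)"
    by (rule lborel_pair.Fubini_integral[OF i, symmetric])
qed

lemma set_integrable_powr_to_inf:
  fixes a e :: real
  assumes "e < -1" "a > 0"
  shows "set_integrable lborel {a..} (\<lambda>x. x powr e)"
proof -
  have "(\<lambda>x. x powr e) integrable_on {a..}"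
    using has_integral_powr_to_inf[OF assms] by blast
  then have "(\<lambda>x. x powr e) absolutely_integrable_on {a..}"
    by (intro nonnegative_absolutely_integrable_1) auto
  then show ?thesis
    unfolding set_integrable_def by (subst (asm) integrable_completion) auto
qed

lemma set_integrable_powr_from_0:
  fixes b e :: real
  assumes "e > -1" "b \<ge> 0"
  shows "set_integrable lborel {0..b} (\<lambda>x. x powr e)"
proof -
  have "(\<lambda>x. x powr e) integrable_on {0..b}"
    using integrable_on_powr_from_0[OF assms] by blast
  then have "(\<lambda>x. x powr e) absolutely_integrable_on {0..b}"
    by (intro nonnegative_absolutely_integrable_1) auto
  then show ?thesis
    unfolding set_integrable_def by (subst (asm) integrable_completion) auto
qed

lemma integrable_one_plus_abs_powr:
  fixes e :: real
  assumes "e < -1"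
  shows "integrable lborel (\<lambda>y. (1 + \<bar>y\<bar>) powr e)"
proof -
  have i: "integrable lborel (\<lambda>x. indicator {1..} x *\<^sub>R x powr e)"
    using set_integrable_powr_to_inf[OF assms, of 1] by (simp add: set_integrable_def)
  from lborel_integrable_real_affine[OF i, of 1 1] lborel_integrable_real_affine[OF i, of "-1" 1]
  have "integrable lborel (\<lambda>y. indicator {1..} (1 + y) *\<^sub>R (1 + y) powr e + indicator {1..} (1 - y) *\<^sub>R (1 - y) powr e)"
    by (intro Bochner_Integration.integrable_add) simp_all
  then show ?thesis
  proof (rule Bochner_Integration.integrable_bound)
    show "AE y in lborel. norm ((1 + \<bar>y\<bar>) powr e)
        \<le> norm (indicator {1..} (1 + y) *\<^sub>R (1 + y) powr e + indicator {1..} (1 - y) *\<^sub>R (1 - y) powr e)"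
      by (intro AE_I2) (auto simp: indicator_def abs_if)
  qed measurable
qed

section \<open>Contour integrals over segments and rectangles\<close>

lemma contour_integral_rectpath:
  assumes "continuous_on (path_image (rectpath a b)) f"
  shows "contour_integral (rectpath a b) f =
    contour_integral (linepath a (Complex (Re b) (Im a))) f +
    contour_integral (linepath (Complex (Re b) (Im a)) b) f +
    contour_integral (linepath b (Complex (Re a) (Im b))) f +
    contour_integral (linepath (Complex (Re a) (Im b)) a) f"
proof -
  have "continuous_on (closed_segment a (Complex (Re b) (Im a))) f"
    "continuous_on (closed_segment (Complex (Re b) (Im a)) b) f"
    "continuous_on (closed_segment b (Complex (Re a) (Im b))) f"
    "continuous_on (closed_segment (Complex (Re a) (Im b)) a) f"
    using assms by (auto simp: rectpath_def Let_def path_image_join intro: continuous_on_subset)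
  note i = this[THEN contour_integrable_continuous_linepath]
  show ?thesis
    using i by (simp add: rectpath_def Let_def contour_integrable_joinI valid_path_join)
qed

lemma norm_contour_integral_linepath_le:
  assumes "continuous_on (closed_segment a b) f"
    and "\<And>x. x \<in> closed_segment a b \<Longrightarrow> norm (f x) \<le> B"
  shows "norm (contour_integral (linepath a b) f) \<le> B * norm (b - a)"
proof (rule contour_integral_bound_linepath)
  show "f contour_integrable_on linepath a b"
    by (rule contour_integrable_continuous_linepath) fact
  show "0 \<le> B" using assms(2)[of a] norm_ge_zero order_trans by blast
qed fact

lemma contour_integral_vertical:
  assumes "continuous_on (closed_segment (Complex c a) (Complex c b)) f" "a < b"
  shows "contour_integral (linepath (Complex c a) (Complex c b)) f = \<i> * (LBINT y:{a..b}. f (Complex c y))"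
proof -
  have "continuous_on {a..b} (\<lambda>y. f (Complex c y))"
  proof (rule continuous_on_compose2[OF assms(1)])
    show "continuous_on {a..b} (Complex c)"
      unfolding Complex_eq by (intro continuous_intros)
    show "Complex c ` {a..b} \<subseteq> closed_segment (Complex c a) (Complex c b)"
      by (auto simp: closed_segment_same_Re closed_segment_eq_real_ivl)
  qed
  then have "set_integrable lborel {a..b} (\<lambda>y. f (Complex c y))"
    by (rule borel_integrable_atLeastAtMost')
  from set_borel_integral_eq_integral(2)[OF this] show ?thesis
    using assms(2) by (subst contour_integral_linepath_same_Re[of _ c _ a b]) auto
qed

text \<open>An interpolation between the bounds |x| and 2, with the cases separated at |x| =
  1.\<close>

lemma norm_exp_i_minus_1_le:
  fixes x \<delta> :: real
  assumes "0 \<le> \<delta>" "\<delta> \<le> 1"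
  shows "norm (exp (\<i> * of_real x) - 1) \<le> 2 * \<bar>x\<bar> powr \<delta>"
proof (cases "\<bar>x\<bar> \<le> 1")
  case True
  have "norm (exp (\<i> * of_real x) - 1) \<le> \<bar>x\<bar>"
    using dist_exp_i_1[of x] abs_sin_x_le_abs_x[of "x / 2"] by simp
  also have "\<bar>x\<bar> \<le> \<bar>x\<bar> powr \<delta>"
    using True assms powr_mono'[of \<delta> 1 "\<bar>x\<bar>"] by (cases "x = 0") auto
  finally show ?thesis using powr_ge_zero[of "\<bar>x\<bar>" \<delta>] by linarith
next
  case False
  have "norm (exp (\<i> * of_real x) - 1) \<le> norm (exp (\<i> * of_real x)) + norm (1::complex)"
    by (rule norm_triangle_ineq4)
  also have "\<dots> = 2" by simp
  also have "2 \<le> 2 * \<bar>x\<bar> powr \<delta>" using False assms ge_one_powr_ge_zero[of "\<bar>x\<bar>" \<delta>] by simp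
  finally show ?thesis .
qed

text \<open>The integrand is t^(p - 1) and the antiderivative t^p / p, which vanishes at 0 because
  Re p > 0. Applied to p = n - s, this produces the Cauchy kernel in the moments.\<close>

lemma integral_power_minus_complex:
  fixes p :: complex
  assumes "Re p > 0"
  shows "set_integrable lborel {0<..<1} (\<lambda>t. exp ((p - 1) * of_real (ln t)))"
    and "(LBINT t:{0<..<1}. exp ((p - 1) * of_real (ln t))) = 1 / p"
proof -
  have p0: "p \<noteq> 0" using assms by auto
  have n: "norm (exp (z * of_real (ln t))) = t powr Re z" if "t > 0" for t z
    using that by (simp add: powr_def)
  show *: "set_integrable lborel {0<..<1} (\<lambda>t. exp ((p - 1) * of_real (ln t)))"
  proof (rule set_integrable_bound)
    show "set_integrable lborel {0<..<1} (\<lambda>t. t powr (Re p - 1))"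
      by (rule set_integrable_subset[OF set_integrable_powr_from_0[of _ 1]]) (use assms in auto)
    show "set_borel_measurable lborel {0<..<1} (\<lambda>t. exp ((p - 1) * of_real (ln t)))"
      unfolding set_borel_measurable_def by measurable
    show "AE t in lborel. t \<in> {0<..<1} \<longrightarrow> norm (exp ((p - 1) * of_real (ln t))) \<le> norm (t powr (Re p - 1))"
      by (intro AE_I2 impI, subst n) auto
  qed
  let ?F = "\<lambda>t::real. exp (p * of_real (ln t)) / p"
  have "(LBINT t=0..1. exp ((p - 1) * of_real (ln t))) = 1 / p - 0"
  proof (rule interval_integral_FTC_integrable)
    fix t :: real assume t: "0 < ereal t" "ereal t < 1"
    then have t0: "t > 0" by simp
    have "((\<lambda>t. of_real (ln t) :: complex) has_vector_derivative of_real (inverse t)) (at t)"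
      using t0 by (intro has_vector_derivative_of_real) (auto intro!: derivative_eq_intros simp: field_simps)
    moreover have "((\<lambda>w. exp (p * w) / p) has_field_derivative exp (p * of_real (ln t)) * p / p)
        (at (of_real (ln t)))"
      by (auto intro!: derivative_eq_intros)
    ultimately have "(((\<lambda>w. exp (p * w) / p) \<circ> (\<lambda>t. of_real (ln t))) has_vector_derivative
       (of_real (inverse t) * (exp (p * of_real (ln t)) * p / p))) (at t)"
      by (rule field_vector_diff_chain_at)
    moreover have "of_real (inverse t) * (exp (p * of_real (ln t)) * p / p) = exp ((p - 1) * of_real (ln t))"
    proof -
      have "exp (complex_of_real (ln t)) = of_real t" using t0 by (simp add: exp_of_real)
      then show ?thesis using p0 by (simp add: left_diff_distrib exp_diff divide_inverse)
    qed
    ultimately show "(?F has_vector_derivative exp ((p - 1) * of_real (ln t))) (at t)" by (simp add: o_def)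
    show "isCont (\<lambda>t. exp ((p - 1) * of_real (ln t))) t" using t0 by (intro continuous_intros) auto
  next
    show "set_integrable lborel (einterval 0 1) (\<lambda>t. exp ((p - 1) * of_real (ln t)))"
      using * by (simp add: zero_ereal_def one_ereal_def)
    have "((\<lambda>t::real. t powr Re p) \<longlongrightarrow> 0) (at_right 0)"
      by (rule tendsto_zero_powrI[OF _ tendsto_const _ assms])
        (auto simp: eventually_at_filter intro: tendsto_ident_at)
    then have "((\<lambda>t. t powr Re p / norm p) \<longlongrightarrow> 0 / norm p) (at_right 0)"
      using p0 by (intro tendsto_divide tendsto_const) auto
    then have "((\<lambda>t. t powr Re p / norm p) \<longlongrightarrow> 0) (at_right 0)" by simp
    moreover have "eventually (\<lambda>t::real. norm (?F t) \<le> t powr Re p / norm p) (at_right 0)"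
      unfolding norm_divide by (intro eventually_at_rightI[of 0 1]) (simp_all only: n greaterThanLessThan_iff order_refl zero_less_one)
    ultimately have "(?F \<longlongrightarrow> 0) (at_right 0)"
      by (rule Lim_null_comparison[rotated])
    then show "((?F \<circ> real_of_ereal) \<longlongrightarrow> 0) (at_right 0)"
      by (simp add: ereal_tendsto_simps1 zero_ereal_def)
    have "(?F \<longlongrightarrow> exp (p * of_real (ln 1)) / p) (at_left 1)"
      using p0 by (intro tendsto_intros) auto
    then show "((?F \<circ> real_of_ereal) \<longlongrightarrow> 1 / p) (at_left 1)"
      by (simp add: ereal_tendsto_simps1 one_ereal_def)
  qed simp
  then show "(LBINT t:{0<..<1}. exp ((p - 1) * of_real (ln t))) = 1 / p"
    by (simp add: interval_integral_Ioo zero_ereal_def one_ereal_def)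
qed

section \<open>Inverse Mellin transforms\<close>

text \<open>\<open>m\<close> bounds the half-plane of holomorphy and \<open>\<mu>\<close> fixes the
  line of integration. The two bounds differ by one power, and this extra power is what integration
  by parts converts into absolute convergence.\<close>

locale mellin_kernel =
  fixes h :: "complex \<Rightarrow> complex" and m \<mu> \<psi> C :: real
  assumes mu: "0 < \<mu>" "\<mu> < m" and psi: "0 < \<psi>" and C: "C > 0"
    and hol: "h holomorphic_on {s. Re s > - m}"
    and bound: "\<And>s. Re s \<ge> - \<mu> \<Longrightarrow> norm (h s) \<le> C * (1 + norm (s + of_real \<mu>)) powr (- \<psi>)"
    and dbound: "\<And>s. Re s \<ge> - \<mu> \<Longrightarrow> norm (deriv h s) \<le> C * (1 + norm (s + of_real \<mu>)) powr (- \<psi> - 1)"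
begin

abbreviation line :: "real \<Rightarrow> complex" where
  "line y \<equiv> Complex (- \<mu>) y"

text \<open>The integral over the segment from -\<open>\<mu>\<close> - iR to -\<open>\<mu>\<close> +
  iR: ds = i dy has absorbed the i of 1/(2 pi i), and t^(-s) is written as an exponential.\<close>

definition trunc :: "real \<Rightarrow> real \<Rightarrow> complex" where
  "trunc R t = 1 / (2 * of_real pi) * (LBINT y:{-R..R}. h (line y) * exp (- line y * of_real (ln t)))"

definition mellin_inv :: "real \<Rightarrow> complex" where
  "mellin_inv t = (if t \<in> {0<..<1} then Lim at_top (\<lambda>R. trunc R t) else 0)"

text \<open>Positivity makes (1 - t)^(\<open>\<delta>\<close> - 1) integrable at 1;
  \<open>\<delta>\<close> < \<open>\<psi>\<close> leaves the integrable decay (1 + |y|)^(-1 -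
  (\<open>\<psi>\<close> - \<open>\<delta>\<close>)) after a factor |y|^\<open>\<delta>\<close> has
  been given up; \<open>\<delta>\<close> <= 1 is what the interpolation requires.\<close>

definition \<delta> :: real where "\<delta> = min \<psi> 1 / 2"

lemma delta: "0 < \<delta>" "\<delta> < 1" "\<delta> < \<psi>"
  using psi by (auto simp: \<delta>_def)

lemma open_halfplane: "open {s. Re s > - m}"
  using open_halfspace_Re_gt .

lemma norm_line: "norm (line y + of_real \<mu>) = \<bar>y\<bar>"
  by (simp add: cmod_def)

lemma has_vector_derivative_h_line:
  "((\<lambda>y. h (line y)) has_vector_derivative \<i> * deriv h (line y)) (at y within S)"
proof -
  have "(line has_vector_derivative \<i>) (at y)"
  proof -
    have "((\<lambda>y. of_real (- \<mu>) + \<i> * of_real y) has_vector_derivative 0 + \<i> * of_real 1) (at y)"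
      by (intro has_vector_derivative_add has_vector_derivative_const has_vector_derivative_mult_right
          has_vector_derivative_of_real DERIV_ident)
    then show ?thesis by (simp add: Complex_eq)
  qed
  moreover have "(h has_field_derivative deriv h (line y)) (at (line y))"
    using mu by (intro holomorphic_derivI[OF hol open_halfplane]) auto
  ultimately show ?thesis
    using field_vector_diff_chain_at[of line \<i> y h "deriv h (line y)"]
    by (auto simp: o_def intro: has_vector_derivative_at_within)
qed

lemma continuous_line: "continuous_on S line"
  unfolding Complex_eq by (intro continuous_intros)

lemma continuous_h_line: "continuous_on S (\<lambda>y. h (line y))"
  using mu by (intro continuous_on_compose2[OF holomorphic_on_imp_continuous_on[OF hol] continuous_line]) auto

lemma continuous_deriv_h_line: "continuous_on S (\<lambda>y. deriv h (line y))"
  using mu by (intro continuous_on_compose2[OF holomorphic_on_imp_continuous_on[OF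
        holomorphic_deriv[OF hol open_halfplane]] continuous_line]) auto

lemma measurable_h_line [measurable]: "(\<lambda>y. h (line y)) \<in> borel_measurable borel"
  by (rule borel_measurable_continuous_onI[OF continuous_h_line])

lemma measurable_line [measurable]: "line \<in> borel_measurable borel"
  by (rule borel_measurable_continuous_onI[OF continuous_line])

text \<open>The antiderivative of \<open>exp (\<i> L y)\<close> is normalised to vanish at \<open>y = 0\<close>: interpolating
  \<open>\<bar>exp (\<i> x) - 1\<bar> \<le> 2 \<bar>x\<bar>\<^sup>\<delta>\<close> then keeps the singularity at \<open>t = 1\<close>, where \<open>L = - ln t\<close> vanishes,
  integrable.\<close>

definition osc :: "real \<Rightarrow> real \<Rightarrow> complex" where
  "osc L y = (exp (\<i> * of_real (L * y)) - 1) / (\<i> * of_real L)"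

lemma continuous_osc: "L \<noteq> 0 \<Longrightarrow> continuous_on S (osc L)"
  unfolding osc_def by (intro continuous_intros) auto

lemma osc_has_vector_derivative:
  assumes "L \<noteq> 0"
  shows "(osc L has_vector_derivative exp (\<i> * of_real (L * y))) (at y within S)"
proof -
  have "((\<lambda>w. (exp (\<i> * (of_real L * w)) - 1) / (\<i> * of_real L)) has_field_derivative
      exp (\<i> * (of_real L * of_real y))) (at (of_real y))"
    using assms by (auto intro!: derivative_eq_intros simp: mult_ac)
  from has_vector_derivative_real_field[OF this] show ?thesis
    unfolding osc_def by (simp add: has_vector_derivative_at_within)
qed

lemma norm_osc_le:
  assumes t: "0 < t" "t < 1"
  shows "norm (osc (- ln t) y) \<le> 2 * (1 + \<bar>y\<bar>) powr \<delta> * (1 - t) powr (\<delta> - 1)"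
proof -
  define L where "L = - ln t"
  \<comment> \<open>Since \<open>\<delta>\<close> - 1 is negative, 1 - t <= -ln t replaces the power
    of \<open>L\<close> by the larger power of 1 - t.\<close>
  have L: "L > 0" "1 - t \<le> L" using t ln_le_minus_one[of t] by (auto simp: L_def)
  have "norm (osc L y) \<le> 2 * \<bar>L * y\<bar> powr \<delta> / L"
    using norm_exp_i_minus_1_le[of \<delta> "L * y"] delta L
    by (simp add: osc_def norm_divide divide_right_mono norm_mult)
  also have "\<dots> = 2 * \<bar>y\<bar> powr \<delta> * L powr (\<delta> - 1)"
    using L by (simp add: abs_mult powr_mult powr_diff)
  also have "\<dots> \<le> 2 * (1 + \<bar>y\<bar>) powr \<delta> * (1 - t) powr (\<delta> - 1)"
    using L t delta by (intro mult_mono powr_mono2 powr_mono2') auto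
  finally show ?thesis by (simp add: L_def)
qed

text \<open>The derivative falls on h, which improves the integrand to an absolutely integrable one;
  the boundary terms at R and -R vanish in the limit.\<close>

lemma trunc_by_parts:
  assumes t: "0 < t" "t < 1" and R: "R \<ge> 0"
  shows "trunc R t = of_real (t powr \<mu> / (2 * pi)) *
    (h (line R) * osc (- ln t) R - h (line (- R)) * osc (- ln t) (- R)
      - (LBINT y:{-R..R}. \<i> * deriv h (line y) * osc (- ln t) y))"
proof -
  define L where "L = - ln t"
  have L: "L > 0" using t by (simp add: L_def)
  let ?f1 = "\<lambda>y. \<i> * deriv h (line y) * osc L y" and ?f2 = "\<lambda>y. h (line y) * exp (\<i> * of_real (L * y))"
  have c1: "continuous_on {-R..R} ?f1" and c2: "continuous_on {-R..R} ?f2"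
    using L by (intro continuous_intros continuous_deriv_h_line continuous_osc continuous_h_line; simp)+
  have "(LBINT y:{-R..R}. ?f1 y + ?f2 y) = h (line R) * osc L R - h (line (- R)) * osc L (- R)"
    unfolding set_lebesgue_integral_def
  proof (rule integral_FTC_atLeastAtMost[where F = "\<lambda>y. h (line y) * osc L y"])
    show "((\<lambda>y. h (line y) * osc L y) has_vector_derivative ?f1 y + ?f2 y) (at y within {-R..R})" for y
      using has_vector_derivative_mult[OF has_vector_derivative_h_line osc_has_vector_derivative, of L y "{-R..R}"] L
      by (simp add: add.commute)
  qed (use R c1 c2 in \<open>auto intro!: continuous_on_add\<close>)
  moreover have "(LBINT y:{-R..R}. ?f1 y + ?f2 y) = (LBINT y:{-R..R}. ?f1 y) + (LBINT y:{-R..R}. ?f2 y)"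
    by (intro set_integral_add borel_integrable_atLeastAtMost' c1 c2)
  ultimately have f2: "(LBINT y:{-R..R}. ?f2 y) = h (line R) * osc L R - h (line (- R)) * osc L (- R)
      - (LBINT y:{-R..R}. ?f1 y)" by (simp add: algebra_simps)
  \<comment> \<open>On the line Re s = -\<open>\<mu>\<close>, t^(-s) is t^\<open>\<mu>\<close> times
    the pure oscillation exp(i \<open>L\<close> y).\<close>
  have eq: "h (line y) * exp (- line y * of_real (ln t)) = of_real (t powr \<mu>) * ?f2 y" for y
  proof -
    have "- line y * of_real (ln t) = of_real (\<mu> * ln t) + \<i> * of_real (L * y)"
      by (simp add: complex_eq_iff L_def)
    moreover have "exp (of_real (\<mu> * ln t)) = complex_of_real (t powr \<mu>)"
      using t by (simp add: exp_of_real powr_def del: of_real_mult)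
    ultimately show ?thesis by (simp only: exp_add mult_ac)
  qed
  have "trunc R t = 1 / (2 * of_real pi) * (of_real (t powr \<mu>) * (LBINT y:{-R..R}. ?f2 y))"
    unfolding trunc_def by (simp only: eq set_integral_mult_right)
  then show ?thesis unfolding f2 by (simp add: L_def)
qed

definition dom :: "real \<Rightarrow> real" where "dom y = (1 + \<bar>y\<bar>) powr (- 1 - (\<psi> - \<delta>))"

lemma integrable_dom: "integrable lborel dom"
  unfolding dom_def using delta by (intro integrable_one_plus_abs_powr) simp

lemma norm_deriv_osc_le:
  assumes t: "0 < t" "t < 1"
  shows "norm (\<i> * deriv h (line y) * osc (- ln t) y) \<le> 2 * C * (1 - t) powr (\<delta> - 1) * dom y"
proof -
  have "norm (\<i> * deriv h (line y) * osc (- ln t) y) = norm (deriv h (line y)) * norm (osc (- ln t) y)"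
    by (simp add: norm_mult)
  also have "\<dots> \<le> (C * (1 + \<bar>y\<bar>) powr (- \<psi> - 1)) * (2 * (1 + \<bar>y\<bar>) powr \<delta> * (1 - t) powr (\<delta> - 1))"
    using dbound[of "line y"] C by (intro mult_mono norm_osc_le t) (auto simp: norm_line)
  also have "\<dots> = 2 * C * (1 - t) powr (\<delta> - 1) * ((1 + \<bar>y\<bar>) powr (- \<psi> - 1) * (1 + \<bar>y\<bar>) powr \<delta>)"
    by (simp add: mult_ac)
  also have "(1 + \<bar>y\<bar>) powr (- \<psi> - 1) * (1 + \<bar>y\<bar>) powr \<delta> = dom y"
    unfolding dom_def powr_add [symmetric] by (simp add: algebra_simps)
  finally show ?thesis .
qed

lemma norm_h_osc_le:
  assumes t: "0 < t" "t < 1"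
  shows "norm (h (line y) * osc (- ln t) y) \<le> 2 * C * (1 - t) powr (\<delta> - 1) * (1 + \<bar>y\<bar>) powr (- (\<psi> - \<delta>))"
proof -
  have "norm (h (line y) * osc (- ln t) y) = norm (h (line y)) * norm (osc (- ln t) y)"
    by (simp add: norm_mult)
  also have "\<dots> \<le> (C * (1 + \<bar>y\<bar>) powr (- \<psi>)) * (2 * (1 + \<bar>y\<bar>) powr \<delta> * (1 - t) powr (\<delta> - 1))"
    using bound[of "line y"] C by (intro mult_mono norm_osc_le t) (auto simp: norm_line)
  also have "\<dots> = 2 * C * (1 - t) powr (\<delta> - 1) * ((1 + \<bar>y\<bar>) powr (- \<psi>) * (1 + \<bar>y\<bar>) powr \<delta>)"
    by (simp add: mult_ac)
  also have "(1 + \<bar>y\<bar>) powr (- \<psi>) * (1 + \<bar>y\<bar>) powr \<delta> = (1 + \<bar>y\<bar>) powr (- (\<psi> - \<delta>))"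
    unfolding powr_add [symmetric] by (simp add: algebra_simps)
  finally show ?thesis .
qed

text \<open>Half of what the bracket in \<open>trunc_by_parts\<close> contributes: 2
  \<open>C\<close> from each boundary term and 2 \<open>C\<close> times the integral of
  \<open>dom\<close>. The prefactor 1/(2 pi) consumes the 2 and leaves 1/pi <= 1.\<close>

definition K :: real where "K = 2 * C + C * integral\<^sup>L lborel dom"

lemma norm_trunc_le:
  assumes t: "0 < t" "t < 1" and R: "R \<ge> 0"
  shows "norm (trunc R t) \<le> K * (t powr \<mu> * (1 - t) powr (\<delta> - 1))"
proof -
  let ?M = "2 * C * (1 - t) powr (\<delta> - 1)"
  have M: "?M \<ge> 0" using C by simp
  have b: "norm (h (line y) * osc (- ln t) y) \<le> ?M" for y
  proof -
    have "(1 + \<bar>y\<bar>) powr (- (\<psi> - \<delta>)) \<le> (1 + \<bar>y\<bar>) powr 0"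
      using delta by (intro powr_mono) auto
    then have "(1 + \<bar>y\<bar>) powr (- (\<psi> - \<delta>)) \<le> 1" by (simp split: if_splits)
    then show ?thesis using norm_h_osc_le[OF t, of y] M mult_left_le order_trans by blast
  qed
  have "norm (LBINT y:{-R..R}. \<i> * deriv h (line y) * osc (- ln t) y) \<le> (LINT y|lborel. ?M * dom y)"
    unfolding set_lebesgue_integral_def
  proof (rule Bochner_Integration.integral_norm_bound_integral)
    show "integrable lborel (\<lambda>y. indicat_real {-R..R} y *\<^sub>R (\<i> * deriv h (line y) * osc (- ln t) y))"
      using t unfolding set_integrable_def[symmetric]
      by (intro borel_integrable_atLeastAtMost' continuous_intros continuous_deriv_h_line continuous_osc) auto
    show "integrable lborel (\<lambda>y. ?M * dom y)" using integrable_dom by simp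
    show "norm (indicat_real {-R..R} y *\<^sub>R (\<i> * deriv h (line y) * osc (- ln t) y)) \<le> ?M * dom y" for y
      using norm_deriv_osc_le[OF t, of y] C by (auto simp: indicator_def dom_def)
  qed
  then have i: "norm (LBINT y:{-R..R}. \<i> * deriv h (line y) * osc (- ln t) y) \<le> ?M * integral\<^sup>L lborel dom"
    by simp
  have "norm (h (line R) * osc (- ln t) R - h (line (- R)) * osc (- ln t) (- R)
      - (LBINT y:{-R..R}. \<i> * deriv h (line y) * osc (- ln t) y)) \<le> (?M + ?M) + ?M * integral\<^sup>L lborel dom"
    by (intro norm_triangle_le_diff add_mono b i order_trans[OF norm_triangle_ineq4])
  also have "\<dots> = 2 * K * (1 - t) powr (\<delta> - 1)"
    by (simp add: K_def algebra_simps)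
  finally have *: "norm (h (line R) * osc (- ln t) R - h (line (- R)) * osc (- ln t) (- R)
      - (LBINT y:{-R..R}. \<i> * deriv h (line y) * osc (- ln t) y)) \<le> 2 * K * (1 - t) powr (\<delta> - 1)" .
  have "norm (trunc R t) \<le> t powr \<mu> / (2 * pi) * (2 * K * (1 - t) powr (\<delta> - 1))"
    unfolding trunc_by_parts[OF t R] norm_mult norm_of_real using * by (intro mult_mono) auto
  also have "\<dots> = 1 / pi * (K * (t powr \<mu> * (1 - t) powr (\<delta> - 1)))" by simp
  also have "\<dots> \<le> 1 * (K * (t powr \<mu> * (1 - t) powr (\<delta> - 1)))"
  proof (rule mult_right_mono)
    show "1 / pi \<le> 1" using pi_gt3 by simp
    have "integral\<^sup>L lborel dom \<ge> 0" by (intro integral_nonneg_AE) (auto simp: dom_def)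
    then show "K * (t powr \<mu> * (1 - t) powr (\<delta> - 1)) \<ge> 0" using C by (simp add: K_def)
  qed
  finally show ?thesis by simp
qed

text \<open>\<open>mellin_inv\<close> is introduced through \<open>Lim\<close>, which says nothing
  until convergence is known. The boundary terms are O(R^(-(\<open>\<psi>\<close> -
  \<open>\<delta>\<close>))), and the remaining integral converges under \<open>dom\<close>.\<close>

lemma trunc_tendsto:
  assumes t: "0 < t" "t < 1"
  shows "((\<lambda>R. trunc R t) \<longlongrightarrow> mellin_inv t) at_top"
proof -
  let ?f = "\<lambda>y. \<i> * deriv h (line y) * osc (- ln t) y"
  have [measurable]: "?f \<in> borel_measurable borel"
    using t by (intro borel_measurable_continuous_onI continuous_intros continuous_deriv_h_line continuous_osc) auto
  have lim0: "((\<lambda>R::real. 2 * C * (1 - t) powr (\<delta> - 1) * (1 + \<bar>R\<bar>) powr (- (\<psi> - \<delta>))) \<longlongrightarrow> 0) at_top"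
  proof -
    have "((\<lambda>R::real. (1 + \<bar>R\<bar>) powr (- (\<psi> - \<delta>))) \<longlongrightarrow> 0) at_top"
      using delta by (intro tendsto_neg_powr filterlim_tendsto_add_at_top[OF tendsto_const]
        filterlim_abs_real) auto
    then show ?thesis by (intro tendsto_mult_right_zero)
  qed
  have e1: "((\<lambda>R. h (line R) * osc (- ln t) R) \<longlongrightarrow> 0) at_top"
    by (rule Lim_null_comparison[OF _ lim0]) (use norm_h_osc_le[OF t] in simp)
  have e2: "((\<lambda>R. h (line (- R)) * osc (- ln t) (- R)) \<longlongrightarrow> 0) at_top"
    by (rule Lim_null_comparison[OF _ lim0]) (use norm_h_osc_le[OF t, of "- _"] in simp)
  have e3: "((\<lambda>R. LBINT y:{-R..R}. ?f y) \<longlongrightarrow> (LINT y|lborel. ?f y)) at_top"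
    unfolding set_lebesgue_integral_def
  proof (rule integral_dominated_convergence_at_top)
    show "integrable lborel (\<lambda>y. 2 * C * (1 - t) powr (\<delta> - 1) * dom y)" using integrable_dom by simp
    show "AE y in lborel. ((\<lambda>R. indicat_real {-R..R} y *\<^sub>R ?f y) \<longlongrightarrow> ?f y) at_top"
    proof (intro AE_I2 tendsto_eventually)
      fix y :: real
      show "\<forall>\<^sub>F R in at_top. indicat_real {-R..R} y *\<^sub>R ?f y = ?f y"
        using eventually_ge_at_top[of "\<bar>y\<bar>"] by eventually_elim (auto simp: indicator_def abs_le_iff)
    qed
    show "\<forall>\<^sub>F R in at_top. AE y in lborel. norm (indicat_real {-R..R} y *\<^sub>R ?f y) \<le> 2 * C * (1 - t) powr (\<delta> - 1) * dom y"
      using norm_deriv_osc_le[OF t] C by (intro always_eventually allI AE_I2) (auto simp: indicator_def dom_def)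
  qed measurable
  have "((\<lambda>R. of_real (t powr \<mu> / (2 * pi)) *
    (h (line R) * osc (- ln t) R - h (line (- R)) * osc (- ln t) (- R) - (LBINT y:{-R..R}. ?f y)))
     \<longlongrightarrow> of_real (t powr \<mu> / (2 * pi)) * (0 - 0 - (LINT y|lborel. ?f y))) at_top"
    by (intro tendsto_mult tendsto_const tendsto_diff e1 e2 e3)
  moreover have "eventually (\<lambda>R. of_real (t powr \<mu> / (2 * pi)) *
    (h (line R) * osc (- ln t) R - h (line (- R)) * osc (- ln t) (- R) - (LBINT y:{-R..R}. ?f y)) = trunc R t) at_top"
    using eventually_ge_at_top[of 0] by eventually_elim (simp only: trunc_by_parts[OF t])
  ultimately have *: "((\<lambda>R. trunc R t) \<longlongrightarrow> of_real (t powr \<mu> / (2 * pi)) * (0 - 0 - (LINT y|lborel. ?f y))) at_top"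
    by (rule Lim_transform_eventually)
  from tendsto_Lim[OF _ this] have "mellin_inv t = of_real (t powr \<mu> / (2 * pi)) * (0 - 0 - (LINT y|lborel. ?f y))"
    using t unfolding mellin_inv_def by (simp add: trivial_limit_at_top_linorder)
  with * show ?thesis by simp
qed

lemma norm_mellin_inv_le:
  assumes "0 < t" "t < 1"
  shows "norm (mellin_inv t) \<le> K * (t powr \<mu> * (1 - t) powr (\<delta> - 1))"
proof (rule tendsto_upperbound[OF tendsto_norm[OF trunc_tendsto[OF assms]]])
  show "\<forall>\<^sub>F R in at_top. norm (trunc R t) \<le> K * (t powr \<mu> * (1 - t) powr (\<delta> - 1))"
    using eventually_ge_at_top[of 0] by eventually_elim (rule norm_trunc_le[OF assms])
qed (simp add: trivial_limit_at_top_linorder)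

lemma measurable_trunc [measurable]: "trunc R \<in> borel_measurable borel"
  unfolding trunc_def set_lebesgue_integral_def by measurable

lemma measurable_mellin_inv [measurable]: "mellin_inv \<in> borel_measurable borel"
proof (rule borel_measurable_LIMSEQ_metric)
  fix n :: nat
  show "(\<lambda>t. indicator {0<..<1} t *\<^sub>R trunc (real n) t) \<in> borel_measurable borel" by measurable
next
  fix t :: real
  have "(\<lambda>n. trunc (real n) t) \<longlonglongrightarrow> mellin_inv t" if "0 < t" "t < 1"
    using filterlim_compose[OF trunc_tendsto[OF that] filterlim_real_sequentially] .
  then show "(\<lambda>n. indicator {0<..<1} t *\<^sub>R trunc (real n) t) \<longlonglongrightarrow> mellin_inv t"
    by (cases "t \<in> {0<..<1}") (auto simp: mellin_inv_def)
qed

end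

section \<open>Moments of the inverse Mellin transform and shift of the vertical line\<close>

context mellin_kernel
begin

text \<open>The y-range is bounded and |t^(n - s - 1)| <= t^(\<open>\<mu>\<close> - 1) for 0 < t <
  1, so Fubini's theorem applies. The inner integral is that of t^(p - 1) with p = n - s and Re p =
  n + \<open>\<mu>\<close> > 0; for n = 0 the positivity comes from \<open>\<mu>\<close>
  alone.\<close>

lemma trunc_moment:
  fixes n :: nat
  assumes R: "R > 0"
  shows "(LBINT t:{0<..<1}. of_real (t ^ n) * (trunc R t / of_real t)) =
    1 / (2 * of_real pi) * (LBINT y:{-R..R}. h (line y) / (of_nat n - line y))"
proof -
  let ?f = "\<lambda>t y. indicator {0<..<1} t *\<^sub>R (of_real (t ^ n / t) *
    (indicator {-R..R} y *\<^sub>R (h (line y) * exp (- line y * of_real (ln t)))))"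
  have inner: "?f t y = (indicator {-R..R} y *\<^sub>R h (line y)) *
      (indicator {0<..<1} t *\<^sub>R exp ((of_nat n - line y - 1) * of_real (ln t)))" for t y
  proof (cases "t \<in> {0<..<1}")
    case True
    then have "of_real (t ^ n / t) * exp (- line y * of_real (ln t)) = exp ((of_nat n - line y - 1) * of_real (ln t))"
    proof -
      have "t ^ n / t = exp ((real n - 1) * ln t)"
        using True by (simp add: left_diff_distrib exp_diff exp_of_nat_mult)
      then have "of_real (t ^ n / t) = exp ((of_nat n - 1) * complex_of_real (ln t))"
        by (simp flip: exp_of_real)
      then show ?thesis by (simp add: algebra_simps flip: exp_add)
    qed
    then show ?thesis using True
      by (cases "y \<in> {-R..R}")
        (simp_all del: of_real_divide of_real_power add: mult.left_commute[of _ "h (line y)"])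
  qed simp
  have "(LBINT t:{0<..<1}. of_real (t ^ n) * (trunc R t / of_real t))
      = 1 / (2 * of_real pi) * (LINT t|lborel. LINT y|lborel. ?f t y)"
  proof -
    have "indicator {0<..<1} t *\<^sub>R (of_real (t ^ n) * (trunc R t / of_real t))
        = 1 / (2 * of_real pi) * (LINT y|lborel. ?f t y)" for t
      unfolding trunc_def set_lebesgue_integral_def integral_scaleR_right integral_mult_right_zero
      by simp
    then show ?thesis by (simp add: set_lebesgue_integral_def)
  qed
  also have "(LINT t|lborel. LINT y|lborel. ?f t y) = (LINT y|lborel. LINT t|lborel. ?f t y)"
  proof (rule Fubini_lborel(2))
    show "(\<lambda>(t, y). ?f t y) \<in> borel_measurable (lborel \<Otimes>\<^sub>M lborel)" by measurable
    show "integrable lborel (\<lambda>t. indicator {0<..<1} t *\<^sub>R t powr (\<mu> - 1))"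
      unfolding set_integrable_def[symmetric]
      by (rule set_integrable_subset[OF set_integrable_powr_from_0[of _ 1]]) (use mu in auto)
    have "set_integrable lborel {-R..R} (\<lambda>y. h (line y))"
      by (intro borel_integrable_atLeastAtMost' continuous_h_line)
    then show "integrable lborel (\<lambda>y. norm (indicator {-R..R} y *\<^sub>R h (line y)))"
      unfolding set_integrable_def by (rule integrable_norm)
    fix t y :: real
    show "norm (?f t y) \<le> (indicator {0<..<1} t *\<^sub>R t powr (\<mu> - 1)) * norm (indicator {-R..R} y *\<^sub>R h (line y))"
    proof (cases "t \<in> {0<..<1}")
      case True
      have "norm (exp ((of_nat n - line y - 1) * of_real (ln t))) = t powr (real n + \<mu> - 1)"
        using True by (simp add: powr_def)
      also have "\<dots> \<le> t powr (\<mu> - 1)" using True by (intro powr_mono') auto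
      finally show ?thesis unfolding inner norm_mult using True
        by (subst mult.commute) (intro mult_right_mono; simp)
    qed simp
  qed
  also have "\<dots> = (LBINT y:{-R..R}. h (line y) / (of_nat n - line y))"
    unfolding inner set_lebesgue_integral_def
  proof (intro Bochner_Integration.integral_cong refl)
    fix y
    have "(LINT t|lborel. indicator {0<..<1} t *\<^sub>R exp ((of_nat n - line y - 1) * of_real (ln t)))
      = 1 / (of_nat n - line y)"
      using integral_power_minus_complex(2)[of "of_nat n - line y"] mu by (simp add: set_lebesgue_integral_def)
    then show "(LINT t|lborel. (indicator {-R..R} y *\<^sub>R h (line y)) *
        (indicator {0<..<1} t *\<^sub>R exp ((of_nat n - line y - 1) * of_real (ln t))))
      = indicator {-R..R} y *\<^sub>R (h (line y) / (of_nat n - line y))"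
      by (simp only: integral_mult_right_zero scaleR_conv_of_real times_divide_eq_right mult_1_right)
  qed
  finally show ?thesis .
qed

lemma powr_neg_psi_tendsto_0: "((\<lambda>R::real. (1 + R) powr (- \<psi>)) \<longlongrightarrow> 0) at_top"
  using psi by (intro tendsto_neg_powr filterlim_tendsto_add_at_top[OF tendsto_const] filterlim_ident) auto

lemma bound_ge:
  assumes "Re s \<ge> - \<mu>" "norm (s + of_real \<mu>) \<ge> R" "R \<ge> 0"
  shows "norm (h s) \<le> C * (1 + R) powr (- \<psi>)"
proof -
  have "(1 + norm (s + of_real \<mu>)) powr (- \<psi>) \<le> (1 + R) powr (- \<psi>)"
    using assms psi by (intro powr_mono2') auto
  then show ?thesis using bound[OF assms(1)] C by (meson mult_left_mono order_trans less_imp_le)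
qed

lemma convex_halfplane: "convex {s. Re s > - m}"
  by (rule convex_halfspace_Re_gt)

text \<open>The segment is closed to the right by a rectangle whose only enclosed singularity of
  h(s)/(s - n) is the point n. The three added sides have length O(R) and distance at least R/2 from
  n, so the decay of h makes their contribution vanish.\<close>

lemma line_contour_tendsto:
  fixes n :: nat
  shows "((\<lambda>R. 1 / (2 * of_real pi) * (LBINT y:{-R..R}. h (line y) / (of_nat n - line y))) \<longlongrightarrow> h (of_nat n)) at_top"
proof -
  let ?J = "\<lambda>R. 1 / (2 * of_real pi) * (LBINT y:{-R..R}. h (line y) / (of_nat n - line y))"
  let ?g = "\<lambda>s. h s / (s - of_nat n)"
  \<comment> \<open>R > 2n gives |s - n| >= R/2 on the right side, and R > \<open>\<mu>\<close>
    bounds the length R + \<open>\<mu>\<close> of the horizontal sides by 2R. Each of the three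
    sides contributes 4, and division of 12 by 2 pi >= 2 leaves 6.\<close>
  have key: "norm (?J R - h (of_nat n)) \<le> C * (1 + R) powr (- \<psi>) * 6" if R: "R > 2 * real n + \<mu> + 1" for R
  proof -
    have Rpos: "R > 0" "R > \<mu>" "R > real n" using R mu by auto
    let ?a = "Complex (- \<mu>) (- R)" and ?b = "Complex R R"
    have box: "of_nat n \<in> box ?a ?b" using Rpos mu by (auto simp: in_box_complex_iff)
    have img: "path_image (rectpath ?a ?b) \<subseteq> {s. Re s > - m} - {of_nat n}"
    proof -
      have "path_image (rectpath ?a ?b) = {z. Re z \<in> {- \<mu>, R} \<and> Im z \<in> {- R..R}} \<union>
          {z. Im z \<in> {- R, R} \<and> Re z \<in> {- \<mu>..R}}"
        using Rpos mu by (subst path_image_rectpath) auto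
      then show ?thesis using Rpos mu by auto
    qed
    have "(?g has_contour_integral (2 * pi * \<i> * winding_number (rectpath ?a ?b) (of_nat n) * h (of_nat n))) (rectpath ?a ?b)"
      using mu img by (intro Cauchy_integral_formula_convex_simple[OF convex_halfplane hol])
        (auto simp: interior_open[OF open_halfplane])
    then have total: "contour_integral (rectpath ?a ?b) ?g = 2 * pi * \<i> * h (of_nat n)"
      using winding_number_rectpath[OF box] by (simp add: contour_integral_unique)
    have cont: "continuous_on ({s. Re s > - m} - {of_nat n}) ?g"
      by (intro continuous_intros continuous_on_subset[OF holomorphic_on_imp_continuous_on[OF hol]]) auto
    have split: "contour_integral (rectpath ?a ?b) ?g =
      contour_integral (linepath ?a (Complex R (- R))) ?g + contour_integral (linepath (Complex R (- R)) ?b) ?g +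
      contour_integral (linepath ?b (Complex (- \<mu>) R)) ?g + contour_integral (linepath (Complex (- \<mu>) R) ?a) ?g"
      using contour_integral_rectpath[OF continuous_on_subset[OF cont img]] by simp
    \<comment> \<open>The left side is traversed downwards. This sign turns 1/(s - n) into 1/(n -
      s).\<close>
    have left: "contour_integral (linepath (Complex (- \<mu>) R) ?a) ?g = 2 * pi * \<i> * ?J R"
    proof -
      have c: "continuous_on (closed_segment ?a (Complex (- \<mu>) R)) ?g"
        by (rule continuous_on_subset[OF cont]) (use Rpos mu in \<open>auto simp: closed_segment_same_Re\<close>)
      have "contour_integral (linepath (Complex (- \<mu>) R) ?a) ?g = - contour_integral (linepath ?a (Complex (- \<mu>) R)) ?g"
        by (intro contour_integral_reverse_linepath) (use c in \<open>simp add: closed_segment_commute\<close>)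
      also have "\<dots> = - (\<i> * (LBINT y:{-R..R}. ?g (line y)))"
        using contour_integral_vertical[OF c] Rpos by simp
      also have "(LBINT y:{-R..R}. ?g (line y)) = (LBINT y:{-R..R}. - (h (line y) / (of_nat n - line y)))"
        by (simp only: minus_divide_right minus_diff_eq)
      also have "\<dots> = - (LBINT y:{-R..R}. h (line y) / (of_nat n - line y))"
        by (simp add: set_lebesgue_integral_def)
      finally show ?thesis by simp
    qed
    define B where "B = C * (1 + R) powr (- \<psi>) / (R / 2)"
    have side: "norm (contour_integral (linepath x y) ?g) \<le> B * (2 * R)"
      if sub: "closed_segment x y \<subseteq> {s. Re s > - m} - {of_nat n}"
        and far: "\<And>s. s \<in> closed_segment x y \<Longrightarrow> Re s \<ge> - \<mu> \<and> norm (s + of_real \<mu>) \<ge> R \<and> norm (s - of_nat n) \<ge> R / 2"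
        and len: "norm (y - x) \<le> 2 * R" for x y
    proof -
      have "norm (contour_integral (linepath x y) ?g) \<le> B * norm (y - x)"
      proof (rule norm_contour_integral_linepath_le[OF continuous_on_subset[OF cont sub]])
        fix s assume s: "s \<in> closed_segment x y"
        have "norm (h s) / norm (s - of_nat n) \<le> C * (1 + R) powr (- \<psi>) / (R / 2)"
          using far[OF s] Rpos C by (intro frac_le bound_ge) auto
        then show "norm (?g s) \<le> B" by (simp add: norm_divide B_def)
      qed
      also have "\<dots> \<le> B * (2 * R)" using len Rpos C by (intro mult_left_mono) (auto simp: B_def)
      finally show ?thesis .
    qed
    have BR: "B * (2 * R) = C * (1 + R) powr (- \<psi>) * 4" using Rpos by (simp add: B_def)
    have horiz: "norm (contour_integral (linepath x y) ?g) \<le> C * (1 + R) powr (- \<psi>) * 4"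
      if "Im x = Im y" "\<bar>Im x\<bar> = R" "{Re x, Re y} = {- \<mu>, R}" for x y
      unfolding BR[symmetric]
    proof (rule side)
      have seg: "Im s = Im x \<and> Re s \<ge> - \<mu>" if "s \<in> closed_segment x y" for s
        using that \<open>Im x = Im y\<close> \<open>{Re x, Re y} = {- \<mu>, R}\<close> Rpos mu
        by (auto simp: closed_segment_same_Im closed_segment_eq_real_ivl doubleton_eq_iff split: if_splits)
      \<comment> \<open>On a horizontal side the imaginary part alone has modulus R, so the distance
        to every real point, in particular to -\<open>\<mu>\<close> and to n, is at least R.\<close>
      have im: "norm (s + of_real r) \<ge> R" if "s \<in> closed_segment x y" for s r
        using seg[OF that] abs_Im_le_cmod[of "s + of_real r"] \<open>\<bar>Im x\<bar> = R\<close> by simp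
      show "closed_segment x y \<subseteq> {s. Re s > - m} - {of_nat n}"
        using seg mu im[where r = "- real n"] Rpos by force
      show "Re s \<ge> - \<mu> \<and> norm (s + of_real \<mu>) \<ge> R \<and> norm (s - of_nat n) \<ge> R / 2" if "s \<in> closed_segment x y" for s
        using seg[OF that] im[OF that, of \<mu>] im[OF that, of "- real n"] Rpos by simp
      have "norm (y - x) = \<bar>Re y - Re x\<bar>" using \<open>Im x = Im y\<close> by (simp add: cmod_def)
      then show "norm (y - x) \<le> 2 * R"
        using \<open>{Re x, Re y} = {- \<mu>, R}\<close> Rpos mu by (auto simp: doubleton_eq_iff)
    qed
    have right: "norm (contour_integral (linepath (Complex R (- R)) ?b) ?g) \<le> C * (1 + R) powr (- \<psi>) * 4"
      unfolding BR[symmetric]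
    proof (rule side)
      have seg: "Re s = R" if "s \<in> closed_segment (Complex R (- R)) ?b" for s
        using that by (auto simp: closed_segment_same_Re)
      show "closed_segment (Complex R (- R)) ?b \<subseteq> {s. Re s > - m} - {of_nat n}"
        using seg Rpos mu by fastforce
      show "Re s \<ge> - \<mu> \<and> norm (s + of_real \<mu>) \<ge> R \<and> norm (s - of_nat n) \<ge> R / 2"
        if "s \<in> closed_segment (Complex R (- R)) ?b" for s
        using seg[OF that] complex_Re_le_cmod[of "s + of_real \<mu>"] complex_Re_le_cmod[of "s - of_nat n"] R mu Rpos
        by simp
      show "norm (?b - Complex R (- R)) \<le> 2 * R" using Rpos by (simp add: cmod_def real_sqrt_mult)
    qed
    have "2 * pi * \<i> * (?J R - h (of_nat n)) = - (contour_integral (linepath ?a (Complex R (- R))) ?g +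
        contour_integral (linepath (Complex R (- R)) ?b) ?g + contour_integral (linepath ?b (Complex (- \<mu>) R)) ?g)"
      using total split left by (simp add: algebra_simps)
    then have "norm (2 * pi * \<i> * (?J R - h (of_nat n))) \<le> C * (1 + R) powr (- \<psi>) * 4 + C * (1 + R) powr (- \<psi>) * 4
        + C * (1 + R) powr (- \<psi>) * 4"
      using Rpos by (simp only: norm_minus_cancel) (intro norm_triangle_mono horiz right; simp add: insert_commute)
    also have "norm (2 * pi * \<i> * (?J R - h (of_nat n))) = 2 * pi * norm (?J R - h (of_nat n))"
      by (simp add: norm_mult)
    also have "2 * pi * norm (?J R - h (of_nat n)) \<ge> 2 * norm (?J R - h (of_nat n))"
      using pi_gt3 by (intro mult_right_mono) auto
    finally show ?thesis by simp
  qed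
  have "((\<lambda>R. C * (1 + R) powr (- \<psi>) * 6) \<longlongrightarrow> 0) at_top"
    using tendsto_mult[OF tendsto_mult[OF tendsto_const powr_neg_psi_tendsto_0] tendsto_const, of C 6] by simp
  then have "((\<lambda>R. ?J R - h (of_nat n)) \<longlongrightarrow> 0) at_top"
    by (rule Lim_null_comparison[rotated])
      (rule eventually_mono[OF eventually_gt_at_top[of "2 * real n + \<mu> + 1"] key])
  then show ?thesis by (simp add: LIM_zero_iff)
qed

lemma integrable_weight:
  "integrable lborel (\<lambda>t. indicator {0<..<1} t *\<^sub>R (K * (t powr (\<mu> - 1) * (1 - t) powr (\<delta> - 1))))"
proof -
  have "set_integrable lborel {0<..<1} (\<lambda>t. t powr (\<mu> - 1) * (1 - t) powr (\<delta> - 1))"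
    by (rule set_integrable_subset[OF integrable_Beta]) (use mu delta in auto)
  then show ?thesis
    unfolding set_integrable_def[symmetric] by (rule set_integrable_mult_right)
qed

theorem moment_mellin_inv:
  fixes n :: nat
  shows "(LBINT t:{0<..<1}. of_real (t ^ n) * (mellin_inv t / of_real t)) = h (of_nat n)"
proof (rule tendsto_unique)
  show "((\<lambda>R. 1 / (2 * of_real pi) * (LBINT y:{-R..R}. h (line y) / (of_nat n - line y))) \<longlongrightarrow> h (of_nat n)) at_top"
    by (rule line_contour_tendsto)
  have "((\<lambda>R. LBINT t:{0<..<1}. of_real (t ^ n) * (trunc R t / of_real t)) \<longlongrightarrow>
      (LBINT t:{0<..<1}. of_real (t ^ n) * (mellin_inv t / of_real t))) at_top"
    unfolding set_lebesgue_integral_def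
  proof (rule integral_dominated_convergence_at_top[OF _ _ integrable_weight])
    show "AE t in lborel. ((\<lambda>R. indicat_real {0<..<1} t *\<^sub>R (of_real (t ^ n) * (trunc R t / of_real t))) \<longlongrightarrow>
      indicat_real {0<..<1} t *\<^sub>R (of_real (t ^ n) * (mellin_inv t / of_real t))) at_top"
    proof (intro AE_I2)
      fix t :: real
      show "((\<lambda>R. indicat_real {0<..<1} t *\<^sub>R (of_real (t ^ n) * (trunc R t / of_real t))) \<longlongrightarrow>
        indicat_real {0<..<1} t *\<^sub>R (of_real (t ^ n) * (mellin_inv t / of_real t))) at_top"
        by (cases "t \<in> {0<..<1}") (auto intro!: tendsto_intros trunc_tendsto)
    qed
    show "\<forall>\<^sub>F R in at_top. AE t in lborel. norm (indicat_real {0<..<1} t *\<^sub>R (of_real (t ^ n) * (trunc R t / of_real t)))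
      \<le> indicator {0<..<1} t *\<^sub>R (K * (t powr (\<mu> - 1) * (1 - t) powr (\<delta> - 1)))"
      using eventually_ge_at_top[of 0]
    proof eventually_elim
      fix R :: real assume R: "R \<ge> 0"
      show "AE t in lborel. norm (indicat_real {0<..<1} t *\<^sub>R (of_real (t ^ n) * (trunc R t / of_real t)))
      \<le> indicator {0<..<1} t *\<^sub>R (K * (t powr (\<mu> - 1) * (1 - t) powr (\<delta> - 1)))"
      proof (intro AE_I2)
        fix t :: real
        have "t ^ n * (norm (trunc R t) / t) \<le> K * (t powr (\<mu> - 1) * (1 - t) powr (\<delta> - 1))" if t: "0 < t" "t < 1"
        proof -
          have "t ^ n * (norm (trunc R t) / t) \<le> 1 * (K * (t powr \<mu> * (1 - t) powr (\<delta> - 1)) / t)"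
            using t norm_trunc_le[OF t R] by (intro mult_mono divide_right_mono power_le_one) auto
          also have "\<dots> = K * (t powr (\<mu> - 1) * (1 - t) powr (\<delta> - 1))"
            using t by (simp add: powr_diff)
          finally show ?thesis .
        qed
        then show "norm (indicat_real {0<..<1} t *\<^sub>R (of_real (t ^ n) * (trunc R t / of_real t)))
          \<le> indicator {0<..<1} t *\<^sub>R (K * (t powr (\<mu> - 1) * (1 - t) powr (\<delta> - 1)))"
          by (auto simp: indicator_def norm_mult norm_divide norm_power)
      qed
    qed
  qed measurable
  moreover have "\<forall>\<^sub>F R in at_top. (LBINT t:{0<..<1}. of_real (t ^ n) * (trunc R t / of_real t)) =
      1 / (2 * of_real pi) * (LBINT y:{-R..R}. h (line y) / (of_nat n - line y))"
    using eventually_gt_at_top[of 0] by eventually_elim (rule trunc_moment)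
  ultimately show "((\<lambda>R. 1 / (2 * of_real pi) * (LBINT y:{-R..R}. h (line y) / (of_nat n - line y))) \<longlongrightarrow>
      (LBINT t:{0<..<1}. of_real (t ^ n) * (mellin_inv t / of_real t))) at_top"
    by (rule Lim_transform_eventually)
qed (simp add: trivial_limit_at_top_linorder)

text \<open>This identifies the limit on the line Re s = c with the one on Re s =
  -\<open>\<mu>\<close>. The integrand has no singularity between the lines, and the horizontal
  sides joining them have the fixed length c + \<open>\<mu>\<close>, so the decay of h suffices to
  remove them.\<close>

theorem vertical_integral_tendsto:
  assumes t: "0 < t" "t < 1" and c: "c > - \<mu>"
  shows "((\<lambda>R::real. 1 / (2 * of_real pi * \<i>) * contour_integral (linepath (Complex c (- R)) (Complex c R))
    (\<lambda>s. h s * of_real t powr (- s))) \<longlongrightarrow> mellin_inv t) at_top"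
proof -
  let ?g = "\<lambda>s. h s * of_real t powr (- s)"
  let ?I = "\<lambda>R. 1 / (2 * of_real pi * \<i>) * contour_integral (linepath (Complex c (- R)) (Complex c R)) ?g"
  have tp: "of_real t powr (- s) = exp (- s * of_real (ln t))" for s :: complex
    using t by (simp add: powr_def Ln_of_real)
  have gh: "?g holomorphic_on {s. Re s > - m}"
    unfolding tp by (intro holomorphic_intros hol)
  have cont: "continuous_on {s. Re s > - m} ?g" by (rule holomorphic_on_imp_continuous_on[OF gh])
  \<comment> \<open>For t < 1 and Re s <= c one has |t^(-s)| <= t^(-c); the last factor is the
    length of a horizontal side.\<close>
  define M where "M = C * t powr (- c) * (c + \<mu>)"
  have key: "norm (?I R - trunc R t) \<le> M * (1 + R) powr (- \<psi>)" if R: "R > 0" for R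
  proof -
    let ?a = "Complex (- \<mu>) (- R)" and ?b = "Complex c R"
    have img: "path_image (rectpath ?a ?b) \<subseteq> {s. Re s > - m}"
    proof -
      have "path_image (rectpath ?a ?b) = {z. Re z \<in> {- \<mu>, c} \<and> Im z \<in> {- R..R}} \<union>
          {z. Im z \<in> {- R, R} \<and> Re z \<in> {- \<mu>..c}}"
        using R c by (subst path_image_rectpath) auto
      then show ?thesis using R mu c by auto
    qed
    have "(?g has_contour_integral 0) (rectpath ?a ?b)"
      using img by (intro Cauchy_theorem_convex_simple[OF gh convex_halfplane]) auto
    then have total: "contour_integral (rectpath ?a ?b) ?g = 0" by (rule contour_integral_unique)
    have split: "contour_integral (rectpath ?a ?b) ?g =
      contour_integral (linepath ?a (Complex c (- R))) ?g + contour_integral (linepath (Complex c (- R)) ?b) ?g +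
      contour_integral (linepath ?b (Complex (- \<mu>) R)) ?g + contour_integral (linepath (Complex (- \<mu>) R) ?a) ?g"
      using contour_integral_rectpath[OF continuous_on_subset[OF cont img]] by simp
    have left: "contour_integral (linepath (Complex (- \<mu>) R) ?a) ?g = - (2 * of_real pi * \<i> * trunc R t)"
    proof -
      have k: "continuous_on (closed_segment ?a (Complex (- \<mu>) R)) ?g"
        by (rule continuous_on_subset[OF cont]) (use R mu in \<open>auto simp: closed_segment_same_Re\<close>)
      have "contour_integral (linepath (Complex (- \<mu>) R) ?a) ?g = - contour_integral (linepath ?a (Complex (- \<mu>) R)) ?g"
        by (intro contour_integral_reverse_linepath) (use k in \<open>simp add: closed_segment_commute\<close>)
      also have "\<dots> = - (\<i> * (LBINT y:{-R..R}. ?g (line y)))"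
        using contour_integral_vertical[OF k] R by simp
      finally show ?thesis unfolding trunc_def tp by simp
    qed
    have horiz: "norm (contour_integral (linepath x y) ?g) \<le> M * (1 + R) powr (- \<psi>)"
      if "Im x = Im y" "\<bar>Im x\<bar> = R" "{Re x, Re y} = {- \<mu>, c}" for x y
    proof -
      have seg: "Im s = Im x \<and> Re s \<ge> - \<mu> \<and> Re s \<le> c" if "s \<in> closed_segment x y" for s
        using that \<open>Im x = Im y\<close> \<open>{Re x, Re y} = {- \<mu>, c}\<close> R mu c
        by (auto simp: closed_segment_same_Im closed_segment_eq_real_ivl doubleton_eq_iff split: if_splits)
      have "norm (contour_integral (linepath x y) ?g) \<le> (C * (1 + R) powr (- \<psi>) * t powr (- c)) * norm (y - x)"
      proof (rule norm_contour_integral_linepath_le)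
        show "continuous_on (closed_segment x y) ?g"
          by (rule continuous_on_subset[OF cont]) (use seg mu in force)
        fix s assume s: "s \<in> closed_segment x y"
        have "norm (h s) \<le> C * (1 + R) powr (- \<psi>)"
          using seg[OF s] abs_Im_le_cmod[of "s + of_real \<mu>"] \<open>\<bar>Im x\<bar> = R\<close> R by (intro bound_ge) auto
        moreover have "norm (of_real t powr (- s)) \<le> t powr (- c)"
        proof -
          have "norm (of_real t powr (- s)) = t powr (- Re s)" using t by (simp add: tp powr_def)
          also have "\<dots> \<le> t powr (- c)" using t seg[OF s] by (intro powr_mono') auto
          finally show ?thesis .
        qed
        ultimately show "norm (?g s) \<le> C * (1 + R) powr (- \<psi>) * t powr (- c)"
          using C unfolding norm_mult by (intro mult_mono) auto
      qed
      also have "norm (y - x) = \<bar>Re y - Re x\<bar>" using \<open>Im x = Im y\<close> by (simp add: cmod_def)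
      also have "\<dots> = c + \<mu>" using \<open>{Re x, Re y} = {- \<mu>, c}\<close> c by (auto simp: doubleton_eq_iff)
      finally show ?thesis by (simp add: M_def mult_ac)
    qed
    have "2 * of_real pi * \<i> * (?I R - trunc R t) = - (contour_integral (linepath ?a (Complex c (- R))) ?g +
        contour_integral (linepath ?b (Complex (- \<mu>) R)) ?g)"
      using total split left by (simp add: algebra_simps)
    then have "norm (2 * of_real pi * \<i> * (?I R - trunc R t)) \<le> M * (1 + R) powr (- \<psi>) + M * (1 + R) powr (- \<psi>)"
      using R by (simp only: norm_minus_cancel) (intro norm_triangle_mono horiz; simp add: insert_commute)
    also have "norm (2 * of_real pi * \<i> * (?I R - trunc R t)) = 2 * pi * norm (?I R - trunc R t)"
      by (simp add: norm_mult)
    also have "2 * pi * norm (?I R - trunc R t) \<ge> 2 * norm (?I R - trunc R t)"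
      using pi_gt3 by (intro mult_right_mono) auto
    finally show ?thesis by simp
  qed
  have "((\<lambda>R. M * (1 + R) powr (- \<psi>)) \<longlongrightarrow> 0) at_top"
    by (rule tendsto_mult_right_zero[OF powr_neg_psi_tendsto_0])
  then have "((\<lambda>R. ?I R - trunc R t) \<longlongrightarrow> 0) at_top"
    by (rule Lim_null_comparison[rotated])
      (rule eventually_mono[OF eventually_gt_at_top[of 0] key])
  from tendsto_add[OF this trunc_tendsto[OF t]] show ?thesis by simp
qed

end

section \<open>A Stieltjes representation of the binomial kernel\<close>

text \<open>This is minus the imaginary part of (1 + u e^(i
  pi/\<open>\<sigma>\<close>))^(-\<open>\<sigma>\<close>), that is, of the boundary value of the
  binomial kernel on the upper ray.\<close>

definition stieltjes_density :: "real \<Rightarrow> real \<Rightarrow> real" where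
  "stieltjes_density \<sigma> u = sin (\<sigma> * arctan (u * sin (pi / \<sigma>) / (1 + u * cos (pi / \<sigma>))))
     / (1 + 2 * u * cos (pi / \<sigma>) + u\<^sup>2) powr (\<sigma> / 2)"

lemma cos_pi_div_nonneg: "\<sigma> \<ge> 2 \<Longrightarrow> cos (pi / \<sigma>) \<ge> (0::real)"
  by (intro cos_ge_zero) (auto simp: field_simps intro: order_trans[of _ 0])

text \<open>\<open>\<sigma>\<close> >= 2 makes cos(pi/\<open>\<sigma>\<close>) nonnegative, so the
  base lies in the right half-plane, where its argument is the arctangent of Im/Re.\<close>

lemma exp_minus_Ln_one_plus_cis:
  assumes \<sigma>: "\<sigma> \<ge> 2" and u: "u \<ge> 0"
  shows "Im (exp (- of_real \<sigma> * Ln (1 + of_real u * cis (pi / \<sigma>)))) = - stieltjes_density \<sigma> u"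
proof -
  let ?w = "1 + of_real u * cis (pi / \<sigma>)"
  have re: "Re ?w > 0" using cos_pi_div_nonneg[OF \<sigma>] u by (simp add: add_pos_nonneg)
  then have w0: "?w \<noteq> 0" by (metis less_irrefl zero_complex.sel(1))
  have "(1 + u * C)\<^sup>2 + (u * S)\<^sup>2 = 1 + 2 * u * C + u\<^sup>2 * (C\<^sup>2 + S\<^sup>2)" for C S :: real
    by (simp add: power2_eq_square algebra_simps)
  from this[of "cos (pi / \<sigma>)" "sin (pi / \<sigma>)"]
  have n2: "norm ?w ^ 2 = 1 + 2 * u * cos (pi / \<sigma>) + u\<^sup>2"
    unfolding cmod_power2 by simp
  have "(1 + 2 * u * cos (pi / \<sigma>) + u\<^sup>2) powr (\<sigma> / 2) = norm ?w powr \<sigma>"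
    unfolding n2[symmetric] using w0 by (simp add: powr_powr flip: powr_numeral)
  moreover have "Im (Ln ?w) = arctan (u * sin (pi / \<sigma>) / (1 + u * cos (pi / \<sigma>)))"
    using arg_conv_arctan[OF re] w0 by (simp add: Arg_eq_Im_Ln)
  moreover have "Re (Ln ?w) = ln (norm ?w)" using w0 by simp
  moreover have "norm ?w powr \<sigma> = exp (\<sigma> * ln (norm ?w))" using w0 by (simp add: powr_def)
  ultimately show ?thesis
    by (simp add: stieltjes_density_def Im_exp exp_minus[of "\<sigma> * ln (norm ?w)"] inverse_eq_divide)
qed

text \<open>The denominator is at least max(1, u^\<open>\<sigma>\<close>), which dominates every
  power u^kappa with 0 <= kappa <= \<open>\<sigma>\<close>. The free exponent is needed: 0 gives
  boundedness, 1 integrability in y for fixed t, and a small positive value the joint integrability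
  in y and t.\<close>

lemma abs_stieltjes_density_le:
  assumes \<sigma>: "\<sigma> \<ge> 2" and u: "u > 0" and \<kappa>: "0 \<le> \<kappa>" "\<kappa> \<le> \<sigma>"
  shows "\<bar>stieltjes_density \<sigma> u\<bar> \<le> u powr (- \<kappa>)"
proof -
  let ?d = "1 + 2 * u * cos (pi / \<sigma>) + u\<^sup>2"
  have d: "?d \<ge> 1" "?d \<ge> u\<^sup>2" using cos_pi_div_nonneg[OF \<sigma>] u by auto
  have "u powr \<kappa> \<le> ?d powr (\<sigma> / 2)"
  proof (cases "u \<le> 1")
    case True
    then have "u powr \<kappa> \<le> 1" using u \<kappa> by (intro powr_le1) auto
    also have "1 \<le> ?d powr (\<sigma> / 2)" using d \<sigma> by (intro ge_one_powr_ge_zero) auto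
    finally show ?thesis .
  next
    case False
    then have "u powr \<kappa> \<le> u powr \<sigma>" using \<kappa> by (intro powr_mono) auto
    also have "\<dots> = (u\<^sup>2) powr (\<sigma> / 2)" using u by (simp add: powr_powr flip: powr_numeral)
    also have "\<dots> \<le> ?d powr (\<sigma> / 2)" using d \<sigma> by (intro powr_mono2) auto
    finally show ?thesis .
  qed
  moreover have "u powr \<kappa> > 0" using u by simp
  ultimately have "\<bar>stieltjes_density \<sigma> u\<bar> \<le> 1 / u powr \<kappa>"
    unfolding stieltjes_density_def abs_divide by (intro frac_le) auto
  then show ?thesis by (simp add: powr_minus_divide)
qed

lemma measurable_stieltjes_density [measurable]: "stieltjes_density \<sigma> \<in> borel_measurable borel"
proof -
  have [measurable]: "arctan \<in> borel_measurable borel"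
    by (intro borel_measurable_continuous_onI continuous_intros)
  show ?thesis unfolding stieltjes_density_def by measurable
qed

lemma continuous_stieltjes_density:
  assumes "\<sigma> \<ge> 2" shows "continuous_on {0..} (stieltjes_density \<sigma>)"
proof -
  have ne: "1 + u * cos (pi / \<sigma>) \<noteq> 0" "1 + 2 * u * cos (pi / \<sigma>) + u\<^sup>2 \<noteq> 0"
    if "u \<in> {0..}" for u
  proof -
    have "u * cos (pi / \<sigma>) \<ge> 0" using cos_pi_div_nonneg[OF assms] that by simp
    moreover have "u\<^sup>2 \<ge> 0" by simp
    ultimately show "1 + u * cos (pi / \<sigma>) \<noteq> 0" "1 + 2 * u * cos (pi / \<sigma>) + u\<^sup>2 \<noteq> 0"
      by linarith+
  qed
  then have "(1 + 2 * u * cos (pi / \<sigma>) + u\<^sup>2) powr (\<sigma> / 2) \<noteq> 0" if "u \<in> {0..}" for u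
    using that by simp
  with ne show ?thesis
    unfolding stieltjes_density_def by (intro continuous_intros ballI)
qed

text \<open>Two bounds are combined: |x + w| is at least the distance d of w from the closed
  negative axis, and x <= |x + w| + |w|. The surplus |w| + 1 is paid for by the multiple (|w| + 1)/d
  of the first bound.\<close>

lemma shifted_slit_lower_bound:
  fixes w :: complex
  assumes "w \<notin> \<real>\<^sub>\<le>\<^sub>0"
  obtains c where "c > 0" "\<And>x. x \<ge> 0 \<Longrightarrow> norm (of_real x + w) \<ge> c * (1 + x)"
proof -
  have w0: "w \<noteq> 0" using assms by auto
  have "closed (\<real>\<^sub>\<le>\<^sub>0 :: complex set)" by simp
  then obtain d where d: "d > 0" "\<And>x. x \<in> \<real>\<^sub>\<le>\<^sub>0 \<Longrightarrow> d \<le> dist w x"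
    using separate_point_closed[OF _ assms] by blast
  define c where "c = 1 / (1 + (norm w + 1) / d)"
  have k: "1 + (norm w + 1) / d > 0" using d by (simp add: add_pos_nonneg)
  show ?thesis
  proof (rule that[of c])
    show "c > 0" using k by (simp add: c_def)
    fix x :: real assume x: "x \<ge> 0"
    have "- of_real x \<in> (\<real>\<^sub>\<le>\<^sub>0 :: complex set)" using x by (simp add: complex_nonpos_Reals_iff)
    from d(2)[OF this] have 1: "d \<le> norm (of_real x + w)" by (simp add: dist_norm add.commute)
    have "x = norm (of_real x + w - w)" using x by simp
    also have "\<dots> \<le> norm (of_real x + w) + norm w" by (rule norm_triangle_ineq4)
    finally have "1 + x \<le> norm (of_real x + w) + (norm w + 1)" by simp
    also have "norm w + 1 = (norm w + 1) / d * d" using d by simp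
    also have "(norm w + 1) / d * d \<le> (norm w + 1) / d * norm (of_real x + w)"
      using 1 d by (intro mult_left_mono) auto
    finally have "1 + x \<le> (1 + (norm w + 1) / d) * norm (of_real x + w)" by (simp add: algebra_simps)
    then show "c * (1 + x) \<le> norm (of_real x + w)"
      using k by (simp add: c_def field_simps)
  qed
qed

text \<open>Under the hypothesis \<open>\<sigma>\<close> Ln z is itself the principal logarithm of
  the power, whose argument therefore stays away from pi.\<close>

lemma powr_notin_nonpos_Reals:
  fixes z :: complex
  assumes "z \<noteq> 0" "\<bar>\<sigma> * Arg z\<bar> < pi"
  shows "z powr of_real \<sigma> \<notin> \<real>\<^sub>\<le>\<^sub>0"
proof
  let ?w = "z powr of_real \<sigma>"
  assume neg: "?w \<in> \<real>\<^sub>\<le>\<^sub>0"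
  have w: "?w = exp (of_real \<sigma> * Ln z)" using assms by (simp add: powr_def)
  have w0: "?w \<noteq> 0" using assms by simp
  have "Im (Ln ?w) = \<sigma> * Arg z"
    unfolding w using assms by (subst Ln_exp) (auto simp: Arg_eq_Im_Ln)
  moreover have "Im (Ln ?w) = pi"
    using neg w0 by (auto simp: Im_Ln_eq_pi complex_nonpos_Reals_iff complex_eq_iff)
  ultimately show False using assms by simp
qed

text \<open>kappa < \<open>\<sigma>\<close> is integrability at 0 and kappa > 0 integrability at
  infinity, where the integrand behaves like y^(-1 - kappa).\<close>

lemma set_integrable_powr_over_one_plus_powr:
  fixes \<kappa> \<sigma> :: real
  assumes "0 < \<kappa>" "\<kappa> < \<sigma>"
  shows "set_integrable lborel {0<..} (\<lambda>y. y powr (\<sigma> - 1 - \<kappa>) / (1 + y powr \<sigma>))"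
  unfolding set_integrable_def
proof (rule Bochner_Integration.integrable_bound)
  show "integrable lborel (\<lambda>y. indicator {0..1} y *\<^sub>R y powr (\<sigma> - 1 - \<kappa>) + indicator {1..} y *\<^sub>R y powr (- 1 - \<kappa>))"
    using set_integrable_powr_from_0[of "\<sigma> - 1 - \<kappa>" 1] set_integrable_powr_to_inf[of "- 1 - \<kappa>" 1] assms
    unfolding set_integrable_def by (intro Bochner_Integration.integrable_add) auto
  have "y powr (\<sigma> - 1 - \<kappa>) / (1 + y powr \<sigma>) \<le> y powr (\<sigma> - 1 - \<kappa>)" for y :: real
    by (simp add: divide_le_eq add_pos_nonneg mult_le_cancel_left1)
  moreover have "y powr (\<sigma> - 1 - \<kappa>) / (1 + y powr \<sigma>) \<le> y powr (- 1 - \<kappa>)" if "y > 0" for y :: real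
  proof -
    have "y powr (\<sigma> - 1 - \<kappa>) / (1 + y powr \<sigma>) \<le> y powr (\<sigma> - 1 - \<kappa>) / y powr \<sigma>"
      using that by (intro divide_left_mono) (auto intro!: mult_pos_pos add_pos_nonneg)
    also have "\<dots> = y powr (- 1 - \<kappa>)" using that by (simp flip: powr_diff)
    finally show ?thesis .
  qed
  ultimately show "AE y in lborel. norm (indicator {0<..} y *\<^sub>R (y powr (\<sigma> - 1 - \<kappa>) / (1 + y powr \<sigma>)))
      \<le> norm (indicator {0..1} y *\<^sub>R y powr (\<sigma> - 1 - \<kappa>) + indicator {1..} y *\<^sub>R y powr (- 1 - \<kappa>))"
    by (intro AE_I2) (auto simp: indicator_def intro: add_increasing2)
qed measurable

lemma contour_integral_horizontal:
  assumes "continuous_on (closed_segment (Complex a c) (Complex b c)) f" "a < b"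
  shows "contour_integral (linepath (Complex a c) (Complex b c)) f = (LBINT x:{a..b}. f (Complex x c))"
proof -
  have c: "continuous_on {a..b} (\<lambda>x. f (Complex x c))"
  proof (rule continuous_on_compose2[OF assms(1)])
    show "continuous_on {a..b} (\<lambda>x. Complex x c)"
      unfolding Complex_eq by (intro continuous_intros)
    show "(\<lambda>x. Complex x c) ` {a..b} \<subseteq> closed_segment (Complex a c) (Complex b c)"
      by (auto simp: closed_segment_same_Im closed_segment_eq_real_ivl)
  qed
  have l: "linepath (Complex a c) (Complex b c) x = linepath (of_real a) (of_real b) x + Complex 0 c" for x
    by (simp add: linepath_def complex_eq_iff algebra_simps)
  have d: "Complex b c - Complex a c = of_real b - of_real a"
    by (simp add: complex_eq_iff)
  have "contour_integral (linepath (Complex a c) (Complex b c)) f =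
      contour_integral (linepath (of_real a) (of_real b)) (\<lambda>w. f (w + Complex 0 c))"
    by (simp add: contour_integral_integral l d)
  also have "\<dots> = integral {a..b} (\<lambda>x. f (of_real x + Complex 0 c))"
    using assms(2) by (subst contour_integral_linepath_Reals_eq) auto
  also have "(\<lambda>x. f (of_real x + Complex 0 c)) = (\<lambda>x. f (Complex x c))"
    by (intro ext arg_cong[where f = f]) (simp add: complex_eq_iff)
  also have "integral {a..b} (\<lambda>x. f (Complex x c)) = (LBINT x:{a..b}. f (Complex x c))"
    by (rule set_borel_integral_eq_integral(2)[symmetric, OF borel_integrable_atLeastAtMost'[OF c]])
  finally show ?thesis .
qed

lemma Re_exp_nonneg: "\<bar>Im v\<bar> \<le> pi / 2 \<Longrightarrow> Re (exp v) \<ge> 0"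
  by (auto simp: Re_exp abs_le_iff intro!: mult_nonneg_nonneg cos_ge_zero)

lemma one_plus_exp_notin_nonpos_Reals:
  fixes v :: complex
  assumes "t > 0" "\<bar>Im v\<bar> < pi"
  shows "1 + of_real t * exp v \<notin> \<real>\<^sub>\<le>\<^sub>0"
proof
  assume "1 + of_real t * exp v \<in> \<real>\<^sub>\<le>\<^sub>0"
  then have *: "1 + t * (exp (Re v) * cos (Im v)) \<le> 0" "t * (exp (Re v) * sin (Im v)) = 0"
    by (auto simp: complex_nonpos_Reals_iff Re_exp Im_exp)
  then have "sin (Im v) = 0" using assms by simp
  then have "Im v = 0" using assms by (auto intro: sin_eq_0_pi[of "Im v"])
  then have "t * (exp (Re v) * cos (Im v)) > 0" using assms by simp
  then show False using *(1) by linarith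
qed

text \<open>The residue theorem for the sector \<open>\<bar>arg \<zeta>\<bar> \<le> \<pi>/\<sigma>\<close> is applied in the variable
  \<open>v = Ln \<zeta>\<close>, which turns truncated sectors into rectangles. On both horizontal edges
  \<open>exp (\<sigma> v)\<close> is a negative real number.\<close>

context
  fixes \<sigma> t :: real and z :: complex
  assumes \<sigma>: "\<sigma> \<ge> 2" and t: "t > 0" and z: "z \<noteq> 0" "\<bar>Arg z\<bar> < pi / \<sigma>"
begin

private definition "w = z powr of_real \<sigma>"
private definition "F v = exp (- of_real \<sigma> * Ln (1 + of_real t * exp v))"
text \<open>The form \<open>\<sigma>\<close> zeta^(\<open>\<sigma>\<close> - 1) (1 + t
  zeta)^(-\<open>\<sigma>\<close>) / (zeta^\<open>\<sigma>\<close> - z^\<open>\<sigma>\<close>)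
  dzeta after zeta = e^v. The factor \<open>\<sigma>\<close> normalises the residue at zeta = z to
  the value of the kernel there.\<close>

private definition "g v = (of_real \<sigma> * exp (of_real \<sigma> * v) * F v) / (exp (of_real \<sigma> * v) - w)"
private definition "k y = complex_of_real (y powr (\<sigma> - 1) * stieltjes_density \<sigma> (t * y)) / (of_real (y powr \<sigma>) + w)"
private definition "\<theta> = pi / \<sigma>"
text \<open>Half the width of the strip \<open>S\<close>. The bound pi keeps 1 + t e^v off the cut
  of the logarithm; the other bound excludes all zeros Ln z + 2 pi i n / \<open>\<sigma>\<close> of
  the denominator except n = 0.\<close>

private definition "\<rho> = min pi (2 * pi / \<sigma> - \<bar>Arg z\<bar>)"
private definition "S = {v. - \<rho> < Im v} \<inter> {v. Im v < \<rho>}"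

private lemma theta: "0 < \<theta>" "\<theta> \<le> pi / 2" "\<theta> < \<rho>" "\<sigma> * \<theta> = pi"
proof -
  show t: "0 < \<theta>" "\<theta> \<le> pi / 2" "\<sigma> * \<theta> = pi"
    using \<sigma> by (auto simp: \<theta>_def field_simps)
  have "\<theta> < pi" using t pi_gt_zero by linarith
  moreover have "\<theta> < 2 * pi / \<sigma> - \<bar>Arg z\<bar>" using z by (simp add: \<theta>_def)
  ultimately show "\<theta> < \<rho>" by (simp add: \<rho>_def)
qed

private lemma S: "open S" "convex S"
  unfolding S_def by (auto intro!: open_Int convex_Int open_halfspace_Im_gt open_halfspace_Im_lt
      convex_halfspace_Im_gt convex_halfspace_Im_lt)

private lemma S_imp: "v \<in> S \<Longrightarrow> \<bar>Im v\<bar> < pi" "v \<in> S \<Longrightarrow> \<bar>Im v\<bar> < 2 * pi / \<sigma> - \<bar>Arg z\<bar>"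
  by (auto simp: S_def \<rho>_def)

private lemma w_eq: "w = exp (of_real \<sigma> * Ln z)"
  using z by (simp add: w_def powr_def)

private lemma norm_w: "norm w = exp (\<sigma> * ln (norm z))"
  using z by (simp add: w_eq)

private lemma zero_iff:
  assumes "v \<in> S" shows "exp (of_real \<sigma> * v) - w = 0 \<longleftrightarrow> v = Ln z"
proof
  assume "exp (of_real \<sigma> * v) - w = 0"
  then have "exp (of_real \<sigma> * v) = exp (of_real \<sigma> * Ln z)" by (simp add: w_eq)
  then obtain n :: int where n: "of_real \<sigma> * v = of_real \<sigma> * Ln z + (of_int (2 * n) * pi) * \<i>"
    unfolding exp_eq by blast
  then have "Im (of_real \<sigma> * v) = Im (of_real \<sigma> * Ln z + (of_int (2 * n) * pi) * \<i>)" by simp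
  then have 1: "\<sigma> * (Im v - Arg z) = 2 * of_int n * pi" using z by (simp add: Arg_eq_Im_Ln algebra_simps)
  have "\<bar>Im v - Arg z\<bar> < 2 * pi / \<sigma>" using S_imp(2)[OF assms] by linarith
  then have "\<sigma> * \<bar>Im v - Arg z\<bar> < 2 * pi" using \<sigma> by (simp add: field_simps)
  moreover have "\<sigma> * \<bar>Im v - Arg z\<bar> = \<bar>of_int n\<bar> * (2 * pi)"
    using arg_cong[OF 1, of abs] \<sigma> by (simp add: abs_mult)
  ultimately have "\<bar>of_int n :: real\<bar> * (2 * pi) < 1 * (2 * pi)" by simp
  then have "\<bar>of_int n :: real\<bar> < 1" by (subst (asm) mult_less_cancel_right) auto
  then have "n = 0" by linarith
  with n show "v = Ln z" using \<sigma> by simp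
qed (simp add: w_eq)

private lemma F_holo: "F holomorphic_on S"
  unfolding F_def using one_plus_exp_notin_nonpos_Reals[OF t] S_imp(1)
  by (intro holomorphic_intros) auto

private lemma Ln_z_in_S: "Ln z \<in> S"
  using z theta by (auto simp: S_def Arg_eq_Im_Ln \<theta>_def)

private lemma g_holo: "g holomorphic_on S - {Ln z}"
  unfolding g_def using zero_iff
  by (intro holomorphic_intros holomorphic_on_subset[OF F_holo]) auto

private lemma residue_g: "residue g (Ln z) = (1 + of_real t * z) powr (- of_real \<sigma>)"
proof -
  have "residue g (Ln z) = (of_real \<sigma> * exp (of_real \<sigma> * Ln z) * F (Ln z)) / (of_real \<sigma> * exp (of_real \<sigma> * Ln z))"
    unfolding g_def
  proof (rule residue_simple_pole_deriv[OF _ _ S(1) convex_connected[OF S(2)] Ln_z_in_S])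
    show "(\<lambda>v. of_real \<sigma> * exp (of_real \<sigma> * v) * F v) holomorphic_on S"
      by (intro holomorphic_intros F_holo)
    show "((\<lambda>v. exp (of_real \<sigma> * v) - w) has_field_derivative of_real \<sigma> * exp (of_real \<sigma> * Ln z)) (at (Ln z))"
      by (auto intro!: derivative_eq_intros)
  qed (use \<sigma> in \<open>auto intro!: holomorphic_intros simp: F_def w_eq\<close>)
  also have "\<dots> = F (Ln z)" using \<sigma> by simp
  also have "\<dots> = (1 + of_real t * z) powr (- of_real \<sigma>)"
  proof -
    have "1 + of_real t * z \<noteq> 0"
      using one_plus_exp_notin_nonpos_Reals[OF t S_imp(1)[OF Ln_z_in_S]] z by auto
    then show ?thesis using z by (simp add: F_def powr_def)
  qed
  finally show ?thesis .
qed

text \<open>For |Im v| <= \<open>\<theta>\<close> <= pi/2 the number e^v has nonnegative real part,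
  so adding 1 cannot shorten it. The first bound serves the left edge of the rectangle, the second
  the right edge.\<close>

private lemma norm_one_plus_ge:
  assumes "\<bar>Im v\<bar> \<le> \<theta>"
  shows "norm (1 + of_real t * exp v) \<ge> 1" "norm (1 + of_real t * exp v) \<ge> t * exp (Re v)"
proof -
  have re: "Re (exp v) \<ge> 0" using assms theta by (intro Re_exp_nonneg) simp
  have "1 \<le> Re (1 + of_real t * exp v)" using re t by simp
  also have "\<dots> \<le> norm (1 + of_real t * exp v)" by (rule complex_Re_le_cmod)
  finally show "norm (1 + of_real t * exp v) \<ge> 1" .
  have "norm (of_real t * exp v) \<le> norm (1 + of_real t * exp v)"
    using re t by (simp add: cmod_def power_mono)
  then show "norm (1 + of_real t * exp v) \<ge> t * exp (Re v)" using t by (simp add: norm_mult)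
qed

private lemma norm_F: "\<bar>Im v\<bar> \<le> \<theta> \<Longrightarrow> norm (F v) = norm (1 + of_real t * exp v) powr (- \<sigma>)"
  using norm_one_plus_ge(1)[of v] by (auto simp: F_def powr_def)

private lemma F_cnj: "\<bar>Im v\<bar> < pi \<Longrightarrow> F (cnj v) = cnj (F v)"
  unfolding F_def using cnj_Ln[OF one_plus_exp_notin_nonpos_Reals[OF t, of v]]
  by (simp add: exp_cnj)

text \<open>Both edges give the same real value -e^(\<open>\<sigma>\<close> x) for
  e^(\<open>\<sigma>\<close> v), so only \<open>F\<close> differs between them. Its values there are
  complex conjugates, hence the difference is 2 i times the density. The factor e^x prepares the
  substitution y = e^x.\<close>

private lemma edge_diff:
  "g (Complex x (- \<theta>)) - g (Complex x \<theta>) = 2 * \<i> * of_real \<sigma> * (exp x *\<^sub>R k (exp x))"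
proof -
  have e: "exp (of_real \<sigma> * Complex x \<theta>) = - of_real (exp (\<sigma> * x))"
    "exp (of_real \<sigma> * Complex x (- \<theta>)) = - of_real (exp (\<sigma> * x))"
    using theta(4) by (simp_all add: complex_eq_iff Re_exp Im_exp)
  have "exp (Complex x \<theta>) = of_real (exp x) * cis (pi / \<sigma>)"
    by (simp add: complex_eq_iff Re_exp Im_exp \<theta>_def)
  then have im: "Im (F (Complex x \<theta>)) = - stieltjes_density \<sigma> (t * exp x)"
    using exp_minus_Ln_one_plus_cis[OF \<sigma>, of "t * exp x"] t by (simp add: F_def mult.assoc)
  have "Complex x (- \<theta>) = cnj (Complex x \<theta>)" by (simp add: complex_eq_iff)
  then have "F (Complex x (- \<theta>)) = cnj (F (Complex x \<theta>))"
    using F_cnj[of "Complex x \<theta>"] theta pi_gt_zero by simp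
  then have d: "F (Complex x (- \<theta>)) - F (Complex x \<theta>) = 2 * \<i> * of_real (stieltjes_density \<sigma> (t * exp x))"
    using im by (simp add: complex_eq_iff)
  have gx: "g (Complex x s) = of_real \<sigma> * of_real (exp (\<sigma> * x)) * F (Complex x s) / (of_real (exp (\<sigma> * x)) + w)"
    if "s = \<theta> \<or> s = - \<theta>" for s
  proof -
    have "- of_real (exp (\<sigma> * x)) - w = - (of_real (exp (\<sigma> * x)) + w)" by simp
    then show ?thesis using that e unfolding g_def by (auto simp only: mult_minus_left mult_minus_right minus_divide_divide)
  qed
  have "g (Complex x (- \<theta>)) - g (Complex x \<theta>)
    = of_real \<sigma> * of_real (exp (\<sigma> * x)) * (F (Complex x (- \<theta>)) - F (Complex x \<theta>)) / (of_real (exp (\<sigma> * x)) + w)"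
    by (simp only: gx simp_thms diff_divide_distrib right_diff_distrib)
  also have "\<dots> = 2 * \<i> * of_real \<sigma> * (of_real (exp (\<sigma> * x)) * of_real (stieltjes_density \<sigma> (t * exp x)) / (of_real (exp (\<sigma> * x)) + w))"
    unfolding d by (simp only: mult_ac times_divide_eq_right times_divide_eq_left)
  also have "of_real (exp (\<sigma> * x)) * of_real (stieltjes_density \<sigma> (t * exp x)) / (of_real (exp (\<sigma> * x)) + w) = exp x *\<^sub>R k (exp x)"
  proof -
    have p: "exp x powr \<sigma> = exp (\<sigma> * x)" "exp x * exp x powr (\<sigma> - 1) = exp (\<sigma> * x)"
      by (simp_all add: powr_def left_diff_distrib flip: exp_add)
    have "exp x *\<^sub>R k (exp x) = of_real (exp x * exp x powr (\<sigma> - 1) * stieltjes_density \<sigma> (t * exp x)) / (of_real (exp x powr \<sigma>) + w)"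
      unfolding k_def scaleR_conv_of_real by (simp only: of_real_mult mult.assoc times_divide_eq_right)
    then show ?thesis unfolding p by (simp only: of_real_mult)
  qed
  finally show ?thesis .
qed

private lemma w_notin: "w \<notin> \<real>\<^sub>\<le>\<^sub>0"
proof -
  have "\<bar>\<sigma> * Arg z\<bar> < pi" using z \<sigma> by (simp add: abs_mult field_simps)
  then show ?thesis unfolding w_def using z by (intro powr_notin_nonpos_Reals)
qed

private lemma w_denom: "y \<ge> 0 \<Longrightarrow> of_real y + w \<noteq> 0"
proof
  assume "y \<ge> 0" "of_real y + w = 0"
  then have "w = of_real (- y)" by (simp add: add_eq_0_iff)
  then show False using w_notin \<open>y \<ge> 0\<close> by simp
qed

private lemma k_measurable: "set_borel_measurable lborel {0<..} k"
  unfolding set_borel_measurable_def k_def by measurable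

private lemma k_integrable: "set_integrable lborel {0<..} k"
proof -
  obtain c where c: "c > 0" "\<And>x. x \<ge> 0 \<Longrightarrow> norm (of_real x + w) \<ge> c * (1 + x)"
    using shifted_slit_lower_bound[OF w_notin] by blast
  show ?thesis
  proof (rule set_integrable_bound[OF _ k_measurable])
    \<comment> \<open>The density bound is used with exponent 1, which is allowed because 0 < 1 <
      \<open>\<sigma>\<close>.\<close>
    show "set_integrable lborel {0<..} (\<lambda>y. (t powr (-1) / c) * (y powr (\<sigma> - 1 - 1) / (1 + y powr \<sigma>)))"
      using \<sigma> by (intro set_integrable_mult_right set_integrable_powr_over_one_plus_powr) auto
    show "AE y in lborel. y \<in> {0<..} \<longrightarrow> norm (k y) \<le> norm ((t powr (-1) / c) * (y powr (\<sigma> - 1 - 1) / (1 + y powr \<sigma>)))"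
    proof (intro AE_I2 impI)
      fix y :: real assume "y \<in> {0<..}"
      then have y: "y > 0" by simp
      have p: "1 + y powr \<sigma> > 0" by (simp add: add_pos_nonneg)
      have "norm (k y) = y powr (\<sigma> - 1) * \<bar>stieltjes_density \<sigma> (t * y)\<bar> / norm (of_real (y powr \<sigma>) + w)"
        by (simp add: k_def norm_divide norm_mult)
      also have "\<dots> \<le> y powr (\<sigma> - 1) * (t * y) powr (-1) / (c * (1 + y powr \<sigma>))"
        using y t \<sigma> c p by (intro frac_le mult_left_mono abs_stieltjes_density_le) auto
      also have "y powr (\<sigma> - 1) * (t * y) powr (-1) = t powr (-1) * y powr (\<sigma> - 1 - 1)"
        using y t by (simp add: powr_mult powr_diff powr_minus_divide field_simps power2_eq_square)
      also have "t powr (-1) * y powr (\<sigma> - 1 - 1) / (c * (1 + y powr \<sigma>)) = (t powr (-1) / c) * (y powr (\<sigma> - 1 - 1) / (1 + y powr \<sigma>))"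
        by simp
      finally show "norm (k y) \<le> norm ((t powr (-1) / c) * (y powr (\<sigma> - 1 - 1) / (1 + y powr \<sigma>)))"
        by (rule order_trans) (simp only: real_norm_def abs_ge_self)
    qed
  qed
qed

private lemma k_substitution:
  assumes "R > 0"
  shows "(LBINT x:{-R..R}. exp x *\<^sub>R k (exp x)) = (LBINT y:{exp (-R)..exp R}. k y)"
proof -
  have "exp ` {- R..R} \<subseteq> {0<..}" by auto
  moreover have "continuous_on {0<..} k"
    unfolding k_def using t w_denom
    by (intro continuous_intros continuous_on_compose2[OF continuous_stieltjes_density[OF \<sigma>]]) auto
  ultimately have "continuous_on (exp ` {- R..R}) k" by (rule continuous_on_subset[rotated])
  then have "(LBINT x=-R..R. exp x *\<^sub>R k (exp x)) = (LBINT y=exp (-R)..exp R. k y)"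
    using assms by (intro interval_integral_substitution_finite)
      (auto intro!: derivative_eq_intros continuous_intros)
  then show ?thesis using assms by (simp add: interval_integral_Icc)
qed

private lemma k_tendsto: "((\<lambda>R. LBINT y:{exp (-R)..exp R}. k y) \<longlongrightarrow> (LBINT y:{0<..}. k y)) at_top"
  unfolding set_lebesgue_integral_def
proof (rule integral_dominated_convergence_at_top)
  show "integrable lborel (\<lambda>y. norm (indicator {0<..} y *\<^sub>R k y))"
    using k_integrable unfolding set_integrable_def by (rule integrable_norm)
  show "(\<lambda>y. indicator {0<..} y *\<^sub>R k y) \<in> borel_measurable lborel"
    using k_measurable by (simp add: set_borel_measurable_def)
  show "(\<lambda>y. indicator {exp (-R)..exp R} y *\<^sub>R k y) \<in> borel_measurable lborel" for R
    unfolding k_def by measurable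
  show "AE y in lborel. ((\<lambda>R. indicator {exp (-R)..exp R} y *\<^sub>R k y) \<longlongrightarrow> indicator {0<..} y *\<^sub>R k y) at_top"
  proof (intro AE_I2 tendsto_eventually)
    fix y :: real
    show "\<forall>\<^sub>F R in at_top. indicator {exp (-R)..exp R} y *\<^sub>R k y = indicator {0<..} y *\<^sub>R k y"
    proof (cases "y > 0")
      case True
      show ?thesis using eventually_ge_at_top[of "\<bar>ln y\<bar>"]
      proof eventually_elim
        case (elim R)
        then have "exp (-R) \<le> exp (ln y)" "exp (ln y) \<le> exp R" unfolding exp_le_cancel_iff by linarith+
        then show ?case using True by (simp add: indicator_def)
      qed
    next
      case False
      then have "y \<notin> {exp (-R)..exp R}" for R
        using exp_gt_zero[of "-R"] unfolding atLeastAtMost_iff by linarith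
      then show ?thesis using False by (simp add: indicator_def)
    qed
  qed
  show "\<forall>\<^sub>F R in at_top. AE y in lborel. norm (indicator {exp (-R)..exp R} y *\<^sub>R k y) \<le> norm (indicator {0<..} y *\<^sub>R k y)"
  proof (intro always_eventually allI AE_I2)
    fix R y :: real
    show "norm (indicator {exp (-R)..exp R} y *\<^sub>R k y) \<le> norm (indicator {0<..} y *\<^sub>R k y)"
      using less_le_trans[OF exp_gt_zero[of "-R"], of y] by (auto simp: indicator_def)
  qed
qed

text \<open>The two vertical edges have length 2 \<open>\<theta>\<close>. On the right edge the
  decay of \<open>F\<close> cancels the factor e^(\<open>\<sigma>\<close> R) of the numerator of
  \<open>g\<close>; on the left edge |\<open>F\<close>| <= 1 and that factor is itself
  small.\<close>

private definition "err R = 2 * \<theta> * (\<sigma> * t powr (- \<sigma>) / (exp (\<sigma> * R) - norm w) + \<sigma> * exp (- (\<sigma> * R)) / (norm w - exp (- (\<sigma> * R))))"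

private lemma err_tendsto: "(err \<longlongrightarrow> 0) at_top"
proof -
  have "filterlim (\<lambda>R. exp (\<sigma> * R)) at_top at_top"
    by (rule filterlim_compose[OF exp_at_top filterlim_tendsto_pos_mult_at_top[OF tendsto_const _ filterlim_ident]])
      (use \<sigma> in auto)
  then have f: "filterlim (\<lambda>R. - norm w + exp (\<sigma> * R)) at_top at_top"
    by (rule filterlim_tendsto_add_at_top[OF tendsto_const])
  have e0: "((\<lambda>R. exp (- (\<sigma> * R))) \<longlongrightarrow> 0) at_top"
    by (rule filterlim_compose[OF exp_at_bot])
      (use \<sigma> in \<open>auto simp: filterlim_uminus_at_bot intro!: filterlim_tendsto_pos_mult_at_top[OF tendsto_const _ filterlim_ident]\<close>)
  have "((\<lambda>R. \<sigma> * t powr (- \<sigma>) / (exp (\<sigma> * R) - norm w)) \<longlongrightarrow> 0) at_top"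
    using tendsto_divide_0[OF tendsto_const filterlim_at_top_imp_at_infinity[OF f]] by simp
  moreover have "norm w \<noteq> 0" by (simp add: norm_w)
  then have "((\<lambda>R. \<sigma> * exp (- (\<sigma> * R)) / (norm w - exp (- (\<sigma> * R)))) \<longlongrightarrow> \<sigma> * 0 / (norm w - 0)) at_top"
    by (intro tendsto_intros e0) simp
  ultimately have "(err \<longlongrightarrow> 2 * \<theta> * (0 + \<sigma> * 0 / (norm w - 0))) at_top"
    unfolding err_def by (intro tendsto_mult tendsto_const tendsto_add)
  then show ?thesis by simp
qed

text \<open>R > |ln |z|| places the pole Ln z inside the rectangle and makes both denominators of
  \<open>err R\<close> positive.\<close>

private lemma rectangle:
  assumes R: "R > \<bar>ln (norm z)\<bar>"
  shows "norm (2 * pi * \<i> * (1 + of_real t * z) powr (- of_real \<sigma>) -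
    2 * \<i> * of_real \<sigma> * (LBINT y:{exp (-R)..exp R}. k y)) \<le> err R"
proof -
  let ?a = "Complex (- R) (- \<theta>)" and ?b = "Complex R \<theta>"
  have R0: "R > 0" using R by linarith
  have box: "Ln z \<in> box ?a ?b"
    using R z theta by (auto simp: in_box_complex_iff Arg_eq_Im_Ln \<theta>_def)
  have img_eq: "path_image (rectpath ?a ?b) = {v. Re v \<in> {- R, R} \<and> Im v \<in> {- \<theta>..\<theta>}} \<union>
      {v. Im v \<in> {- \<theta>, \<theta>} \<and> Re v \<in> {- R..R}}"
    using R0 theta by (subst path_image_rectpath) auto
  have img: "path_image (rectpath ?a ?b) \<subseteq> S - {Ln z}"
    unfolding img_eq using theta box by (auto simp: S_def in_box_complex_iff)
  have "contour_integral (rectpath ?a ?b) g = 2 * pi * \<i> * (\<Sum>p\<in>{Ln z}. winding_number (rectpath ?a ?b) p * residue g p)"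
  proof (rule Residue_theorem[OF S(1) convex_connected[OF S(2)] _ g_holo])
    show "\<forall>v. v \<notin> S \<longrightarrow> winding_number (rectpath ?a ?b) v = 0"
    proof (intro allI impI winding_number_rectpath_outside)
      fix v assume "v \<notin> S"
      then show "v \<notin> cbox ?a ?b" using theta by (auto simp: S_def in_cbox_complex_iff)
    qed (use R0 theta in auto)
  qed (use img in auto)
  then have total: "contour_integral (rectpath ?a ?b) g = 2 * pi * \<i> * (1 + of_real t * z) powr (- of_real \<sigma>)"
    using winding_number_rectpath[OF box] residue_g by simp
  have cont: "continuous_on (S - {Ln z}) g" by (rule holomorphic_on_imp_continuous_on[OF g_holo])
  have split: "contour_integral (rectpath ?a ?b) g =
      contour_integral (linepath ?a (Complex R (- \<theta>))) g + contour_integral (linepath (Complex R (- \<theta>)) ?b) g +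
      contour_integral (linepath ?b (Complex (- R) \<theta>)) g + contour_integral (linepath (Complex (- R) \<theta>) ?a) g"
    using contour_integral_rectpath[OF continuous_on_subset[OF cont img]] by simp
  have ci: "continuous_on (closed_segment p q) g" if "closed_segment p q \<subseteq> path_image (rectpath ?a ?b)" for p q
    using that img by (intro continuous_on_subset[OF cont]) auto
  have cb: "continuous_on (closed_segment (Complex (- R) y) (Complex R y)) g" if "y = \<theta> \<or> y = - \<theta>" for y
    by (rule ci) (use that R0 theta in \<open>auto simp: img_eq closed_segment_same_Im closed_segment_eq_real_ivl\<close>)
  have cv: "continuous_on (closed_segment (Complex x y) (Complex x (- y))) g" if "x = R \<or> x = - R" "y = \<theta> \<or> y = - \<theta>" for x y
    by (rule ci) (use that R0 theta in \<open>auto simp: img_eq closed_segment_same_Re closed_segment_eq_real_ivl\<close>)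
  have bottom: "contour_integral (linepath ?a (Complex R (- \<theta>))) g = (LBINT x:{-R..R}. g (Complex x (- \<theta>)))"
    using R0 by (intro contour_integral_horizontal cb) auto
  have top: "contour_integral (linepath ?b (Complex (- R) \<theta>)) g = - (LBINT x:{-R..R}. g (Complex x \<theta>))"
  proof -
    have "contour_integral (linepath ?b (Complex (- R) \<theta>)) g = - contour_integral (linepath (Complex (- R) \<theta>) ?b) g"
      by (intro contour_integral_reverse_linepath) (use cb[of \<theta>] in \<open>simp add: closed_segment_commute\<close>)
    also have "contour_integral (linepath (Complex (- R) \<theta>) ?b) g = (LBINT x:{-R..R}. g (Complex x \<theta>))"
      using R0 by (intro contour_integral_horizontal cb) auto
    finally show ?thesis .
  qed
  have sint: "set_integrable lborel {-R..R} (\<lambda>x. g (Complex x y))" if "y = \<theta> \<or> y = - \<theta>" for y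
  proof (intro borel_integrable_atLeastAtMost' continuous_on_compose2[OF cb[OF that]])
    show "continuous_on {-R..R} (\<lambda>x. Complex x y)" unfolding Complex_eq by (intro continuous_intros)
    show "(\<lambda>x. Complex x y) ` {-R..R} \<subseteq> closed_segment (Complex (- R) y) (Complex R y)"
      by (auto simp: closed_segment_same_Im closed_segment_eq_real_ivl)
  qed
  have "contour_integral (linepath ?a (Complex R (- \<theta>))) g + contour_integral (linepath ?b (Complex (- R) \<theta>)) g
      = (LBINT x:{-R..R}. g (Complex x (- \<theta>)) - g (Complex x \<theta>))"
    unfolding bottom top using set_integral_diff(2)[OF sint[of "- \<theta>"] sint[of \<theta>]] by simp
  also have "\<dots> = 2 * \<i> * of_real \<sigma> * (LBINT x:{-R..R}. exp x *\<^sub>R k (exp x))"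
    unfolding edge_diff by (rule set_integral_mult_right)
  also have "\<dots> = 2 * \<i> * of_real \<sigma> * (LBINT y:{exp (-R)..exp R}. k y)"
    by (simp only: k_substitution[OF R0])
  finally have hor: "contour_integral (linepath ?a (Complex R (- \<theta>))) g + contour_integral (linepath ?b (Complex (- R) \<theta>)) g
      = 2 * \<i> * of_real \<sigma> * (LBINT y:{exp (-R)..exp R}. k y)" .
  have seg: "Re v = x \<and> \<bar>Im v\<bar> \<le> \<theta>" if "v \<in> closed_segment (Complex x y) (Complex x (- y))" "y = \<theta> \<or> y = - \<theta>" for v x y
    using that theta by (auto simp: closed_segment_same_Re closed_segment_eq_real_ivl split: if_splits)
  have len: "norm (Complex x (- y) - Complex x y) = 2 * \<theta>" if "y = \<theta> \<or> y = - \<theta>" for x y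
    using that theta by (auto simp: cmod_def real_sqrt_mult)
  have norm_e: "norm (exp (of_real \<sigma> * v)) = exp (\<sigma> * Re v)" for v by simp
  have right: "norm (contour_integral (linepath (Complex R (- \<theta>)) (Complex R (- (- \<theta>)))) g)
      \<le> (\<sigma> * t powr (- \<sigma>) / (exp (\<sigma> * R) - norm w)) * norm (Complex R (- (- \<theta>)) - Complex R (- \<theta>))"
  proof (rule norm_contour_integral_linepath_le[OF cv])
    fix v assume "v \<in> closed_segment (Complex R (- \<theta>)) (Complex R (- (- \<theta>)))"
    then have v: "Re v = R" "\<bar>Im v\<bar> \<le> \<theta>" using seg[of v R "- \<theta>"] by auto
    have "norm (F v) \<le> (t * exp R) powr (- \<sigma>)"
      unfolding norm_F[OF v(2)] using norm_one_plus_ge(2)[OF v(2)] t v \<sigma> by (intro powr_mono2') auto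
    also have "\<dots> = t powr (- \<sigma>) * exp R powr (- \<sigma>)" using t by (simp add: powr_mult)
    also have "exp R powr (- \<sigma>) = 1 / exp (\<sigma> * R)" by (simp add: powr_def exp_minus divide_inverse)
    finally have "norm (F v) \<le> t powr (- \<sigma>) / exp (\<sigma> * R)" by simp
    then have "\<sigma> * exp (\<sigma> * R) * norm (F v) \<le> \<sigma> * exp (\<sigma> * R) * (t powr (- \<sigma>) / exp (\<sigma> * R))"
      using \<sigma> by (intro mult_left_mono) auto
    then have num: "\<sigma> * exp (\<sigma> * R) * norm (F v) \<le> \<sigma> * t powr (- \<sigma>)" by simp
    have "exp (\<sigma> * R) - norm w \<le> norm (exp (of_real \<sigma> * v) - w)"
      using norm_triangle_ineq2[of "exp (of_real \<sigma> * v)" w] v by (simp only: norm_e)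
    moreover have "exp (\<sigma> * R) - norm w > 0" using R \<sigma> by (simp add: norm_w)
    ultimately have "\<sigma> * exp (\<sigma> * R) * norm (F v) / norm (exp (of_real \<sigma> * v) - w) \<le> \<sigma> * t powr (- \<sigma>) / (exp (\<sigma> * R) - norm w)"
      using num \<sigma> by (intro frac_le) auto
    then show "norm (g v) \<le> \<sigma> * t powr (- \<sigma>) / (exp (\<sigma> * R) - norm w)"
      using v \<sigma> unfolding g_def norm_divide norm_mult norm_e by simp
  qed auto
  have left: "norm (contour_integral (linepath (Complex (- R) \<theta>) (Complex (- R) (- \<theta>))) g)
      \<le> (\<sigma> * exp (- (\<sigma> * R)) / (norm w - exp (- (\<sigma> * R)))) * norm (Complex (- R) (- \<theta>) - Complex (- R) \<theta>)"
  proof (rule norm_contour_integral_linepath_le[OF cv])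
    fix v assume "v \<in> closed_segment (Complex (- R) \<theta>) (Complex (- R) (- \<theta>))"
    then have v: "Re v = - R" "\<bar>Im v\<bar> \<le> \<theta>" using seg[of v "- R" \<theta>] by auto
    have "norm (F v) \<le> 1 powr (- \<sigma>)"
      unfolding norm_F[OF v(2)] using norm_one_plus_ge(1)[OF v(2)] \<sigma> by (intro powr_mono2') auto
    then have "norm (F v) \<le> 1" by simp
    then have num: "\<sigma> * exp (- (\<sigma> * R)) * norm (F v) \<le> \<sigma> * exp (- (\<sigma> * R))"
      using \<sigma> by (intro mult_left_le) auto
    have "norm w - exp (- (\<sigma> * R)) \<le> norm (exp (of_real \<sigma> * v) - w)"
      using norm_triangle_ineq2[of w "exp (of_real \<sigma> * v)"] v
      by (simp add: norm_minus_commute)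
    moreover have "norm w - exp (- (\<sigma> * R)) > 0"
    proof -
      have "\<sigma> * (- R) < \<sigma> * ln (norm z)" using R \<sigma> by (intro mult_strict_left_mono) auto
      then show ?thesis by (simp add: norm_w)
    qed
    ultimately have "\<sigma> * exp (- (\<sigma> * R)) * norm (F v) / norm (exp (of_real \<sigma> * v) - w) \<le> \<sigma> * exp (- (\<sigma> * R)) / (norm w - exp (- (\<sigma> * R)))"
      using num \<sigma> by (intro frac_le) auto
    then show "norm (g v) \<le> \<sigma> * exp (- (\<sigma> * R)) / (norm w - exp (- (\<sigma> * R)))"
      using v \<sigma> unfolding g_def norm_divide norm_mult norm_e by simp
  qed auto
  have "2 * pi * \<i> * (1 + of_real t * z) powr (- of_real \<sigma>) - 2 * \<i> * of_real \<sigma> * (LBINT y:{exp (-R)..exp R}. k y)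
      = contour_integral (linepath (Complex R (- \<theta>)) ?b) g + contour_integral (linepath (Complex (- R) \<theta>) ?a) g"
    unfolding total[symmetric] split hor[symmetric] by simp
  also have "norm \<dots> \<le> (\<sigma> * t powr (- \<sigma>) / (exp (\<sigma> * R) - norm w)) * (2 * \<theta>) +
      (\<sigma> * exp (- (\<sigma> * R)) / (norm w - exp (- (\<sigma> * R)))) * (2 * \<theta>)"
    using right left len[of "- \<theta>" R] len[of \<theta> "- R"] by (intro norm_triangle_mono) simp_all
  also have "\<dots> = err R" by (simp add: err_def algebra_simps)
  finally show ?thesis .
qed

lemma stieltjes_binomial:
  "(1 + of_real t * z) powr (- of_real \<sigma>) = of_real (\<sigma> / pi) *
    (LBINT y:{0<..}. complex_of_real (y powr (\<sigma> - 1) * stieltjes_density \<sigma> (t * y)) / (of_real (y powr \<sigma>) + z powr of_real \<sigma>))"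
proof -
  let ?X = "2 * pi * \<i> * (1 + of_real t * z) powr (- of_real \<sigma>)"
  have "((\<lambda>R. ?X - 2 * \<i> * of_real \<sigma> * (LBINT y:{exp (-R)..exp R}. k y)) \<longlongrightarrow> 0) at_top"
    by (rule Lim_null_comparison[OF eventually_mono[OF eventually_gt_at_top rectangle] err_tendsto])
  moreover have "((\<lambda>R. ?X - 2 * \<i> * of_real \<sigma> * (LBINT y:{exp (-R)..exp R}. k y)) \<longlongrightarrow>
      ?X - 2 * \<i> * of_real \<sigma> * (LBINT y:{0<..}. k y)) at_top"
    by (intro tendsto_intros k_tendsto)
  ultimately have "?X - 2 * \<i> * of_real \<sigma> * (LBINT y:{0<..}. k y) = 0"
    by (intro tendsto_unique) (auto simp: trivial_limit_at_top_linorder)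
  then show ?thesis unfolding k_def w_def by (simp add: field_simps)
qed

end

section \<open>Euler type integrals\<close>

text \<open>Cauchy's inequality turns the local domination into one of the difference quotients.\<close>

lemma holomorphic_on_LINT:
  fixes f :: "complex \<Rightarrow> 'a \<Rightarrow> complex"
  assumes S: "open S" and hol: "\<And>t. (\<lambda>x. f x t) holomorphic_on S"
    and meas: "\<And>x. x \<in> S \<Longrightarrow> f x \<in> borel_measurable M"
    and W: "integrable M W"
    and loc: "\<And>x. x \<in> S \<Longrightarrow> \<exists>r>0. \<exists>B\<ge>0. ball x r \<subseteq> S \<and> (\<forall>y\<in>ball x r. \<forall>t. norm (f y t) \<le> B * W t)"
  shows "(\<lambda>x. LINT t|M. f x t) holomorphic_on S"
  unfolding holomorphic_on_def
proof
  fix x assume x: "x \<in> S"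
  from loc[OF x] obtain r B where r: "r > 0" "ball x r \<subseteq> S" and B: "B \<ge> 0"
    and bnd: "\<And>y t. y \<in> ball x r \<Longrightarrow> norm (f y t) \<le> B * W t" by blast
  have int: "integrable M (f y)" if "y \<in> ball x r" for y
  proof (rule Bochner_Integration.integrable_bound)
    show "integrable M (\<lambda>t. B * W t)" using W by simp
    show "AE t in M. norm (f y t) \<le> norm (B * W t)"
      using bnd[OF that] by (intro AE_I2) (metis abs_ge_self order_trans real_norm_def)
  qed (use that r meas in auto)
  define d where "d t = deriv (\<lambda>x. f x t) x" for t
  \<comment> \<open>For y within r/2 of x the disc of radius r/4 about y stays inside the ball of
    radius r, where the domination is available.\<close>
  define C where "C = B / (r / 4)"
  have der: "((\<lambda>x. f x t) has_field_derivative deriv (\<lambda>x. f x t) y) (at y)" if "y \<in> S" for y t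
    by (rule holomorphic_derivI[OF hol S that])
  have dbnd: "norm (deriv (\<lambda>x. f x t) y) \<le> C * W t" if y: "y \<in> ball x (r / 2)" for y t
  proof -
    have sub: "cball y (r / 4) \<subseteq> ball x r"
    proof
      fix u assume "u \<in> cball y (r / 4)"
      then show "u \<in> ball x r" using y dist_triangle[of x u y] r by simp
    qed
    then have subS: "cball y (r / 4) \<subseteq> S" using r by blast
    have "norm ((deriv ^^ 1) (\<lambda>x. f x t) y) \<le> fact 1 * (B * W t) / (r / 4) ^ 1"
    proof (rule Cauchy_inequality)
      show "(\<lambda>x. f x t) holomorphic_on ball y (r / 4)"
        by (rule holomorphic_on_subset[OF hol]) (use subS ball_subset_cball in blast)
      show "continuous_on (cball y (r / 4)) (\<lambda>x. f x t)"
        by (rule continuous_on_subset[OF holomorphic_on_imp_continuous_on[OF hol] subS])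
      show "norm (f u t) \<le> B * W t" if "norm (y - u) = r / 4" for u
        by (rule bnd) (use that sub in \<open>auto simp: subset_iff dist_norm\<close>)
    qed (use r in auto)
    then show ?thesis by (simp add: C_def mult_ac)
  qed
  have lip: "norm (f y t - f x t) \<le> C * W t * norm (y - x)" if "y \<in> ball x (r / 2)" for y t
  proof (rule field_differentiable_bound[OF convex_ball])
    fix u assume u: "u \<in> ball x (r / 2)"
    have "ball x (r / 2) \<subseteq> ball x r" using r(1) by (intro subset_ball) simp
    then have "u \<in> S" using u r(2) by blast
    then show "((\<lambda>x. f x t) has_field_derivative deriv (\<lambda>x. f x t) u) (at u within ball x (r / 2))"
      by (rule has_field_derivative_at_within[OF der])
    show "norm (deriv (\<lambda>x. f x t) u) \<le> C * W t" by (rule dbnd[OF u])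
  next
    show "y \<in> ball x (r / 2)" "x \<in> ball x (r / 2)" using that r(1) by simp_all
  qed
  have lim: "(\<lambda>n. (f (X n) t - f x t) / (X n - x)) \<longlonglongrightarrow> d t"
    if X: "\<And>n. X n \<in> ball x (r / 2) - {x}" "X \<longlonglongrightarrow> x" for X t
  proof -
    have "((\<lambda>y. (f y t - f x t) / (y - x)) \<longlongrightarrow> d t) (at x)"
      using der[OF x, of t] by (simp add: has_field_derivative_iff d_def)
    then show ?thesis
      using X unfolding tendsto_at_iff_sequentially by (auto simp: o_def)
  qed
  have "((\<lambda>y. ((LINT t|M. f y t) - (LINT t|M. f x t)) / (y - x)) \<longlongrightarrow> (LINT t|M. d t)) (at x within ball x (r / 2))"
    \<comment> \<open>Along sequences the difference quotients converge pointwise to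
      \<open>d\<close>, which gives both the measurability of \<open>d\<close> and dominated
      convergence.\<close>
    unfolding tendsto_at_iff_sequentially o_def
  proof (intro allI impI)
    fix X :: "nat \<Rightarrow> complex" assume X: "\<forall>n. X n \<in> ball x (r / 2) - {x}" "X \<longlonglongrightarrow> x"
    have in_ball: "X n \<in> ball x r" for n using X(1)[rule_format, of n] r by auto
    have XS: "X n \<in> S" for n using in_ball r by blast
    have l: "(\<lambda>n. (f (X n) t - f x t) / (X n - x)) \<longlonglongrightarrow> d t" for t
      using lim X by blast
    have m: "(\<lambda>t. (f (X n) t - f x t) / (X n - x)) \<in> borel_measurable M" for n
      using meas[OF XS] meas[OF x] by measurable
    have "(\<lambda>n. LINT t|M. (f (X n) t - f x t) / (X n - x)) \<longlonglongrightarrow> (LINT t|M. d t)"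
    proof (rule integral_dominated_convergence)
      show "d \<in> borel_measurable M" by (rule borel_measurable_LIMSEQ_metric[OF m l])
      show "integrable M (\<lambda>t. C * W t)" using W by simp
      show "AE t in M. (\<lambda>n. (f (X n) t - f x t) / (X n - x)) \<longlonglongrightarrow> d t"
        using l by (intro AE_I2)
      show "AE t in M. norm ((f (X n) t - f x t) / (X n - x)) \<le> C * W t" for n
        using X(1) lip[of "X n"] by (intro AE_I2) (auto simp: norm_divide divide_le_eq)
    qed (rule m)
    moreover have q: "(LINT t|M. (f (X n) t - f x t) / (X n - x)) = ((LINT t|M. f (X n) t) - (LINT t|M. f x t)) / (X n - x)" for n
      using int[OF in_ball] int[of x] r by simp
    ultimately show "(\<lambda>n. ((LINT t|M. f (X n) t) - (LINT t|M. f x t)) / (X n - x)) \<longlonglongrightarrow> (LINT t|M. d t)"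
      by (simp only: q)
  qed
  then have "((\<lambda>y. ((LINT t|M. f y t) - (LINT t|M. f x t)) / (y - x)) \<longlongrightarrow> (LINT t|M. d t)) (at x)"
    using r by (subst (asm) at_within_open) auto
  then have "((\<lambda>x. LINT t|M. f x t) has_field_derivative (LINT t|M. d t)) (at x)"
    by (simp add: has_field_derivative_iff)
  then show "(\<lambda>x. LINT t|M. f x t) field_differentiable at x within S"
    using field_differentiable_at_within field_differentiable_def by blast
qed

section \<open>The binomial series and the slit plane\<close>

lemma binomial_pochhammer_sums:
  fixes x :: complex
  assumes "norm x < 1"
  shows "(\<lambda>n. of_real (pochhammer \<sigma> n / fact n) * x ^ n) sums (1 - x) powr (- of_real \<sigma>)"
proof -
  have "(\<lambda>n. (- of_real \<sigma> gchoose n) * (- x) ^ n) sums (1 + (- x)) powr (- of_real \<sigma>)"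
    using assms by (intro gen_binomial_complex) simp
  moreover have "(- of_real \<sigma> gchoose n) * (- x) ^ n = of_real (pochhammer \<sigma> n / fact n) * x ^ n" for n
  proof -
    have "(- of_real \<sigma> gchoose n) * (- x) ^ n = ((-1) ^ n * (-1) ^ n) * (pochhammer (of_real \<sigma>) n / fact n * x ^ n)"
      unfolding gbinomial_pochhammer power_minus[of x n]
      by (simp only: minus_minus times_divide_eq_right times_divide_eq_left mult_ac)
    also have "(-1) ^ n * (-1) ^ n = (1::complex)" by (simp flip: power_mult_distrib)
    finally show ?thesis by (simp add: pochhammer_of_real)
  qed
  ultimately show ?thesis by simp
qed

lemma open_slit_plane: "open slit_plane"
  unfolding slit_plane_def by (intro open_Compl closed_slot_right)

lemma one_minus_notin_nonpos_Reals:
  assumes "x \<in> slit_plane" "0 \<le> t" "t \<le> 1"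
  shows "1 - of_real t * x \<notin> \<real>\<^sub>\<le>\<^sub>0"
proof
  assume "1 - of_real t * x \<in> \<real>\<^sub>\<le>\<^sub>0"
  then have *: "t * Re x \<ge> 1" "t * Im x = 0" by (auto simp: complex_nonpos_Reals_iff)
  then have "t \<noteq> 0" by auto
  then have t: "t > 0" using assms by simp
  then have "Im x = 0" using * by simp
  have "Re x > 0" using *(1) t zero_less_mult_pos[of t "Re x"] by linarith
  then have "t * Re x \<le> 1 * Re x" using assms by (intro mult_right_mono) auto
  then have "Re x \<ge> 1" using * by simp
  moreover have "x = of_real (Re x)" using \<open>Im x = 0\<close> by (simp add: complex_eq_iff)
  ultimately have "x \<in> complex_of_real ` {1..}" by (metis atLeast_iff imageI)
  then show False using assms by (simp add: slit_plane_def)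
qed

text \<open>The values of 1 - t y over a closed ball in the slit plane and t in [0, 1] form a
  compact set that avoids 0. The bound keeps the negative power of 1 - t y locally uniformly
  bounded.\<close>

lemma one_minus_lower_bound:
  assumes x: "x \<in> slit_plane"
  obtains r d where "r > 0" "d > 0" "ball x r \<subseteq> slit_plane"
    "\<And>y t. y \<in> ball x r \<Longrightarrow> 0 \<le> t \<Longrightarrow> t \<le> 1 \<Longrightarrow> d \<le> norm (1 - of_real t * y)"
proof -
  obtain r where r: "r > 0" "cball x r \<subseteq> slit_plane"
    using open_slit_plane x open_contains_cball by blast
  let ?K = "(\<lambda>(y, t::real). 1 - of_real t * y) ` (cball x r \<times> {0..1})"
  have "compact ?K"
    by (intro compact_continuous_image compact_Times) (auto intro!: continuous_intros simp: case_prod_beta)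
  moreover have "0 \<notin> ?K"
  proof
    assume "0 \<in> ?K"
    then obtain y t where yt: "y \<in> cball x r" "t \<in> {0..1}" "1 - of_real t * y = 0" by auto
    then have "1 - of_real t * y \<notin> \<real>\<^sub>\<le>\<^sub>0" using r by (intro one_minus_notin_nonpos_Reals) auto
    then show False using yt by simp
  qed
  ultimately have "\<exists>d>0. \<forall>u\<in>?K. d \<le> dist 0 u"
    by (intro separate_point_closed compact_imp_closed)
  then obtain d where d: "d > 0" "\<forall>u\<in>?K. d \<le> dist 0 u" by (elim exE conjE)
  have "d \<le> norm (1 - of_real t * y)" if "y \<in> ball x r" "0 \<le> t" "t \<le> 1" for y t
  proof -
    have "1 - of_real t * y \<in> ?K" using that by (intro image_eqI[of _ _ "(y, t)"]) auto
    from bspec[OF d(2) this] show ?thesis by (simp add: dist_norm norm_minus_commute)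
  qed
  then show ?thesis using r d ball_subset_cball[of x r] by (intro that[of r d]) auto
qed

text \<open>What the integral transforms below require of G: measurability and a majorant of Beta
  type with an exponent at 0 that survives division by t.\<close>

locale beta_dominated =
  fixes g :: "real \<Rightarrow> complex" and K \<mu> \<delta> :: real
  assumes mu: "\<mu> > 0" and delta: "\<delta> > 0"
    and g_measurable [measurable]: "g \<in> borel_measurable borel"
    and g_bound: "\<And>t. 0 < t \<Longrightarrow> t < 1 \<Longrightarrow> norm (g t) \<le> K * (t powr \<mu> * (1 - t) powr (\<delta> - 1))"
begin

text \<open>A majorant of t^(-kappa) |g(t)| / t; kappa is the part of the exponent
  \<open>\<mu>\<close> that is spent on decay in another variable.\<close>

definition weight :: "real \<Rightarrow> real \<Rightarrow> real" where
  "weight \<kappa> t = indicator {0<..<1} t *\<^sub>R (K * (t powr (\<mu> - \<kappa> - 1) * (1 - t) powr (\<delta> - 1)))"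

lemma integrable_weight: "\<kappa> < \<mu> \<Longrightarrow> integrable lborel (weight \<kappa>)"
proof -
  assume "\<kappa> < \<mu>"
  then have "set_integrable lborel {0<..<1} (\<lambda>t. t powr (\<mu> - \<kappa> - 1) * (1 - t) powr (\<delta> - 1))"
    by (intro set_integrable_subset[OF integrable_Beta]) (use delta in auto)
  then show ?thesis
    unfolding weight_def set_integrable_def[symmetric] by (rule set_integrable_mult_right)
qed

lemma norm_g_le_weight:
  assumes "0 < t" "t < 1" shows "t powr (- \<kappa>) * (norm (g t) / t) \<le> weight \<kappa> t"
proof -
  have "t powr (- \<kappa>) * (norm (g t) / t) \<le> t powr (- \<kappa>) * (K * (t powr \<mu> * (1 - t) powr (\<delta> - 1)) / t)"
    using assms g_bound by (intro mult_left_mono divide_right_mono) auto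
  also have "\<dots> = weight \<kappa> t"
    using assms by (simp add: weight_def powr_diff powr_minus_divide)
  finally show ?thesis .
qed

lemma weight_eq_0: "\<not> (0 < t \<and> t < 1) \<Longrightarrow> weight \<kappa> t = 0"
  by (auto simp: weight_def)

definition euler_integral :: "real \<Rightarrow> complex \<Rightarrow> complex" where
  "euler_integral \<sigma> x = (LBINT t:{0<..<1}. (1 - of_real t * x) powr (- of_real \<sigma>) * (g t / of_real t))"

lemma holomorphic_euler_integral:
  assumes \<sigma>: "\<sigma> \<ge> 0"
  shows "euler_integral \<sigma> holomorphic_on slit_plane"
  unfolding euler_integral_def set_lebesgue_integral_def
proof (rule holomorphic_on_LINT[OF open_slit_plane _ _ integrable_weight[OF mu]])
  fix t :: real
  show "(\<lambda>x. indicator {0<..<1} t *\<^sub>R ((1 - of_real t * x) powr (- of_real \<sigma>) * (g t / of_real t))) holomorphic_on slit_plane"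
  proof (cases "t \<in> {0<..<1}")
    case True
    then show ?thesis
      using one_minus_notin_nonpos_Reals[of _ t] by (auto intro!: holomorphic_intros)
  qed simp
next
  fix x
  show "(\<lambda>t. indicator {0<..<1} t *\<^sub>R ((1 - of_real t * x) powr (- of_real \<sigma>) * (g t / of_real t))) \<in> borel_measurable lborel"
    unfolding powr_def by measurable
next
  fix x assume "x \<in> slit_plane"
  then obtain r d where r: "r > 0" "d > 0" "ball x r \<subseteq> slit_plane"
    "\<And>y t. y \<in> ball x r \<Longrightarrow> 0 \<le> t \<Longrightarrow> t \<le> 1 \<Longrightarrow> d \<le> norm (1 - of_real t * y)"
    using one_minus_lower_bound by blast
  have "norm (indicator {0<..<1} t *\<^sub>R ((1 - of_real t * y) powr (- of_real \<sigma>) * (g t / of_real t))) \<le> d powr (- \<sigma>) * weight 0 t"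
    if y: "y \<in> ball x r" for y t
  proof (cases "0 < t \<and> t < 1")
    case True
    have "norm ((1 - of_real t * y) powr (- of_real \<sigma>)) = norm (1 - of_real t * y) powr (- \<sigma>)"
      by (subst norm_powr_real_powr') auto
    also have "\<dots> \<le> d powr (- \<sigma>)" using r y True \<sigma> by (intro powr_mono2') auto
    finally have "norm ((1 - of_real t * y) powr (- of_real \<sigma>)) * (norm (g t) / t) \<le> d powr (- \<sigma>) * weight 0 t"
      using norm_g_le_weight[of t 0] True by (intro mult_mono) auto
    then show ?thesis using True by (simp add: norm_mult norm_divide)
  qed (auto simp: weight_eq_0)
  then show "\<exists>r>0. \<exists>B\<ge>0. ball x r \<subseteq> slit_plane \<and> (\<forall>y\<in>ball x r. \<forall>t.
      norm (indicator {0<..<1} t *\<^sub>R ((1 - of_real t * y) powr (- of_real \<sigma>) * (g t / of_real t))) \<le> B * weight 0 t)"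
    using r by (intro exI[of _ r] conjI exI[of _ "d powr (- \<sigma>)"]) auto
qed

text \<open>Termwise integration: since 0 < t < 1, the binomial series at t x is dominated by the
  one at |x|, times the integrable weight.\<close>

lemma euler_integral_sums:
  assumes \<sigma>: "\<sigma> > 0" and x: "norm x < 1"
  shows "(\<lambda>n. of_real (pochhammer \<sigma> n / fact n) * x ^ n * (LBINT t:{0<..<1}. of_real (t ^ n) * (g t / of_real t)))
    sums euler_integral \<sigma> x"
proof -
  let ?c = "\<lambda>n. pochhammer \<sigma> n / fact n"
  let ?f = "\<lambda>n t. indicator {0<..<1} t *\<^sub>R (of_real (?c n) * (of_real t * x) ^ n * (g t / of_real t))"
  have c: "?c n \<ge> 0" for n using \<sigma> by (simp add: pochhammer_nonneg)
  \<comment> \<open>At the real point |x| the binomial series has nonnegative terms, so its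
    summability is the absolute summability wanted for x.\<close>
  have "summable (\<lambda>n. of_real (?c n) * of_real (norm x) ^ n :: complex)"
    by (rule sums_summable[OF binomial_pochhammer_sums]) (use x in simp)
  then have sc: "summable (\<lambda>n. ?c n * norm x ^ n)"
    by (subst (asm) of_real_power[symmetric], subst (asm) of_real_mult[symmetric]) (simp only: summable_complex_of_real)
  have bnd: "norm (?f n t) \<le> ?c n * norm x ^ n * weight 0 t" for n t
  proof (cases "0 < t \<and> t < 1")
    case True
    then have "t ^ n \<le> 1" by (intro power_le_one) auto
    then have "(t * norm x) ^ n \<le> norm x ^ n"
      by (simp add: power_mult_distrib mult_left_le_one_le True less_imp_le)
    then have "?c n * (t * norm x) ^ n * (norm (g t) / t) \<le> ?c n * norm x ^ n * weight 0 t"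
      using norm_g_le_weight[of t 0] True c[of n]
      by (intro mult_mono mult_nonneg_nonneg) auto
    moreover have "pochhammer \<sigma> n \<ge> 0" using \<sigma> by (rule pochhammer_nonneg)
    ultimately show ?thesis using True by (simp add: norm_mult norm_divide norm_power)
  qed (auto simp: weight_eq_0)
  have w: "integrable lborel (weight 0)" by (rule integrable_weight[OF mu])
  have int: "integrable lborel (?f n)" for n
  proof (rule Bochner_Integration.integrable_bound)
    show "integrable lborel (\<lambda>t. ?c n * norm x ^ n * weight 0 t)" using w by simp
    show "AE t in lborel. norm (?f n t) \<le> norm (?c n * norm x ^ n * weight 0 t)"
      by (intro AE_I2 order_trans[OF bnd]) (simp only: real_norm_def abs_ge_self)
  qed measurable
  have "(\<lambda>n. LINT t|lborel. ?f n t) sums (LINT t|lborel. (\<Sum>n. ?f n t))"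
  proof (rule sums_integral[OF int])
    show "AE t in lborel. summable (\<lambda>n. norm (?f n t))"
    proof (intro AE_I2)
      fix t
      show "summable (\<lambda>n. norm (?f n t))"
        by (rule summable_comparison_test'[OF summable_mult2[OF sc, of "weight 0 t"]])
          (use bnd in simp)
    qed
    show "summable (\<lambda>n. LINT t|lborel. norm (?f n t))"
    proof (rule summable_comparison_test'[OF summable_mult2[OF sc, of "integral\<^sup>L lborel (weight 0)"]])
      fix n :: nat
      have "(LINT t|lborel. norm (?f n t)) \<le> (LINT t|lborel. ?c n * norm x ^ n * weight 0 t)"
        using int w bnd by (intro integral_mono integrable_norm) auto
      then show "norm (LINT t|lborel. norm (?f n t)) \<le> ?c n * norm x ^ n * integral\<^sup>L lborel (weight 0)"
        by simp
    qed
  qed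
  moreover have "(LINT t|lborel. (\<Sum>n. ?f n t)) = euler_integral \<sigma> x"
    unfolding euler_integral_def set_lebesgue_integral_def
  proof (intro Bochner_Integration.integral_cong refl)
    fix t
    show "(\<Sum>n. ?f n t) = indicator {0<..<1} t *\<^sub>R ((1 - of_real t * x) powr (- of_real \<sigma>) * (g t / of_real t))"
    proof (cases "t \<in> {0<..<1}")
      case True
      then have "norm (of_real t * x) < 1"
        using x mult_strict_mono[of t 1 "norm x" 1] by (cases "x = 0") (auto simp: norm_mult)
      from sums_mult2[OF binomial_pochhammer_sums[OF this, of \<sigma>], of "g t / of_real t"] show ?thesis
        using True by (simp add: sums_iff)
    qed simp
  qed
  moreover have "(LINT t|lborel. ?f n t) = of_real (?c n) * x ^ n * (LBINT t:{0<..<1}. of_real (t ^ n) * (g t / of_real t))" for n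
  proof -
    have "(LINT t|lborel. ?f n t) = (LBINT t:{0<..<1}. (of_real (?c n) * x ^ n) * (of_real (t ^ n) * (g t / of_real t)))"
      unfolding set_lebesgue_integral_def
      by (intro Bochner_Integration.integral_cong refl) (simp add: power_mult_distrib)
    then show ?thesis by (simp only: set_integral_mult_right)
  qed
  ultimately show ?thesis by simp
qed

lemma set_integrable_stieltjes_density:
  assumes \<sigma>: "\<sigma> \<ge> 2" and y: "y > 0"
  shows "set_integrable lborel {0<..<1} (\<lambda>t. of_real (stieltjes_density \<sigma> (t * y) / t) * g t)"
  unfolding set_integrable_def
proof (rule Bochner_Integration.integrable_bound[OF integrable_weight[OF mu]])
  show "AE t in lborel. norm (indicator {0<..<1} t *\<^sub>R (of_real (stieltjes_density \<sigma> (t * y) / t) * g t)) \<le> norm (weight 0 t)"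
  proof (intro AE_I2)
    fix t
    show "norm (indicator {0<..<1} t *\<^sub>R (of_real (stieltjes_density \<sigma> (t * y) / t) * g t)) \<le> norm (weight 0 t)"
    proof (cases "0 < t \<and> t < 1")
      case True
      have "\<bar>stieltjes_density \<sigma> (t * y)\<bar> \<le> (t * y) powr (- 0)"
        using True y \<sigma> by (intro abs_stieltjes_density_le) auto
      then have "\<bar>stieltjes_density \<sigma> (t * y)\<bar> * (norm (g t) / t) \<le> 1 * weight 0 t"
        using True y norm_g_le_weight[of t 0] by (intro mult_mono) auto
      then have "norm (of_real (stieltjes_density \<sigma> (t * y) / t) * g t) \<le> weight 0 t"
        using True by (simp add: norm_mult norm_divide)
      then show ?thesis using True abs_ge_self[of "weight 0 t"] by simp
    qed (auto simp: weight_eq_0)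
  qed
qed measurable

text \<open>For each t the kernel is replaced by its Stieltjes integral over y, and the order of
  integration is exchanged. The majorant has to be a product of a function of y and a function of
  t.\<close>

lemma euler_integral_stieltjes:
  fixes z :: complex
  assumes \<sigma>: "\<sigma> \<ge> 2" and z: "z \<noteq> 0" "\<bar>Arg z\<bar> < pi / \<sigma>"
  defines "q \<equiv> \<lambda>y. of_real (y powr (\<sigma> - 1)) / (of_real (y powr \<sigma>) + z powr of_real \<sigma>) *
      (LBINT t:{0<..<1}. of_real (stieltjes_density \<sigma> (t * y) / t) * g t)"
  shows "set_integrable lborel {0<..} q"
    and "euler_integral \<sigma> (- z) = of_real (\<sigma> / pi) * (LBINT y:{0<..}. q y)"
proof -
  let ?w = "z powr of_real \<sigma>"
  have "\<bar>\<sigma> * Arg z\<bar> < pi" using z \<sigma> by (simp add: abs_mult field_simps)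
  then have "?w \<notin> \<real>\<^sub>\<le>\<^sub>0" using z by (intro powr_notin_nonpos_Reals)
  then obtain c where c: "c > 0" "\<And>x. x \<ge> 0 \<Longrightarrow> norm (of_real x + ?w) \<ge> c * (1 + x)"
    using shifted_slit_lower_bound by blast
  \<comment> \<open>Exponent 0 would leave a y-majorant of order 1/y at infinity, while an exponent
    of \<open>\<mu>\<close> or more would make the weight non-integrable at t = 0 in general; any
    value strictly between 0 and both \<open>\<mu>\<close> and \<open>\<sigma>\<close>
    works.\<close>
  define \<kappa> where "\<kappa> = min \<mu> 1 / 2"
  have \<kappa>: "0 < \<kappa>" "\<kappa> < \<mu>" "\<kappa> < \<sigma>" using mu \<sigma> by (auto simp: \<kappa>_def)
  define G where "G y t = indicator {0<..} y *\<^sub>R indicator {0<..<1} t *\<^sub>R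
      (of_real (y powr (\<sigma> - 1)) / (of_real (y powr \<sigma>) + ?w) * (of_real (stieltjes_density \<sigma> (t * y) / t) * g t))" for y t
  have G_measurable: "(\<lambda>(y, t). G y t) \<in> borel_measurable (lborel \<Otimes>\<^sub>M lborel)"
    unfolding G_def by measurable
  define a where "a y = indicator {0<..} y *\<^sub>R (1 / c * (y powr (\<sigma> - 1 - \<kappa>) / (1 + y powr \<sigma>)))" for y
  have a: "integrable lborel a"
    unfolding a_def set_integrable_def[symmetric]
    by (intro set_integrable_mult_right set_integrable_powr_over_one_plus_powr \<kappa>)
  have bound: "norm (G y t) \<le> a y * weight \<kappa> t" for y t
  proof (cases "0 < y \<and> 0 < t \<and> t < 1")
    case True
    have "\<bar>stieltjes_density \<sigma> (t * y)\<bar> \<le> (t * y) powr (- \<kappa>)"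
      using True \<kappa> \<sigma> by (intro abs_stieltjes_density_le) auto
    also have "\<dots> = y powr (- \<kappa>) * t powr (- \<kappa>)" using True by (simp add: powr_mult)
    finally have 1: "\<bar>stieltjes_density \<sigma> (t * y)\<bar> \<le> y powr (- \<kappa>) * t powr (- \<kappa>)" .
    have "norm (G y t) = y powr (\<sigma> - 1) / norm (of_real (y powr \<sigma>) + ?w) * (\<bar>stieltjes_density \<sigma> (t * y)\<bar> * (norm (g t) / t))"
      using True by (simp add: G_def norm_mult norm_divide)
    also have "\<dots> \<le> y powr (\<sigma> - 1) / (c * (1 + y powr \<sigma>)) * ((y powr (- \<kappa>) * t powr (- \<kappa>)) * (norm (g t) / t))"
      using True 1 c by (intro mult_mono frac_le) (auto intro!: mult_pos_pos add_pos_nonneg)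
    also have "\<dots> = (y powr (\<sigma> - 1) * y powr (- \<kappa>)) / (c * (1 + y powr \<sigma>)) * (t powr (- \<kappa>) * (norm (g t) / t))"
      by simp
    also have "y powr (\<sigma> - 1) * y powr (- \<kappa>) = y powr (\<sigma> - 1 - \<kappa>)" by (simp flip: powr_add)
    also have "y powr (\<sigma> - 1 - \<kappa>) / (c * (1 + y powr \<sigma>)) * (t powr (- \<kappa>) * (norm (g t) / t)) \<le>
        y powr (\<sigma> - 1 - \<kappa>) / (c * (1 + y powr \<sigma>)) * weight \<kappa> t"
      using True c norm_g_le_weight by (intro mult_left_mono) auto
    finally show ?thesis using True by (simp add: a_def)
  qed (auto simp: G_def a_def weight_eq_0)
  note fub = Fubini_lborel[OF G_measurable a integrable_weight[OF \<kappa>(2)] bound]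
  have inner_t: "(LINT t|lborel. G y t) = indicator {0<..} y *\<^sub>R q y" for y
  proof -
    let ?X = "\<lambda>t. of_real (stieltjes_density \<sigma> (t * y) / t) * g t"
    have "(LINT t|lborel. G y t) = indicator {0<..} y *\<^sub>R
        (LBINT t:{0<..<1}. of_real (y powr (\<sigma> - 1)) / (of_real (y powr \<sigma>) + ?w) * ?X t)"
      unfolding G_def set_lebesgue_integral_def by (rule integral_scaleR_right)
    also have "(LBINT t:{0<..<1}. of_real (y powr (\<sigma> - 1)) / (of_real (y powr \<sigma>) + ?w) * ?X t) = q y"
      unfolding q_def by (rule set_integral_mult_right)
    finally show ?thesis .
  qed
  have inner_y: "(LINT y|lborel. G y t) = of_real (pi / \<sigma>) *
      (indicator {0<..<1} t *\<^sub>R ((1 - of_real t * (- z)) powr (- of_real \<sigma>) * (g t / of_real t)))" for t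
  proof (cases "0 < t \<and> t < 1")
    case True
    let ?k = "\<lambda>y. complex_of_real (y powr (\<sigma> - 1) * stieltjes_density \<sigma> (t * y)) / (of_real (y powr \<sigma>) + ?w)"
    have "G y t = (indicator {0<..} y *\<^sub>R ?k y) * (g t / of_real t)" for y
      using True by (cases "y > 0") (simp_all add: G_def)
    then have "(LINT y|lborel. G y t) = (LBINT y:{0<..}. ?k y) * (g t / of_real t)"
      by (simp only: set_lebesgue_integral_def integral_mult_left_zero)
    also have "(LBINT y:{0<..}. ?k y) = of_real (pi / \<sigma>) * (1 + of_real t * z) powr (- of_real \<sigma>)"
      using \<sigma> True z by (subst stieltjes_binomial) auto
    finally show ?thesis using True by simp
  qed (auto simp: G_def)
  show "set_integrable lborel {0<..} q"
    using fub(1) unfolding inner_t set_integrable_def .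
  have "(LBINT y:{0<..}. q y) = of_real (pi / \<sigma>) * euler_integral \<sigma> (- z)"
    using fub(2) unfolding inner_t inner_y integral_mult_right_zero
    by (simp only: set_lebesgue_integral_def euler_integral_def)
  then show "euler_integral \<sigma> (- z) = of_real (\<sigma> / pi) * (LBINT y:{0<..}. q y)"
    using \<sigma> by (simp add: field_simps)
qed

end

section \<open>The hypergeometric function\<close>

lemma foldl_mult_eq_prod_list:
  fixes f :: "'a \<Rightarrow> 'b::comm_monoid_mult"
  shows "foldl (\<lambda>r a. r * f a) v xs = v * (\<Prod>a\<leftarrow>xs. f a)"
  by (induction xs arbitrary: v) (auto simp: mult.assoc)

lemma prod_list_pochhammer_Gamma:
  assumes "\<forall>a\<in>set A. 0 < a"
  shows "(\<Prod>a\<leftarrow>A. pochhammer (complex_of_real a) n) * (\<Prod>a\<leftarrow>A. Gamma (of_real a)) = (\<Prod>a\<leftarrow>A. Gamma (of_real a + of_nat n))"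
  using assms
proof (induction A)
  case (Cons a A)
  then have "complex_of_real a \<notin> \<int>\<^sub>\<le>\<^sub>0" by (intro Re_pos_notin_nonpos_Ints) simp
  then have "pochhammer (complex_of_real a) n * Gamma (of_real a) = Gamma (of_real a + of_nat n)"
    by (simp add: pochhammer_Gamma Gamma_eq_zero_iff)
  with Cons show ?case by (simp add: mult_ac)
qed simp

text \<open>Up to a constant factor the coefficient is a binomial coefficient times h(n), the shape
  that termwise integration of the Euler integral yields once the moments are known.\<close>

lemma fps_hypergeo_nth_gamma_ratio:
  assumes A: "\<forall>a\<in>set A. 0 < a" and B: "\<forall>b\<in>set B. 0 < b"
  shows "fps_hypergeo (map complex_of_real (\<sigma> # A)) (map complex_of_real B) 1 $ n =
    (\<Prod>b\<leftarrow>B. Gamma (of_real b)) / (\<Prod>a\<leftarrow>A. Gamma (of_real a)) *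
    (of_real (pochhammer \<sigma> n / fact n) * gamma_ratio A B (of_nat n))"
proof -
  have nz: "(\<Prod>a\<leftarrow>A. Gamma (complex_of_real a)) \<noteq> 0" "(\<Prod>b\<leftarrow>B. Gamma (complex_of_real b)) \<noteq> 0"
    using prod_list_Gamma_nonzero[of A 0] prod_list_Gamma_nonzero[of B 0] A B by auto
  have "fps_hypergeo (map complex_of_real (\<sigma> # A)) (map complex_of_real B) 1 $ n =
      pochhammer (of_real \<sigma>) n * (\<Prod>a\<leftarrow>A. pochhammer (of_real a) n) / ((\<Prod>b\<leftarrow>B. pochhammer (of_real b) n) * fact n)"
    unfolding fps_hypergeo_nth foldl_mult_eq_prod_list by (simp add: o_def)
  also have "(\<Prod>a\<leftarrow>A. pochhammer (complex_of_real a) n) = (\<Prod>a\<leftarrow>A. Gamma (of_real a + of_nat n)) / (\<Prod>a\<leftarrow>A. Gamma (of_real a))"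
    using prod_list_pochhammer_Gamma[OF A, of n] nz(1) by (simp add: nonzero_eq_divide_eq)
  also have "(\<Prod>b\<leftarrow>B. pochhammer (complex_of_real b) n) = (\<Prod>b\<leftarrow>B. Gamma (of_real b + of_nat n)) / (\<Prod>b\<leftarrow>B. Gamma (of_real b))"
    using prod_list_pochhammer_Gamma[OF B, of n] nz(2) by (simp add: nonzero_eq_divide_eq)
  finally show ?thesis
    by (simp add: gamma_ratio_def pochhammer_of_real mult_ac)
qed

lemma prod_nth_Gamma_ratio:
  assumes "length A = length B"
  shows "complex_of_real (\<Prod>i<length A. Gamma (B ! i) / Gamma (A ! i)) =
    (\<Prod>b\<leftarrow>B. Gamma (of_real b)) / (\<Prod>a\<leftarrow>A. Gamma (of_real a))"
  using assms
  by (simp add: prod.list_conv_set_nth atLeast0LessThan prod_dividef Gamma_complex_of_real)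

theorem corollary1:
  fixes q :: nat and A B :: "real list" and \<sigma> c :: real and z :: complex
  assumes "q \<ge> 1" and "length A = q" and "length B = q"
    and "B \<prec>\<^sup>W A"
    and "(\<Sum>i<q. B ! i - A ! i) > 0"
    and "c > - Min (set A)"
    and "\<sigma> \<ge> 2"
    and "z \<noteq> 0" and "\<bar>Arg z\<bar> < pi / \<sigma>"
  shows "(\<forall>y>0. set_integrable lborel {0<..<1} (phi_integrand c \<sigma> A B y)) \<and>
    set_integrable lborel {0<..}
      (\<lambda>y. phi c \<sigma> A B y / (complex_of_real (y powr \<sigma>) + z powr complex_of_real \<sigma>)) \<and>
    hypergeometric_F \<sigma> A B (- z) =
      (LBINT y:{0<..}. phi c \<sigma> A B y / (complex_of_real (y powr \<sigma>) + z powr complex_of_real \<sigma>))"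
proof -
  obtain a0 A' b0 B' where AB: "A = a0 # A'" "B = b0 # B'"
    using assms(1-3) by (metis length_0_conv neq_Nil_conv not_one_le_zero)
  have maj: "sorted A" "sorted B" "\<forall>a\<in>set A. 0 < a" "\<forall>b\<in>set B. 0 < b"
    "\<forall>k\<in>{1..length A}. sum_list (take k A) \<le> sum_list (take k B)"
    using assms(4) by (auto simp: weak_supermajorized_def)
  \<comment> \<open>The case k = 1 of the majorization. It makes \<open>a0\<close> a lower bound of
    both lists and hence a common reference point for the Gamma factors.\<close>
  have "a0 \<le> b0" using bspec[OF maj(5), of 1] by (simp add: AB)
  then have geA: "\<forall>a\<in>set A. a0 \<le> a" and geB: "\<forall>b\<in>set B. a0 \<le> b"
    using maj(1,2) by (auto simp: AB)
  have a0: "a0 > 0" using maj(3) by (simp add: AB)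
  have Min: "Min (set A) = a0" using geA by (intro Min_eqI) (auto simp: AB)
  \<comment> \<open>The midpoint between max(0, -c) and \<open>a0\<close>: positive for
    integrability at t = 0, below \<open>a0\<close> for holomorphy, and above -c so that the given
    line lies to the right of Re s = -\<open>\<mu>\<close>.\<close>
  define \<mu> where "\<mu> = (max 0 (- c) + a0) / 2"
  have \<mu>: "0 < \<mu>" "\<mu> < a0" using a0 assms(6) by (auto simp: \<mu>_def Min)
  have "- c < a0" using assms(6) Min by simp
  then have c: "c > - \<mu>" using a0 by (simp add: \<mu>_def max_def field_simps)
  define \<psi> where "\<psi> = sum_list B - sum_list A"
  have \<psi>: "\<psi> > 0"
    using assms(2,3,5) by (simp add: \<psi>_def sum_list_sum_nth atLeast0LessThan sum_subtractf)
  obtain C where C: "C > 0"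
    "\<And>s. Re s \<ge> - \<mu> \<Longrightarrow> norm (gamma_ratio A B s) \<le> C * (1 + norm (s + of_real \<mu>)) powr (sum_list A - sum_list B)"
    "\<And>s. Re s \<ge> - \<mu> \<Longrightarrow> norm (deriv (gamma_ratio A B) s) \<le> C * (1 + norm (s + of_real \<mu>)) powr (sum_list A - sum_list B - 1)"
    using gamma_ratio_bounds[of A B a0 \<mu>] assms(2,3) geA geB \<mu>(2) \<psi> by (auto simp: \<psi>_def)
  interpret M: mellin_kernel "gamma_ratio A B" a0 \<mu> \<psi> C
  proof
    show "gamma_ratio A B holomorphic_on {s. Re s > - a0}"
      using gamma_ratio_has_field_derivative[OF geA geB] open_halfspace_Re_gt[of "- a0"]
      by (auto simp: holomorphic_on_open)
  qed (use \<mu> \<psi> C in \<open>simp_all add: \<psi>_def\<close>)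
  interpret E: beta_dominated M.mellin_inv M.K \<mu> M.\<delta>
    by standard (use M.delta M.norm_mellin_inv_le \<mu> in auto)
  have G: "meijer_G c B A t = M.mellin_inv t" if "0 < t" "t < 1" for t
    using M.vertical_integral_tendsto[OF that c] unfolding meijer_G_def gamma_ratio_def
    by (intro tendsto_Lim) (auto simp: trivial_limit_at_top_linorder)
  define P where "P = (\<Prod>i<length A. Gamma (B ! i) / Gamma (A ! i))"
  have P: "complex_of_real P = (\<Prod>b\<leftarrow>B. Gamma (of_real b)) / (\<Prod>a\<leftarrow>A. Gamma (of_real a))"
    unfolding P_def using assms(2,3) by (intro prod_nth_Gamma_ratio) simp
  \<comment> \<open>\<open>\<sigma>\<close> >= 2 puts z in the right half-plane, so that -z stays
    away from the cut [1, infinity).\<close>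
  have "\<bar>Im (Ln z)\<bar> < pi / 2"
  proof -
    have "pi / \<sigma> \<le> pi / 2" using assms(7) by (intro divide_left_mono) auto
    moreover have "\<bar>Im (Ln z)\<bar> < pi / \<sigma>" using assms(8,9) by (simp add: Arg_eq_Im_Ln)
    ultimately show ?thesis by linarith
  qed
  then have "Re z > 0" using Re_Ln_pos_lt[OF assms(8)] by simp
  then have slit: "- z \<in> slit_plane" by (auto simp: slit_plane_def dest: arg_cong[where f = Re])
  \<comment> \<open>Uniqueness of the continuation identifies the chosen function with the multiple
    of the Euler integral that has the same power series on the unit disc.\<close>
  have F: "hypergeometric_F \<sigma> A B (- z) = of_real P * E.euler_integral \<sigma> (- z)"
  proof (rule hypergeometric_F_eqI[OF _ _ slit])
    show "(\<lambda>x. of_real P * E.euler_integral \<sigma> x) holomorphic_on slit_plane"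
      using assms(7) by (intro holomorphic_intros E.holomorphic_euler_integral) simp
    fix x :: complex assume "x \<in> ball 0 1"
    then have "norm x < 1" by simp
    from sums_mult[OF E.euler_integral_sums[OF _ this, of \<sigma>], of "of_real P"] assms(7)
    have "(\<lambda>n. fps_hypergeo (map complex_of_real (\<sigma> # A)) (map complex_of_real B) 1 $ n * x ^ n)
        sums (of_real P * E.euler_integral \<sigma> x)"
      unfolding M.moment_mellin_inv P fps_hypergeo_nth_gamma_ratio[OF maj(3,4)] by (simp only: mult_ac)
    then show "of_real P * E.euler_integral \<sigma> x =
        eval_fps (fps_hypergeo (map complex_of_real (\<sigma> # A)) (map complex_of_real B) 1) x"
      unfolding eval_fps_def by (rule sums_unique)
  qed
  \<comment> \<open>\<open>meijer_G\<close> has been identified with \<open>mellin_inv\<close> on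
    (0, 1), so the integrands are compared as functions on this set.\<close>
  have integrand: "phi_integrand c \<sigma> A B y t = of_real (stieltjes_density \<sigma> (t * y) / t) * M.mellin_inv t"
    if "t \<in> {0<..<1}" for t y
    using that G[of t] by (simp add: phi_integrand_def stieltjes_density_def power_mult_distrib mult.assoc)
  have 1: "set_integrable lborel {0<..<1} (phi_integrand c \<sigma> A B y)" if "y > 0" for y
    using E.set_integrable_stieltjes_density[OF assms(7) that]
    by (subst set_integrable_cong[OF refl refl integrand]) auto
  let ?q = "\<lambda>y. of_real (y powr (\<sigma> - 1)) / (of_real (y powr \<sigma>) + z powr of_real \<sigma>) *
      (LBINT t:{0<..<1}. of_real (stieltjes_density \<sigma> (t * y) / t) * M.mellin_inv t)"
  have "(LBINT t:{0<..<1}. phi_integrand c \<sigma> A B y t)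
      = (LBINT t:{0<..<1}. of_real (stieltjes_density \<sigma> (t * y) / t) * M.mellin_inv t)" for y
    by (intro set_lebesgue_integral_cong) (auto simp: integrand)
  then have phi: "phi c \<sigma> A B y / (complex_of_real (y powr \<sigma>) + z powr complex_of_real \<sigma>)
      = (of_real P * of_real (\<sigma> / pi)) * ?q y" for y
    by (simp add: phi_def P_def[symmetric])
  note st = E.euler_integral_stieltjes[OF assms(7-9)]
  have 2: "set_integrable lborel {0<..}
      (\<lambda>y. phi c \<sigma> A B y / (complex_of_real (y powr \<sigma>) + z powr complex_of_real \<sigma>))"
    unfolding phi by (intro set_integrable_mult_right st(1))
  have "hypergeometric_F \<sigma> A B (- z) = (of_real P * of_real (\<sigma> / pi)) * (LBINT y:{0<..}. ?q y)"
    unfolding F st(2) by (simp only: mult.assoc)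
  also have "\<dots> = (LBINT y:{0<..}. (of_real P * of_real (\<sigma> / pi)) * ?q y)"
    by (rule set_integral_mult_right[symmetric])
  finally show ?thesis using 1 2 unfolding phi by blast
qed

end
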